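(* Let $M$ be a compact, connected, and oriented smooth Riemannian $n$-manifold without boundary isometrically embedded into $\mathbb{R}^{n+1}$, let $N$ be a Riemannian manifold, and let $h\in\operatorname{Diff}(M,N)$. If $h^*g_N=R^2g_M$ for some $R\in\mathbb{R}$, then $h$ is a critical point of the functional $\Phi$. In particular, let $h_R:\mathbb{R}^{n+1}\to\mathbb{R}^{n+1}$ be the radial map $h_R(p)=Rp$ for all $p\in\mathbb{R}^{n+1}$, where $R>0$. Assume that $N=h_R(M)$ is a rescaled version of $M$, and the Riemannian metrics $g_M$ and $g_N$ on $M$ and $N$ are inherited from $\mathbb{R}^{n+1}$. Then every composition $h=f\circ h_R|_M$ of the radial map $h_R|_M$ with an isometry $f\in\operatorname{Diff}(N)$ is a critical point of the functional $\Phi$.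
   Context: $\operatorname{Diff}(M,N)$ is the set of smooth diffeomorphisms $M\to N$, and $\Phi:\operatorname{Diff}(M,N)\to\mathbb{R}_+$ is $\Phi(h)=\int_M\|h^*g_N-g_M\|^2\,\omega_M$, where $\omega_M$ is the volume form of $(M,g_M)$ and $\|\cdot\|$ is the fiber norm on $(0,2)$-tensors on $M$ induced by $g_M^*\otimes g_M^*$. $h$ is a critical point of $\Phi$ if $\frac{d}{dt}\Phi(h\circ\phi_t)|_{t=0}=0$ for the flow $\phi_t$ of every smooth vector field on $M$. *)

theory Defs
  imports "HOL-Analysis.Analysis"
begin

subsection \<open>Smooth maps between Euclidean spaces\<close>

text \<open>\<open>Ck_on k S f\<close>: \<open>f\<close> is \<open>k\<close> times continuously differentiable on \<open>S\<close>. Derivatives are taken with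
  respect to the full neighbourhood filter, so this is meant for open \<open>S\<close>.\<close>

fun Ck_on :: "nat \<Rightarrow> 'a::real_normed_vector set \<Rightarrow> ('a \<Rightarrow> 'b::real_normed_vector) \<Rightarrow> bool" where
  "Ck_on 0 S f \<longleftrightarrow> continuous_on S f"
| "Ck_on (Suc k) S f \<longleftrightarrow>
     (\<forall>x\<in>S. f differentiable (at x)) \<and> (\<forall>v. Ck_on k S (\<lambda>x. frechet_derivative f (at x) v))"

definition smooth_on :: "'a::real_normed_vector set \<Rightarrow> ('a \<Rightarrow> 'b::real_normed_vector) \<Rightarrow> bool" where
  "smooth_on S f \<longleftrightarrow> (\<forall>k. Ck_on k S f)"

subsection \<open>Smooth manifolds\<close>

text \<open>A chart is a pair of its domain and its coordinate map; values of the coordinate map outside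
  the domain are irrelevant.\<close>

type_synonym ('p, 'n) chart = "'p set \<times> ('p \<Rightarrow> real^'n)"

abbreviation cdom :: "('p, 'n::finite) chart \<Rightarrow> 'p set" where "cdom c \<equiv> fst c"
abbreviation cmap :: "('p, 'n::finite) chart \<Rightarrow> 'p \<Rightarrow> real^'n" where "cmap c \<equiv> snd c"
abbreviation cinv :: "('p, 'n::finite) chart \<Rightarrow> real^'n \<Rightarrow> 'p" where
  "cinv c \<equiv> inv_into (cdom c) (cmap c)"

record ('p, 'n::finite) manifold =
  mtop :: "'p topology"
  atlas :: "('p, 'n) chart set"

abbreviation carrier_of :: "('p, 'n::finite) manifold \<Rightarrow> 'p set" where
  "carrier_of M \<equiv> topspace (mtop M)"

definition coord_rep ::
  "('p, 'n::finite) chart \<Rightarrow> ('p \<Rightarrow> 'q) \<Rightarrow> ('q, 'k::finite) chart \<Rightarrow> real^'n \<Rightarrow> real^'k" where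
  "coord_rep c F d = cmap d \<circ> F \<circ> cinv c"

text \<open>The atlas need not be maximal; it determines the smooth structure. Charts are onto open subsets
  of the whole of Euclidean space, so there is no boundary.\<close>

definition smooth_manifold :: "('p, 'n::finite) manifold \<Rightarrow> bool" where
  "smooth_manifold M \<longleftrightarrow>
     Hausdorff_space (mtop M) \<and> second_countable (mtop M) \<and>
     carrier_of M = (\<Union>c\<in>atlas M. cdom c) \<and>
     (\<forall>c\<in>atlas M. openin (mtop M) (cdom c) \<and> open (cmap c ` cdom c) \<and>
        homeomorphic_map (subtopology (mtop M) (cdom c)) (top_of_set (cmap c ` cdom c)) (cmap c)) \<and>
     (\<forall>c\<in>atlas M. \<forall>d\<in>atlas M. smooth_on (cmap c ` (cdom c \<inter> cdom d)) (coord_rep c id d))"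

text \<open>An orientation is given by an atlas all of whose transition maps have positive Jacobian
  determinant; its charts are the positively oriented ones.\<close>

definition oriented_manifold :: "('p, 'n::finite) manifold \<Rightarrow> bool" where
  "oriented_manifold M \<longleftrightarrow> smooth_manifold M \<and>
     (\<forall>c\<in>atlas M. \<forall>d\<in>atlas M. \<forall>p\<in>cdom c \<inter> cdom d.
        det (matrix (frechet_derivative (coord_rep c id d) (at (cmap c p)))) > 0)"

definition smooth_map ::
  "('p, 'n::finite) manifold \<Rightarrow> ('q, 'k::finite) manifold \<Rightarrow> ('p \<Rightarrow> 'q) \<Rightarrow> bool" where
  "smooth_map M N F \<longleftrightarrow> continuous_map (mtop M) (mtop N) F \<and>
     (\<forall>c\<in>atlas M. \<forall>d\<in>atlas N. smooth_on (cmap c ` {p \<in> cdom c. F p \<in> cdom d}) (coord_rep c F d))"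

definition Diff ::
  "('p, 'n::finite) manifold \<Rightarrow> ('q, 'k::finite) manifold \<Rightarrow> ('p \<Rightarrow> 'q) set" where
  "Diff M N = {h. bij_betw h (carrier_of M) (carrier_of N) \<and> smooth_map M N h \<and>
                  smooth_map N M (inv_into (carrier_of M) h)}"

subsection \<open>Tangent vectors\<close>

text \<open>A tangent vector at \<open>p\<close> is the family of its coordinate vectors in all charts around \<open>p\<close>, related
  by the derivatives of the transition maps (and \<open>0\<close> at all other charts, so that equality of
  tangent vectors is equality of functions).\<close>

type_synonym ('p, 'n) tangent = "('p, 'n) chart \<Rightarrow> real^'n"

definition charts_at :: "('p, 'n::finite) manifold \<Rightarrow> 'p \<Rightarrow> ('p, 'n) chart set" where
  "charts_at M p = {c \<in> atlas M. p \<in> cdom c}"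

definition chart_at :: "('p, 'n::finite) manifold \<Rightarrow> 'p \<Rightarrow> ('p, 'n) chart" where
  "chart_at M p = (SOME c. c \<in> charts_at M p)"

definition tangent_space :: "('p, 'n::finite) manifold \<Rightarrow> 'p \<Rightarrow> ('p, 'n) tangent set" where
  "tangent_space M p =
     {v. (\<forall>c\<in>charts_at M p. \<forall>d\<in>charts_at M p.
            v d = frechet_derivative (coord_rep c id d) (at (cmap c p)) (v c)) \<and>
         (\<forall>c. c \<notin> charts_at M p \<longrightarrow> v c = 0)}"

text \<open>The differential \<open>dF\<^sub>p\<close>, computed in some chart around \<open>p\<close>; on tangent vectors the choice of
  the chart does not matter.\<close>

definition differential ::
  "('p, 'n::finite) manifold \<Rightarrow> ('q, 'k::finite) manifold \<Rightarrow> ('p \<Rightarrow> 'q) \<Rightarrow> 'p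
     \<Rightarrow> ('p, 'n) tangent \<Rightarrow> ('q, 'k) tangent" where
  "differential M N F p v = (\<lambda>d.
     if d \<in> charts_at N (F p)
     then frechet_derivative (coord_rep (chart_at M p) F d) (at (cmap (chart_at M p) p))
            (v (chart_at M p))
     else 0)"

text \<open>The coordinate vector \<open>\<partial>/\<partial>x\<^sub>i\<close> at \<open>p\<close> of the chart \<open>c\<close>.\<close>

definition coord_vec ::
  "('p, 'n::finite) manifold \<Rightarrow> ('p, 'n) chart \<Rightarrow> 'p \<Rightarrow> 'n \<Rightarrow> ('p, 'n) tangent" where
  "coord_vec M c p i = (\<lambda>d.
     if d \<in> charts_at M p
     then frechet_derivative (coord_rep c id d) (at (cmap c p)) (axis i 1)
     else 0)"

definition smooth_vector_field ::
  "('p, 'n::finite) manifold \<Rightarrow> ('p \<Rightarrow> ('p, 'n) tangent) \<Rightarrow> bool" where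
  "smooth_vector_field M X \<longleftrightarrow>
     (\<forall>p\<in>carrier_of M. X p \<in> tangent_space M p) \<and>
     (\<forall>c\<in>atlas M. smooth_on (cmap c ` cdom c) (\<lambda>x. X (cinv c x) c))"

text \<open>\<open>\<phi>\<close> is the global flow of \<open>X\<close>: a smooth map \<open>\<real> \<times> M \<rightarrow> M\<close> with \<open>\<phi> 0 = id\<close> whose curves
  \<open>t \<mapsto> \<phi> t p\<close> are integral curves of \<open>X\<close>.\<close>

definition is_flow ::
  "('p, 'n::finite) manifold \<Rightarrow> ('p \<Rightarrow> ('p, 'n) tangent) \<Rightarrow> (real \<Rightarrow> 'p \<Rightarrow> 'p) \<Rightarrow> bool" where
  "is_flow M X \<phi> \<longleftrightarrow>
     (\<forall>p\<in>carrier_of M. \<phi> 0 p = p) \<and>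
     (\<forall>t. \<forall>p\<in>carrier_of M. \<phi> t p \<in> carrier_of M) \<and>
     (\<forall>t. \<forall>p\<in>carrier_of M. \<forall>d\<in>charts_at M (\<phi> t p).
        ((\<lambda>s. cmap d (\<phi> s p)) has_vector_derivative X (\<phi> t p) d) (at t)) \<and>
     (\<forall>t. \<forall>p\<in>carrier_of M. \<forall>c\<in>charts_at M p. \<forall>d\<in>charts_at M (\<phi> t p).
        \<exists>W. open W \<and> (t, cmap c p) \<in> W \<and>
            (\<forall>(s, y)\<in>W. y \<in> cmap c ` cdom c \<and> \<phi> s (cinv c y) \<in> cdom d) \<and>
            smooth_on W (\<lambda>(s, y). cmap d (\<phi> s (cinv c y))))"

subsection \<open>Riemannian metrics\<close>

text \<open>A field of bilinear forms, i.e. a \<open>(0,2)\<close>-tensor field; only its values on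
  \<open>tangent_space M p\<close> for \<open>p\<close> in \<open>M\<close> are meaningful.\<close>

type_synonym ('p, 'n) tensor2 = "'p \<Rightarrow> ('p, 'n) tangent \<Rightarrow> ('p, 'n) tangent \<Rightarrow> real"

definition riemannian_manifold ::
  "('p, 'n::finite) manifold \<Rightarrow> ('p, 'n) tensor2 \<Rightarrow> bool" where
  "riemannian_manifold M g \<longleftrightarrow> smooth_manifold M \<and>
     (\<forall>p\<in>carrier_of M. \<forall>u\<in>tangent_space M p. \<forall>v\<in>tangent_space M p.
        g p u v = g p v u \<and>
        (\<forall>w\<in>tangent_space M p. \<forall>a. g p (\<lambda>c. a *\<^sub>R u c + w c) v = a * g p u v + g p w v)) \<and>
     (\<forall>p\<in>carrier_of M. \<forall>u\<in>tangent_space M p. u \<noteq> (\<lambda>c. 0) \<longrightarrow> g p u u > 0) \<and>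
     (\<forall>c\<in>atlas M. \<forall>i j. smooth_on (cmap c ` cdom c)
        (\<lambda>x. g (cinv c x) (coord_vec M c (cinv c x) i) (coord_vec M c (cinv c x) j)))"

definition pullback ::
  "('p, 'n::finite) manifold \<Rightarrow> ('q, 'k::finite) manifold \<Rightarrow> ('p \<Rightarrow> 'q) \<Rightarrow> ('q, 'k) tensor2
     \<Rightarrow> ('p, 'n) tensor2" where
  "pullback M N F g p u v = g (F p) (differential M N F p u) (differential M N F p v)"

definition tensor2_eq ::
  "('p, 'n::finite) manifold \<Rightarrow> ('p, 'n) tensor2 \<Rightarrow> ('p, 'n) tensor2 \<Rightarrow> bool" where
  "tensor2_eq M S T \<longleftrightarrow>
     (\<forall>p\<in>carrier_of M. \<forall>u\<in>tangent_space M p. \<forall>v\<in>tangent_space M p. S p u v = T p u v)"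

definition isometry ::
  "('p, 'n::finite) manifold \<Rightarrow> ('p, 'n) tensor2 \<Rightarrow> ('q, 'k::finite) manifold \<Rightarrow> ('q, 'k) tensor2
     \<Rightarrow> ('p \<Rightarrow> 'q) \<Rightarrow> bool" where
  "isometry M g\<^sub>M N g\<^sub>N f \<longleftrightarrow> f \<in> Diff M N \<and> tensor2_eq M (pullback M N f g\<^sub>N) g\<^sub>M"

definition isometric_embedding ::
  "('p, 'n::finite) manifold \<Rightarrow> ('p, 'n) tensor2 \<Rightarrow> ('q, 'k::finite) manifold \<Rightarrow> ('q, 'k) tensor2
     \<Rightarrow> ('p \<Rightarrow> 'q) \<Rightarrow> bool" where
  "isometric_embedding M g\<^sub>M N g\<^sub>N F \<longleftrightarrow>
     smooth_map M N F \<and> embedding_map (mtop M) (mtop N) F \<and>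
     (\<forall>p\<in>carrier_of M. inj_on (differential M N F p) (tangent_space M p)) \<and>
     tensor2_eq M (pullback M N F g\<^sub>N) g\<^sub>M"

definition euclid :: "(real^'m::finite, 'm) manifold" where
  "euclid = \<lparr>mtop = euclidean, atlas = {(UNIV, id)}\<rparr>"

definition euclid_metric :: "(real^'m::finite, 'm) tensor2" where
  "euclid_metric p u v = u (UNIV, id) \<bullet> v (UNIV, id)"

subsection \<open>The volume form and its integral\<close>

definition metric_matrix ::
  "('p, 'n::finite) manifold \<Rightarrow> ('p, 'n) tensor2 \<Rightarrow> ('p, 'n) chart \<Rightarrow> 'p \<Rightarrow> real^'n^'n" where
  "metric_matrix M g c p = (\<chi> i j. g p (coord_vec M c p i) (coord_vec M c p j))"

text \<open>An \<open>n\<close>-form takes at each point an \<open>n\<close>-tuple of tangent vectors, indexed by \<open>'n\<close>. On an oriented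
  manifold the volume form is \<open>\<surd>(det g\<^sub>i\<^sub>j) dx\<^sub>1 \<and> \<dots> \<and> dx\<^sub>n\<close> in any positively oriented chart.\<close>

type_synonym ('p, 'n) top_form = "'p \<Rightarrow> ('n \<Rightarrow> ('p, 'n) tangent) \<Rightarrow> real"

definition volume_form ::
  "('p, 'n::finite) manifold \<Rightarrow> ('p, 'n) tensor2 \<Rightarrow> ('p, 'n) top_form" where
  "volume_form M g p v =
     sqrt (det (metric_matrix M g (chart_at M p) p)) * det (\<chi> i j. v j (chart_at M p) $ i)"

text \<open>Continuous weights suffice to integrate continuous \<open>n\<close>-forms.\<close>

definition partition_of_unity ::
  "('p, 'n::finite) manifold \<Rightarrow> ('p, 'n) chart set \<Rightarrow> (('p, 'n) chart \<Rightarrow> 'p \<Rightarrow> real) \<Rightarrow> bool" where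
  "partition_of_unity M C \<rho> \<longleftrightarrow> finite C \<and> C \<subseteq> atlas M \<and>
     (\<forall>c\<in>C. continuous_map (mtop M) euclideanreal (\<rho> c) \<and> (\<forall>p\<in>carrier_of M. 0 \<le> \<rho> c p) \<and>
            mtop M closure_of {p \<in> carrier_of M. \<rho> c p \<noteq> 0} \<subseteq> cdom c) \<and>
     (\<forall>p\<in>carrier_of M. (\<Sum>c\<in>C. \<rho> c p) = 1)"

text \<open>The integral of an \<open>n\<close>-form over a compact oriented manifold, computed with some partition of
  unity subordinate to the oriented atlas; for continuous forms the choice does not matter.\<close>

definition form_integral :: "('p, 'n::finite) manifold \<Rightarrow> ('p, 'n) top_form \<Rightarrow> real" where
  "form_integral M \<eta> =
     (let (C, \<rho>) = (SOME (C, \<rho>). partition_of_unity M C \<rho>)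
      in \<Sum>c\<in>C. integral (cmap c ` cdom c)
           (\<lambda>x. \<rho> c (cinv c x) * \<eta> (cinv c x) (coord_vec M c (cinv c x))))"

subsection \<open>The functional\<close>

text \<open>The norm on \<open>(0,2)\<close>-tensors at \<open>p\<close> induced by \<open>g\<^sup>* \<otimes> g\<^sup>*\<close>:
  \<open>\<parallel>S\<parallel>\<^sup>2 = g\<^sup>i\<^sup>k g\<^sup>j\<^sup>l S\<^sub>i\<^sub>j S\<^sub>k\<^sub>l\<close>, where \<open>(g\<^sup>i\<^sup>j)\<close> is the inverse of \<open>(g\<^sub>i\<^sub>j)\<close> and represents the dual metric \<open>g\<^sup>*\<close>.\<close>

definition fiber_norm ::
  "('p, 'n::finite) manifold \<Rightarrow> ('p, 'n) tensor2 \<Rightarrow> 'p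
     \<Rightarrow> (('p, 'n) tangent \<Rightarrow> ('p, 'n) tangent \<Rightarrow> real) \<Rightarrow> real" where
  "fiber_norm M g p S =
     (let c = chart_at M p; G = matrix_inv (metric_matrix M g c p);
          s = (\<lambda>i j. S (coord_vec M c p i) (coord_vec M c p j))
      in sqrt (\<Sum>i\<in>UNIV. \<Sum>j\<in>UNIV. \<Sum>k\<in>UNIV. \<Sum>l\<in>UNIV. G $ i $ k * G $ j $ l * s i j * s k l))"

definition Phi ::
  "('p, 'n::finite) manifold \<Rightarrow> ('p, 'n) tensor2 \<Rightarrow> ('q, 'k::finite) manifold \<Rightarrow> ('q, 'k) tensor2
     \<Rightarrow> ('p \<Rightarrow> 'q) \<Rightarrow> real" where
  "Phi M g\<^sub>M N g\<^sub>N h = form_integral M (\<lambda>p v.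
     (fiber_norm M g\<^sub>M p (\<lambda>u w. pullback M N h g\<^sub>N p u w - g\<^sub>M p u w))\<^sup>2 * volume_form M g\<^sub>M p v)"

definition critical_point ::
  "('p, 'n::finite) manifold \<Rightarrow> ('p, 'n) tensor2 \<Rightarrow> ('q, 'k::finite) manifold \<Rightarrow> ('q, 'k) tensor2
     \<Rightarrow> ('p \<Rightarrow> 'q) \<Rightarrow> bool" where
  "critical_point M g\<^sub>M N g\<^sub>N h \<longleftrightarrow> h \<in> Diff M N \<and>
     (\<forall>X \<phi>. smooth_vector_field M X \<and> is_flow M X \<phi> \<longrightarrow>
        ((\<lambda>t. Phi M g\<^sub>M N g\<^sub>N (h \<circ> \<phi> t)) has_real_derivative 0) (at 0))"

definition closed_embedded_manifold ::
  "('p, 'n::finite) manifold \<Rightarrow> ('p, 'n) tensor2 \<Rightarrow> ('p \<Rightarrow> real^'m::finite) \<Rightarrow> bool" where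
  "closed_embedded_manifold M g \<iota> \<longleftrightarrow>
     riemannian_manifold M g \<and> oriented_manifold M \<and>
     compact_space (mtop M) \<and> connected_space (mtop M) \<and>
     isometric_embedding M g euclid euclid_metric \<iota>"

end

theory Submission
  imports Defs
begin

text \<open>
  If \<open>h\<^sup>* g\<^sub>N = r g\<^sub>M\<close>, then \<open>(h \<circ> \<phi>\<^sub>t)\<^sup>* g\<^sub>N = r \<phi>\<^sub>t\<^sup>* g\<^sub>M\<close>, so that \<open>\<Phi> (h \<circ> \<phi>\<^sub>t)\<close> depends on \<open>\<phi>\<^sub>t\<^sup>* g\<^sub>M\<close> only. Its
  integrand has at \<open>t = 0\<close> the same derivative as \<open>4 r (r - 1)\<close> times the volume density of \<open>\<phi>\<^sub>t\<^sup>* g\<^sub>M\<close>;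
  and the total volume of \<open>\<phi>\<^sub>t\<^sup>* g\<^sub>M\<close> does not depend on \<open>t\<close>, because \<open>\<phi>\<^sub>t\<close> is a diffeomorphism of \<open>M\<close>.
  This replaces the divergence theorem by a change of variables, for which a continuous partition
  of unity is enough. The radial map between the embedded manifolds \<open>M\<close> and \<open>R M\<close> is a
  diffeomorphism that multiplies the metric by \<open>R\<^sup>2\<close>, and composing it with an isometry does not
  change the pullback.
\<close>

subsection \<open>The calculus of k times continuously differentiable maps\<close>

text \<open>Write a for the matrix of the pulled back metric in a chart, m for a times the inverse
  of g, and \<tau> for the trace of the derivative of m at time 0, where m = 1. There tr(m m) and tr
  m vary at the rates 2 \<tau> and \<tau>, so the integrand varies at the rate (2 r^2 - 2 r) \<tau>,
  while the square root of det m varies at the rate \<tau> / 2; this is the origin of 4 r (r - 1).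
  Three features of the definitions shape the rest. \<open>form_integral\<close> uses a chosen
  partition of unity that is merely continuous and is not carried along by the flow, so invariance
  of the volume is proved for one fixed partition, refined by its transport under the flow map.
  \<open>is_flow\<close> does not state the group law, by which \<open>\<phi> (- t)\<close> inverts
  \<open>\<phi> t\<close>, so uniqueness of integral curves is proved. \<open>fiber_norm\<close> and
  \<open>volume_form\<close> are evaluated in a chosen chart, \<open>fiber_norm\<close> moreover as
  a square root, so independence of the chart and nonnegativity come before the integrand is a
  smooth expression in m.\<close>

lemma Ck_on_cong:
  fixes f :: "'a::real_normed_vector \<Rightarrow> 'b::real_normed_vector"
  assumes "open S" "\<And>x. x \<in> S \<Longrightarrow> f x = g x" "Ck_on k S f"
  shows "Ck_on k S g"
  using assms(2,3)
proof (induction k arbitrary: f g)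
  case 0
  then show ?case by (auto cong: continuous_on_cong)
next
  case (Suc k)
  have der: "(g has_derivative frechet_derivative f (at x)) (at x)" if "x \<in> S" for x
  proof (rule has_derivative_transform_within_open[OF _ \<open>open S\<close> that])
    show "(f has_derivative frechet_derivative f (at x)) (at x)"
      using Suc.prems that by (simp add: frechet_derivative_works)
  qed (use Suc.prems in auto)
  have eq: "frechet_derivative f (at x) = frechet_derivative g (at x)" if "x \<in> S" for x
    using frechet_derivative_at[OF der[OF that]] .
  show ?case
    unfolding Ck_on.simps
  proof (intro conjI ballI allI)
    show "g differentiable at x" if "x \<in> S" for x
      using der[OF that] by (auto simp: differentiable_def)
    show "Ck_on k S (\<lambda>x. frechet_derivative g (at x) v)" for v
      by (rule Suc.IH[of "\<lambda>x. frechet_derivative f (at x) v"]) (use Suc.prems eq in auto)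
  qed
qed

text \<open>\<open>Ck_on\<close> speaks of \<open>frechet_derivative\<close>, which is defined by
  choice; uniqueness of derivatives lets any explicitly computed derivative stand in for it.\<close>

lemma Ck_on_SucI:
  fixes f :: "'a::real_normed_vector \<Rightarrow> 'b::real_normed_vector"
  assumes "open S" "\<And>x. x \<in> S \<Longrightarrow> (f has_derivative f' x) (at x)" "\<And>v. Ck_on k S (\<lambda>x. f' x v)"
  shows "Ck_on (Suc k) S f"
  unfolding Ck_on.simps
proof (intro conjI ballI allI)
  show "f differentiable at x" if "x \<in> S" for x
    using assms(2)[OF that] by (auto simp: differentiable_def)
  show "Ck_on k S (\<lambda>x. frechet_derivative f (at x) v)" for v
    by (rule Ck_on_cong[OF assms(1) _ assms(3)[of v]]) (metis assms(2) frechet_derivative_at)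
qed

lemma Ck_on_has_derivative:
  "Ck_on (Suc k) S f \<Longrightarrow> x \<in> S \<Longrightarrow> (f has_derivative frechet_derivative f (at x)) (at x)"
  by (simp add: frechet_derivative_works)

lemma Ck_on_subset: "Ck_on k S f \<Longrightarrow> T \<subseteq> S \<Longrightarrow> Ck_on k T f"
  by (induction k arbitrary: f) (auto intro: continuous_on_subset)

lemma Ck_on_Suc_imp: "Ck_on (Suc k) S f \<Longrightarrow> Ck_on k S f"
proof (induction k arbitrary: f)
  case 0
  then show ?case
    by (auto intro!: continuous_at_imp_continuous_on differentiable_imp_continuous_within)
next
  case (Suc k)
  show ?case
    unfolding Ck_on.simps(2)[of k]
  proof (intro conjI ballI allI)
    show "f differentiable at x" if "x \<in> S" for x
      using Suc.prems that by simp
    show "Ck_on k S (\<lambda>x. frechet_derivative f (at x) v)" for v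
      using Suc.prems by (intro Suc.IH) (auto simp only: Ck_on.simps(2)[of "Suc k"])
  qed
qed

lemma Ck_on_continuous_on: "Ck_on k S f \<Longrightarrow> continuous_on S f"
  by (induction k) (auto dest: Ck_on_Suc_imp simp del: Ck_on.simps(2))

text \<open>Derivatives are full derivatives at a point, so every order of differentiability is
  decided near each point. This is the entry point wherever the chart on the target side changes
  from point to point.\<close>

lemma Ck_on_local:
  assumes "\<And>x. x \<in> S \<Longrightarrow> \<exists>W. open W \<and> x \<in> W \<and> Ck_on k W f"
  shows "Ck_on k S f"
  using assms
proof (induction k arbitrary: f)
  case 0
  show ?case
    unfolding Ck_on.simps
  proof (rule continuous_at_imp_continuous_on, rule ballI)
    fix x assume "x \<in> S"
    then obtain W where "open W" "x \<in> W" "Ck_on 0 W f" using 0 by blast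
    then show "isCont f x" by (simp add: continuous_on_eq_continuous_at)
  qed
next
  case (Suc k)
  show ?case
    unfolding Ck_on.simps
  proof (intro conjI ballI allI)
    show "f differentiable at x" if "x \<in> S" for x
      using Suc.prems[OF that] by fastforce
    show "Ck_on k S (\<lambda>x. frechet_derivative f (at x) v)" for v
    proof (rule Suc.IH)
      fix x assume "x \<in> S"
      then obtain W where "open W" "x \<in> W" "Ck_on (Suc k) W f" using Suc.prems by blast
      then show "\<exists>W. open W \<and> x \<in> W \<and> Ck_on k W (\<lambda>x. frechet_derivative f (at x) v)"
        by (intro exI[of _ W]) simp
    qed
  qed
qed

lemma Ck_on_const [simp]: "Ck_on k S (\<lambda>x. c)"
  by (induction k arbitrary: c) auto

lemma Ck_on_bounded_linear:
  fixes f :: "'a::real_normed_vector \<Rightarrow> 'b::real_normed_vector"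
  assumes "open S" "Ck_on k S f" "bounded_linear L"
  shows "Ck_on k S (\<lambda>x. L (f x))"
  using assms(2)
proof (induction k arbitrary: f)
  case 0
  then show ?case
    using bounded_linear.continuous_on[OF assms(3)] by simp
next
  case (Suc k)
  show ?case
  proof (rule Ck_on_SucI[OF assms(1)])
    show "((\<lambda>x. L (f x)) has_derivative (\<lambda>v. L (frechet_derivative f (at x) v))) (at x)" if "x \<in> S" for x
      by (rule bounded_linear.has_derivative[OF assms(3) Ck_on_has_derivative[OF Suc.prems that]])
    show "Ck_on k S (\<lambda>x. L (frechet_derivative f (at x) v))" for v
      by (rule Suc.IH) (use Suc.prems in auto)
  qed
qed

lemma Ck_on_ident:
  fixes S :: "'a::real_normed_vector set"
  assumes "open S"
  shows "Ck_on k S (\<lambda>x. x)"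
proof (cases k)
  case (Suc j)
  show ?thesis
    unfolding Suc by (rule Ck_on_SucI[OF assms has_derivative_ident]) simp
qed (simp add: continuous_on_id)

lemma Ck_on_linear_map: "open S \<Longrightarrow> bounded_linear L \<Longrightarrow> Ck_on k S L"
  using Ck_on_bounded_linear[OF _ Ck_on_ident] by blast

lemma Ck_on_add:
  fixes f g :: "'a::real_normed_vector \<Rightarrow> 'b::real_normed_vector"
  assumes "open S" "Ck_on k S f" "Ck_on k S g"
  shows "Ck_on k S (\<lambda>x. f x + g x)"
  using assms(2,3)
proof (induction k arbitrary: f g)
  case 0
  then show ?case by (simp add: continuous_on_add)
next
  case (Suc k)
  show ?case
    by (rule Ck_on_SucI[OF assms(1) has_derivative_add[OF Ck_on_has_derivative Ck_on_has_derivative]])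
      (use Suc in \<open>auto\<close>)
qed

lemma Ck_on_bounded_bilinear:
  fixes f :: "'a::real_normed_vector \<Rightarrow> 'b::real_normed_vector"
    and g :: "'a \<Rightarrow> 'c::real_normed_vector"
    and B :: "'b \<Rightarrow> 'c \<Rightarrow> 'd::real_normed_vector"
  assumes "open S" "bounded_bilinear B" "Ck_on k S f" "Ck_on k S g"
  shows "Ck_on k S (\<lambda>x. B (f x) (g x))"
  using assms(3,4)
proof (induction k arbitrary: f g)
  case 0
  then show ?case
    using bounded_bilinear.continuous_on[OF assms(2)] by simp
next
  case (Suc k)
  show ?case
  proof (rule Ck_on_SucI[OF assms(1) bounded_bilinear.FDERIV[OF assms(2) Ck_on_has_derivative Ck_on_has_derivative]])
    fix v
    show "Ck_on k S (\<lambda>x. B (f x) (frechet_derivative g (at x) v) + B (frechet_derivative f (at x) v) (g x))"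
      using Suc.prems Ck_on_Suc_imp[OF Suc.prems(1)] Ck_on_Suc_imp[OF Suc.prems(2)]
      by (intro Ck_on_add Suc.IH assms(1)) auto
  qed (use Suc.prems in auto)
qed

lemmas Ck_on_scaleR = Ck_on_bounded_bilinear[OF _ bounded_bilinear_scaleR]
lemmas Ck_on_mult = Ck_on_bounded_bilinear[OF _ bounded_bilinear_mult]

lemma Ck_on_uminus: "open S \<Longrightarrow> Ck_on k S f \<Longrightarrow> Ck_on k S (\<lambda>x. - f x)"
  by (rule Ck_on_bounded_linear[where L = uminus]) (auto intro: bounded_linear_minus bounded_linear_ident)

lemma Ck_on_diff: "open S \<Longrightarrow> Ck_on k S f \<Longrightarrow> Ck_on k S g \<Longrightarrow> Ck_on k S (\<lambda>x. f x - g x)"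
  using Ck_on_add[OF _ _ Ck_on_uminus, of S k f g] by simp

lemma Ck_on_sum:
  assumes "open S" "\<And>i. i \<in> I \<Longrightarrow> Ck_on k S (f i)"
  shows "Ck_on k S (\<lambda>x. \<Sum>i\<in>I. f i x)"
  using assms(2) by (induction I rule: infinite_finite_induct) (auto intro!: Ck_on_add assms(1))

lemma Ck_on_prod:
  fixes f :: "'i \<Rightarrow> 'a::real_normed_vector \<Rightarrow> real"
  assumes "open S" "\<And>i. i \<in> I \<Longrightarrow> Ck_on k S (f i)"
  shows "Ck_on k S (\<lambda>x. \<Prod>i\<in>I. f i x)"
  using assms(2) by (induction I rule: infinite_finite_induct) (auto intro!: Ck_on_mult assms(1))

lemma Ck_on_vec_nth: "open S \<Longrightarrow> Ck_on k S f \<Longrightarrow> Ck_on k S (\<lambda>x. f x $ i)"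
  by (rule Ck_on_bounded_linear[OF _ _ bounded_linear_vec_nth])

lemma Ck_on_vec_lambda:
  fixes f :: "'a::real_normed_vector \<Rightarrow> 'n::finite \<Rightarrow> 'b::real_normed_vector"
  assumes "open S" "\<And>i. Ck_on k S (\<lambda>x. f x i)"
  shows "Ck_on k S (\<lambda>x. \<chi> i. f x i)"
proof -
  have bl: "bounded_linear (\<lambda>y::'b. axis i y :: 'b^'n)" for i
    by (rule bounded_linear_intro[where K = 1])
       (auto simp: axis_def vec_eq_iff norm_vec_def L2_set_def if_distrib[of norm] if_distrib[of "\<lambda>x. x^2"] cong: if_cong)
  have "Ck_on k S (\<lambda>x. \<Sum>i\<in>UNIV. axis i (f x i) :: 'b^'n)"
    by (intro Ck_on_sum assms(1) Ck_on_bounded_linear[OF assms(1) assms(2) bl])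
  moreover have "(\<Sum>i\<in>UNIV. axis i (f x i) :: 'b^'n) = (\<chi> i. f x i)" for x
    by (simp add: vec_eq_iff axis_def)
  ultimately show ?thesis by simp
qed

lemma Ck_on_Pair:
  fixes f :: "'a::real_normed_vector \<Rightarrow> 'b::real_normed_vector" and g :: "'a \<Rightarrow> 'c::real_normed_vector"
  assumes "open S" "Ck_on k S f" "Ck_on k S g"
  shows "Ck_on k S (\<lambda>x. (f x, g x))"
proof -
  have "Ck_on k S (\<lambda>x. (f x, 0) + (0, g x))"
    by (intro Ck_on_add assms(1) Ck_on_bounded_linear[OF assms(1) assms(2)] Ck_on_bounded_linear[OF assms(1) assms(3)]
        bounded_linear_Pair bounded_linear_zero bounded_linear_ident)
  then show ?thesis by simp
qed

text \<open>The chain rule applies g'(f x) to the moving vector f'(x) v, whereas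
  \<open>Ck_on\<close> controls g' in fixed directions. Expanding that vector in the basis of the
  finite-dimensional middle space leaves sums of products that the induction covers.\<close>

lemma Ck_on_compose:
  fixes f :: "'a::real_normed_vector \<Rightarrow> 'b::euclidean_space" and g :: "'b \<Rightarrow> 'c::real_normed_vector"
  assumes "open S" "Ck_on k S f" "Ck_on k T g" "f ` S \<subseteq> T"
  shows "Ck_on k S (\<lambda>x. g (f x))"
  using assms(2,3)
proof (induction k arbitrary: g)
  case 0
  then show ?case
    using assms(4) by (auto intro: continuous_on_compose2)
next
  case (Suc k)
  let ?f' = "\<lambda>x. frechet_derivative f (at x)" and ?g' = "\<lambda>y. frechet_derivative g (at y)"
  have dg: "(g has_derivative ?g' (f x)) (at (f x))" if "x \<in> S" for x
    using Suc.prems(2) assms(4) that by (intro Ck_on_has_derivative) auto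
  show ?case
  proof (rule Ck_on_SucI[OF assms(1)])
    fix x assume x: "x \<in> S"
    show "((\<lambda>x. g (f x)) has_derivative (\<lambda>v. \<Sum>b\<in>Basis. (?f' x v \<bullet> b) *\<^sub>R ?g' (f x) b)) (at x)"
    proof -
      have der: "((\<lambda>x. g (f x)) has_derivative (\<lambda>v. ?g' (f x) (?f' x v))) (at x)"
        using diff_chain_at[OF Ck_on_has_derivative[OF Suc.prems(1) x] dg[OF x]] by (simp add: o_def)
      have "?g' (f x) w = (\<Sum>b\<in>Basis. (w \<bullet> b) *\<^sub>R ?g' (f x) b)" for w
      proof -
        have lin: "linear (?g' (f x))"
          by (rule has_derivative_linear[OF dg[OF x]])
        have "?g' (f x) w = ?g' (f x) (\<Sum>b\<in>Basis. (w \<bullet> b) *\<^sub>R b)"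
          by (simp add: euclidean_representation)
        also have "\<dots> = (\<Sum>b\<in>Basis. (w \<bullet> b) *\<^sub>R ?g' (f x) b)"
          by (simp add: linear_sum[OF lin] linear_cmul[OF lin])
        finally show ?thesis .
      qed
      then show ?thesis
        by (intro has_derivative_eq_rhs[OF der] ext)
    qed
  next
    fix v
    show "Ck_on k S (\<lambda>x. \<Sum>b\<in>Basis. (?f' x v \<bullet> b) *\<^sub>R ?g' (f x) b)"
    proof (intro Ck_on_sum assms(1) Ck_on_scaleR)
      show "Ck_on k S (\<lambda>x. ?f' x v \<bullet> b)" for b
        by (rule Ck_on_bounded_linear[OF assms(1) _ bounded_linear_inner_left]) (use Suc.prems(1) in simp)
      show "Ck_on k S (\<lambda>x. ?g' (f x) b)" for b
        using Suc.IH[of "\<lambda>y. ?g' y b"] Suc.prems Ck_on_Suc_imp[of k S f] by auto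
    qed
  qed
qed

lemma Ck_on_inverse:
  fixes f :: "'a::real_normed_vector \<Rightarrow> real"
  assumes "open S" "Ck_on k S f" "\<And>x. x \<in> S \<Longrightarrow> f x \<noteq> 0"
  shows "Ck_on k S (\<lambda>x. inverse (f x))"
  using assms(2)
proof (induction k)
  case 0
  then show ?case using assms(3) by (simp add: continuous_on_inverse)
next
  case (Suc k)
  show ?case
  proof (rule Ck_on_SucI[OF assms(1)])
    show "((\<lambda>x. inverse (f x)) has_derivative
        (\<lambda>v. - (inverse (f x) * frechet_derivative f (at x) v * inverse (f x)))) (at x)" if "x \<in> S" for x
      by (rule Deriv.has_derivative_inverse[OF assms(3)[OF that] Ck_on_has_derivative[OF Suc.prems that]])
    show "Ck_on k S (\<lambda>x. - (inverse (f x) * frechet_derivative f (at x) v * inverse (f x)))" for v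
      by (intro Ck_on_uminus Ck_on_mult assms(1) Suc.IH Ck_on_Suc_imp[OF Suc.prems])
         (use Suc.prems in auto)
  qed
qed

lemma Ck_on_divide:
  fixes f g :: "'a::real_normed_vector \<Rightarrow> real"
  assumes "open S" "Ck_on k S f" "Ck_on k S g" "\<And>x. x \<in> S \<Longrightarrow> g x \<noteq> 0"
  shows "Ck_on k S (\<lambda>x. f x / g x)"
  unfolding divide_inverse by (intro Ck_on_mult Ck_on_inverse assms)

lemma Ck_on_sqrt:
  fixes f :: "'a::real_normed_vector \<Rightarrow> real"
  assumes "open S" "Ck_on k S f" "\<And>x. x \<in> S \<Longrightarrow> f x > 0"
  shows "Ck_on k S (\<lambda>x. sqrt (f x))"
  using assms(2)
proof (induction k)
  case 0
  then show ?case by (simp add: continuous_on_real_sqrt)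
next
  case (Suc k)
  show ?case
  proof (rule Ck_on_SucI[OF assms(1)])
    fix x assume x: "x \<in> S"
    show "((\<lambda>x. sqrt (f x)) has_derivative
        (\<lambda>v. frechet_derivative f (at x) v * (inverse (sqrt (f x)) / 2))) (at x)"
      by (rule DERIV_compose_FDERIV[OF DERIV_real_sqrt[OF assms(3)[OF x]] Ck_on_has_derivative[OF Suc.prems x]])
  next
    have "sqrt (f x) \<noteq> 0" if "x \<in> S" for x
      using assms(3)[OF that] by simp
    then show "Ck_on k S (\<lambda>x. frechet_derivative f (at x) v * (inverse (sqrt (f x)) / 2))" for v
      using Suc.prems Ck_on_Suc_imp[OF Suc.prems]
      by (intro Ck_on_mult Ck_on_divide assms(1) Ck_on_inverse Suc.IH Ck_on_const) auto
  qed
qed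

lemma Ck_on_det:
  fixes A :: "'a::real_normed_vector \<Rightarrow> real^'n^'n"
  assumes "open S" "\<And>i j. Ck_on k S (\<lambda>x. A x $ i $ j)"
  shows "Ck_on k S (\<lambda>x. det (A x))"
  unfolding det_def by (intro Ck_on_sum Ck_on_mult Ck_on_prod assms Ck_on_const)

text \<open>By Cramer's rule.\<close>

lemma Ck_on_solve:
  fixes A :: "'a::real_normed_vector \<Rightarrow> real^'n^'n" and b s :: "'a \<Rightarrow> real^'n"
  assumes "open S" "\<And>i j. Ck_on k S (\<lambda>x. A x $ i $ j)" "\<And>i. Ck_on k S (\<lambda>x. b x $ i)"
    and "\<And>x. x \<in> S \<Longrightarrow> det (A x) \<noteq> 0" "\<And>x. x \<in> S \<Longrightarrow> A x *v s x = b x"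
  shows "Ck_on k S s"
proof (rule Ck_on_cong[OF assms(1)])
  let ?s = "\<lambda>x. \<chi> k. det (\<chi> i j. if j = k then b x $ i else A x $ i $ j) / det (A x)"
  show "?s x = s x" if "x \<in> S" for x
    using cramer[OF assms(4)[OF that], of "s x" "b x"] assms(5)[OF that] by simp
  have "Ck_on k S (\<lambda>x. if j = l then b x $ i else A x $ i $ j)" for i j l
    using assms(2,3) by (cases "j = l") auto
  then show "Ck_on k S ?s"
    by (intro Ck_on_vec_lambda Ck_on_divide Ck_on_det assms(1,2,4)) auto
qed

subsection \<open>Coordinate representations and tangent vectors\<close>

lemma smooth_manifold_chart:
  assumes "smooth_manifold M" "c \<in> atlas M"
  shows chart_dom_open: "openin (mtop M) (cdom c)"
    and chart_image_open: "open (cmap c ` cdom c)"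
    and chart_homeomorphic:
      "homeomorphic_map (subtopology (mtop M) (cdom c)) (top_of_set (cmap c ` cdom c)) (cmap c)"
  using assms unfolding smooth_manifold_def by blast+

lemma chart_dom_subset: "smooth_manifold M \<Longrightarrow> c \<in> atlas M \<Longrightarrow> cdom c \<subseteq> carrier_of M"
  by (simp add: chart_dom_open openin_subset)

lemma chart_inj:
  assumes "smooth_manifold M" "c \<in> atlas M"
  shows "inj_on (cmap c) (cdom c)"
  using homeomorphic_imp_injective_map[OF chart_homeomorphic[OF assms]] chart_dom_subset[OF assms]
  by (simp add: Int_absorb1)

lemma cinv_cmap: "smooth_manifold M \<Longrightarrow> c \<in> atlas M \<Longrightarrow> p \<in> cdom c \<Longrightarrow> cinv c (cmap c p) = p"
  by (rule inv_into_f_f[OF chart_inj])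

lemma cinv_in: "x \<in> cmap c ` cdom c \<Longrightarrow> cinv c x \<in> cdom c"
  by (fact inv_into_into)

lemma cmap_cinv: "x \<in> cmap c ` cdom c \<Longrightarrow> cmap c (cinv c x) = x"
  by (fact f_inv_into_f)

lemma charts_atI: "c \<in> atlas M \<Longrightarrow> p \<in> cdom c \<Longrightarrow> c \<in> charts_at M p"
  by (simp add: charts_at_def)

lemma charts_atD: "c \<in> charts_at M p \<Longrightarrow> c \<in> atlas M \<and> p \<in> cdom c"
  by (simp add: charts_at_def)

lemma charts_at_carrier: "smooth_manifold M \<Longrightarrow> c \<in> charts_at M p \<Longrightarrow> p \<in> carrier_of M"
  using chart_dom_subset[of M c] charts_atD[of c M p] by blast

lemma charts_at_nonempty: "smooth_manifold M \<Longrightarrow> p \<in> carrier_of M \<Longrightarrow> \<exists>c. c \<in> charts_at M p"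
  unfolding smooth_manifold_def charts_at_def by auto

lemma chart_at_in: "smooth_manifold M \<Longrightarrow> p \<in> carrier_of M \<Longrightarrow> chart_at M p \<in> charts_at M p"
  unfolding chart_at_def using charts_at_nonempty by (metis someI_ex)

lemma continuous_map_cinv:
  assumes "smooth_manifold M" "c \<in> atlas M"
  shows "continuous_map (top_of_set (cmap c ` cdom c)) (mtop M) (cinv c)"
proof -
  obtain g where g: "homeomorphic_maps (subtopology (mtop M) (cdom c)) (top_of_set (cmap c ` cdom c)) (cmap c) g"
    using chart_homeomorphic[OF assms] homeomorphic_map_maps by blast
  then have gc: "continuous_map (top_of_set (cmap c ` cdom c)) (mtop M) g"
    and gi: "\<And>p. p \<in> cdom c \<Longrightarrow> g (cmap c p) = p"
    using chart_dom_subset[OF assms]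
    by (auto simp: homeomorphic_maps_def continuous_map_in_subtopology Int_absorb1)
  have "g x = cinv c x" if "x \<in> cmap c ` cdom c" for x
    using that gi cinv_cmap[OF assms] by auto
  then show ?thesis
    by (intro continuous_map_eq[OF gc]) auto
qed

lemma continuous_map_cmap:
  assumes "smooth_manifold M" "c \<in> atlas M"
  shows "continuous_map (subtopology (mtop M) (cdom c)) euclidean (cmap c)"
  using homeomorphic_imp_continuous_map[OF chart_homeomorphic[OF assms]]
  by (simp add: continuous_map_in_subtopology)

lemma chart_preimage_open:
  assumes "smooth_manifold M" "c \<in> atlas M" "continuous_map (mtop M) X F" "openin X T"
  shows "open (cmap c ` {p \<in> cdom c. F p \<in> T})"
proof -
  have "continuous_map (top_of_set (cmap c ` cdom c)) X (F \<circ> cinv c)"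
    by (rule continuous_map_compose[OF continuous_map_cinv[OF assms(1,2)] assms(3)])
  from openin_continuous_map_preimage[OF this assms(4)]
  have "open {x \<in> cmap c ` cdom c. F (cinv c x) \<in> T}"
    using chart_image_open[OF assms(1,2)] openin_open_eq by auto
  moreover have "{x \<in> cmap c ` cdom c. F (cinv c x) \<in> T} = cmap c ` {p \<in> cdom c. F p \<in> T}"
    using cinv_cmap[OF assms(1,2)] by auto
  ultimately show ?thesis by simp
qed

abbreviation cder where
  "cder c F d p \<equiv> frechet_derivative (coord_rep c F d) (at (cmap c p))"

text \<open>The composite factors through the chart e only where F lands in its domain; continuity
  of F makes this an open neighbourhood, which suffices for derivatives.\<close>

lemma coord_rep_chain:
  assumes M: "smooth_manifold M" and N: "smooth_manifold N" and F: "continuous_map (mtop M) (mtop N) F"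
    and c: "c \<in> charts_at M p" and e: "e \<in> charts_at N (F p)"
    and A: "(coord_rep c F e has_derivative A) (at (cmap c p))"
    and B: "(coord_rep e G d has_derivative B) (at (cmap e (F p)))"
  shows "(coord_rep c (G \<circ> F) d has_derivative B \<circ> A) (at (cmap c p))"
proof (rule has_derivative_transform_within_open)
  have ca: "c \<in> atlas M" "p \<in> cdom c" and ea: "e \<in> atlas N" "F p \<in> cdom e"
    using c e by (auto simp: charts_at_def)
  let ?W = "cmap c ` {q \<in> cdom c. F q \<in> cdom e}"
  have "coord_rep c F e (cmap c p) = cmap e (F p)"
    by (simp add: coord_rep_def cinv_cmap[OF M ca])
  then show "(coord_rep e G d \<circ> coord_rep c F e has_derivative B \<circ> A) (at (cmap c p))"
    using diff_chain_at[OF A] B by simp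
  show "open ?W" by (rule chart_preimage_open[OF M ca(1) F chart_dom_open[OF N ea(1)]])
  show "cmap c p \<in> ?W" using ca ea by blast
  show "(coord_rep e G d \<circ> coord_rep c F e) x = coord_rep c (G \<circ> F) d x" if "x \<in> ?W" for x
    using that by (auto simp: coord_rep_def cinv_cmap[OF M ca(1)] cinv_cmap[OF N ea(1)])
qed

lemma smooth_on_has_derivative:
  "smooth_on S f \<Longrightarrow> x \<in> S \<Longrightarrow> (f has_derivative frechet_derivative f (at x)) (at x)"
  unfolding smooth_on_def by (meson Ck_on_has_derivative)

lemma smooth_map_has_derivative:
  assumes "smooth_map M N F" "c \<in> charts_at M p" "d \<in> charts_at N (F p)"
  shows "(coord_rep c F d has_derivative cder c F d p) (at (cmap c p))"
  by (rule smooth_on_has_derivative[where S = "cmap c ` {q \<in> cdom c. F q \<in> cdom d}"])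
     (use assms in \<open>auto simp: smooth_map_def charts_at_def\<close>)

lemma smooth_map_continuous: "smooth_map M N F \<Longrightarrow> continuous_map (mtop M) (mtop N) F"
  by (simp add: smooth_map_def)

lemma smooth_map_carrier: "smooth_map M N F \<Longrightarrow> p \<in> carrier_of M \<Longrightarrow> F p \<in> carrier_of N"
  using smooth_map_continuous continuous_map_image_subset_topspace by fastforce

lemma smooth_map_id:
  assumes "smooth_manifold M" shows "smooth_map M M id"
proof -
  have "{p \<in> cdom c. id p \<in> cdom d} = cdom c \<inter> cdom d" for c d :: "('a,'b) chart"
    by auto
  then show ?thesis
    using assms unfolding smooth_map_def smooth_manifold_def by auto
qed

lemma cder_comp:
  assumes "smooth_manifold M" "smooth_manifold N" "smooth_map M N F" "smooth_map N P G"
    and "c \<in> charts_at M p" "e \<in> charts_at N (F p)" "d \<in> charts_at P (G (F p))"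
  shows "cder c (G \<circ> F) d p = cder e G d (F p) \<circ> cder c F e p"
  using frechet_derivative_at[OF coord_rep_chain[OF assms(1,2) smooth_map_continuous[OF assms(3)] assms(5,6)
      smooth_map_has_derivative[OF assms(3,5,6)] smooth_map_has_derivative[OF assms(4,6,7)]]] by simp

lemma cder_linear:
  assumes "smooth_map M N F" "c \<in> charts_at M p" "d \<in> charts_at N (F p)"
  shows "linear (cder c F d p)"
  by (rule has_derivative_linear[OF smooth_map_has_derivative[OF assms]])

lemma cder_id:
  assumes "smooth_manifold M" "c \<in> charts_at M p"
  shows "cder c id c p = id"
proof -
  have ca: "c \<in> atlas M" "p \<in> cdom c" using assms(2) by (auto simp: charts_at_def)
  have "(coord_rep c id c has_derivative id) (at (cmap c p))"
    by (rule has_derivative_transform_within_open[OF has_derivative_id chart_image_open[OF assms(1) ca(1)]])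
       (use ca in \<open>auto simp: coord_rep_def cinv_cmap[OF assms(1)]\<close>)
  from frechet_derivative_at[OF this] show ?thesis by simp
qed

lemma cder_id_trans:
  assumes "smooth_manifold M" "c \<in> charts_at M p" "d \<in> charts_at M p" "e \<in> charts_at M p"
  shows "cder c id e p w = cder d id e p (cder c id d p w)"
  using cder_comp[OF assms(1,1) smooth_map_id[OF assms(1)] smooth_map_id[OF assms(1)], of c p d e] assms
  by simp

text \<open>The tangent vector at \<open>p\<close> whose coordinate vector in the chart \<open>c\<close> is \<open>w\<close>.\<close>

definition tvec where
  "tvec M c p w = (\<lambda>d. if d \<in> charts_at M p then cder c id d p w else 0)"

lemma coord_vec_tvec: "coord_vec M c p i = tvec M c p (axis i 1)"
  by (simp add: coord_vec_def tvec_def)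

lemma tvec_at: "smooth_manifold M \<Longrightarrow> c \<in> charts_at M p \<Longrightarrow> tvec M c p w c = w"
  by (simp add: tvec_def cder_id)

lemma tvec_tangent:
  assumes "smooth_manifold M" "c \<in> charts_at M p"
  shows "tvec M c p w \<in> tangent_space M p"
  unfolding tangent_space_def tvec_def
  by (simp add: cder_id_trans[OF assms, symmetric])

text \<open>Together with \<open>tvec_at\<close> this identifies the tangent space at p with
  coordinate space. The default value 0 outside \<open>charts_at M p\<close> is what makes the two
  functions agree at every chart.\<close>

lemma tangent_tvec:
  assumes "c \<in> charts_at M p" "v \<in> tangent_space M p"
  shows "tvec M c p (v c) = v"
proof
  fix d
  show "tvec M c p (v c) d = v d"
  proof (cases "d \<in> charts_at M p")
    case True
    then have "v d = cder c id d p (v c)"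
      using assms unfolding tangent_space_def by blast
    then show ?thesis using True by (simp add: tvec_def)
  next
    case False
    then have "v d = 0"
      using assms unfolding tangent_space_def by blast
    then show ?thesis using False by (simp add: tvec_def)
  qed
qed

lemma tvec_linear:
  assumes "smooth_manifold M" "c \<in> charts_at M p"
  shows "tvec M c p (a *\<^sub>R w + w') = (\<lambda>d. a *\<^sub>R tvec M c p w d + tvec M c p w' d)"
proof
  fix d
  show "tvec M c p (a *\<^sub>R w + w') d = a *\<^sub>R tvec M c p w d + tvec M c p w' d"
    using cder_linear[OF smooth_map_id[OF assms(1)], of c p d] assms(2)
    by (cases "d \<in> charts_at M p") (auto simp: tvec_def linear_add linear_cmul)
qed

lemma tvec_change:
  assumes "smooth_manifold M" "c \<in> charts_at M p" "d \<in> charts_at M p"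
  shows "tvec M c p w = tvec M d p (cder c id d p w)"
  using tangent_tvec[OF assms(3) tvec_tangent[OF assms(1,2)]] assms(3) by (simp add: tvec_def)

text \<open>\<open>differential\<close> computes in the arbitrarily chosen
  \<open>chart_at M p\<close>; the chain rule through the transition maps at both ends removes this
  choice.\<close>

lemma differential_tvec:
  assumes M: "smooth_manifold M" and N: "smooth_manifold N" and F: "smooth_map M N F"
    and c: "c \<in> charts_at M p" and d: "d \<in> charts_at N (F p)"
  shows "differential M N F p (tvec M c p w) = tvec N d (F p) (cder c F d p w)"
proof
  fix e
  have p: "p \<in> carrier_of M" using charts_at_carrier[OF M c] .
  let ?c = "chart_at M p"
  have c': "?c \<in> charts_at M p" using chart_at_in[OF M p] .
  show "differential M N F p (tvec M c p w) e = tvec N d (F p) (cder c F d p w) e"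
  proof (cases "e \<in> charts_at N (F p)")
    case True
    have "cder ?c F e p (cder c id ?c p w) = cder c F e p w"
      using cder_comp[OF M M smooth_map_id[OF M] F, of c p ?c e] c c' True by simp
    also have "\<dots> = cder d id e (F p) (cder c F d p w)"
      using cder_comp[OF M N F smooth_map_id[OF N], of c p d e] c d True by simp
    finally show ?thesis
      using True c' by (simp add: differential_def tvec_def)
  qed (simp add: differential_def tvec_def)
qed

lemma differential_comp:
  assumes M: "smooth_manifold M" and N: "smooth_manifold N"
    and F: "smooth_map M N F" and G: "smooth_map N P G" and p: "p \<in> carrier_of M"
  shows "differential M P (G \<circ> F) p v = differential N P G (F p) (differential M N F p v)"
proof
  fix d
  let ?c = "chart_at M p" and ?e = "chart_at N (F p)"
  have e: "?e \<in> charts_at N (F p)"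
    by (rule chart_at_in[OF N smooth_map_carrier[OF F p]])
  show "differential M P (G \<circ> F) p v d = differential N P G (F p) (differential M N F p v) d"
    using cder_comp[OF M N F G chart_at_in[OF M p] e, of d] e by (simp add: differential_def)
qed

lemma differential_tangent:
  assumes M: "smooth_manifold M" and N: "smooth_manifold N" and F: "smooth_map M N F"
    and p: "p \<in> carrier_of M" and v: "v \<in> tangent_space M p"
  shows "differential M N F p v \<in> tangent_space N (F p)"
proof -
  obtain c where c: "c \<in> charts_at M p" using charts_at_nonempty[OF M p] by blast
  obtain d where d: "d \<in> charts_at N (F p)"
    using charts_at_nonempty[OF N smooth_map_carrier[OF F p]] by blast
  show ?thesis
    using differential_tvec[OF M N F c d, of "v c"] tangent_tvec[OF c v] tvec_tangent[OF N d] by simp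
qed

text \<open>Inverses arise as \<open>inv_into\<close>, which matches a given formula only on the
  carrier.\<close>

lemma smooth_map_cong:
  assumes M: "smooth_manifold M" and F: "smooth_map M N F"
    and N: "smooth_manifold N" and eq: "\<And>p. p \<in> carrier_of M \<Longrightarrow> F p = G p"
  shows "smooth_map M N G"
  unfolding smooth_map_def
proof (intro conjI ballI)
  show cont: "continuous_map (mtop M) (mtop N) G"
    by (rule continuous_map_eq[OF smooth_map_continuous[OF F]]) (use eq in auto)
  fix c d assume c: "c \<in> atlas M" and d: "d \<in> atlas N"
  have "F p = G p" if "p \<in> cdom c" for p
    using eq chart_dom_subset[OF M c] that by blast
  then have S: "{p \<in> cdom c. G p \<in> cdom d} = {p \<in> cdom c. F p \<in> cdom d}"
    and Fc: "\<And>p. p \<in> cdom c \<Longrightarrow> F p = G p" by auto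
  show "smooth_on (cmap c ` {p \<in> cdom c. G p \<in> cdom d}) (coord_rep c G d)"
    unfolding smooth_on_def S
  proof
    fix k
    have "Ck_on k (cmap c ` {p \<in> cdom c. F p \<in> cdom d}) (coord_rep c F d)"
      using F c d by (auto simp: smooth_map_def smooth_on_def)
    then show "Ck_on k (cmap c ` {p \<in> cdom c. F p \<in> cdom d}) (coord_rep c G d)"
      by (rule Ck_on_cong[rotated 2])
        (use chart_preimage_open[OF M c smooth_map_continuous[OF F] chart_dom_open[OF N d]] Fc
         in \<open>auto simp: coord_rep_def cinv_cmap[OF M c]\<close>)
  qed
qed

lemma smooth_map_comp:
  assumes M: "smooth_manifold M" and N: "smooth_manifold N" and P: "smooth_manifold P"
    and F: "smooth_map M N F" and G: "smooth_map N P G"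
  shows "smooth_map M P (G \<circ> F)"
  unfolding smooth_map_def
proof (intro conjI ballI)
  show cont: "continuous_map (mtop M) (mtop P) (G \<circ> F)"
    by (rule continuous_map_compose[OF smooth_map_continuous[OF F] smooth_map_continuous[OF G]])
  fix c d assume c: "c \<in> atlas M" and d: "d \<in> atlas P"
  show "smooth_on (cmap c ` {p \<in> cdom c. (G \<circ> F) p \<in> cdom d}) (coord_rep c (G \<circ> F) d)"
    unfolding smooth_on_def
  proof (intro allI Ck_on_local)
    fix k x assume "x \<in> cmap c ` {p \<in> cdom c. (G \<circ> F) p \<in> cdom d}"
    then obtain p where p: "x = cmap c p" "p \<in> cdom c" "G (F p) \<in> cdom d" by auto
    have "F p \<in> carrier_of N"
      using smooth_map_carrier[OF F] chart_dom_subset[OF M c] p by blast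
    then obtain e where e: "e \<in> atlas N" "F p \<in> cdom e"
      using charts_at_nonempty[OF N, of "F p"] by (auto simp: charts_at_def)
    \<comment> \<open>The points that F sends into the domain of e and the composite sends into that
      of d; here the composite factors through e.\<close>
    define W where "W = cmap c ` {q \<in> cdom c. F q \<in> {r \<in> carrier_of N. G r \<in> cdom d} \<inter> cdom e}"
    have oT: "openin (mtop N) ({r \<in> carrier_of N. G r \<in> cdom d} \<inter> cdom e)"
      by (intro openin_Int openin_continuous_map_preimage[OF smooth_map_continuous[OF G]]
          chart_dom_open[OF P d] chart_dom_open[OF N e(1)])
    have oW: "open W"
      unfolding W_def by (rule chart_preimage_open[OF M c smooth_map_continuous[OF F] oT])
    have "Ck_on k W (\<lambda>x. coord_rep e G d (coord_rep c F e x))"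
    proof (rule Ck_on_compose[OF oW, where f = "coord_rep c F e" and g = "coord_rep e G d"])
      have "Ck_on k (cmap c ` {q \<in> cdom c. F q \<in> cdom e}) (coord_rep c F e)"
        using F c e by (auto simp: smooth_map_def smooth_on_def)
      then show "Ck_on k W (coord_rep c F e)"
        by (rule Ck_on_subset) (auto simp: W_def)
      show "Ck_on k (cmap e ` {q \<in> cdom e. G q \<in> cdom d}) (coord_rep e G d)"
        using G d e unfolding smooth_map_def smooth_on_def by blast
      show "coord_rep c F e ` W \<subseteq> cmap e ` {q \<in> cdom e. G q \<in> cdom d}"
        by (auto simp: W_def coord_rep_def cinv_cmap[OF M c])
    qed
    then have "Ck_on k W (coord_rep c (G \<circ> F) d)"
      by (rule Ck_on_cong[OF oW, rotated]) (auto simp: W_def coord_rep_def cinv_cmap[OF M c] cinv_cmap[OF N e(1)])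
    moreover have "x \<in> W"
      using p e \<open>F p \<in> carrier_of N\<close> by (auto simp: W_def)
    ultimately show "\<exists>W. open W \<and> x \<in> W \<and> Ck_on k W (coord_rep c (G \<circ> F) d)"
      using oW by blast
  qed
qed

lemma Diff_comp:
  assumes M: "smooth_manifold M" and N: "smooth_manifold N" and P: "smooth_manifold P"
    and h: "h \<in> Diff M N" and f: "f \<in> Diff N P"
  shows "f \<circ> h \<in> Diff M P"
  unfolding Diff_def
proof (intro CollectI conjI)
  have bh: "bij_betw h (carrier_of M) (carrier_of N)" and bf: "bij_betw f (carrier_of N) (carrier_of P)"
    using h f by (auto simp: Diff_def)
  show "bij_betw (f \<circ> h) (carrier_of M) (carrier_of P)"
    by (rule bij_betw_trans[OF bh bf])
  show "smooth_map M P (f \<circ> h)"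
    using smooth_map_comp[OF M N P] h f by (auto simp: Diff_def)
  have "smooth_map P M (inv_into (carrier_of M) h \<circ> inv_into (carrier_of N) f)"
    using smooth_map_comp[OF P N M] h f by (auto simp: Diff_def)
  then show "smooth_map P M (inv_into (carrier_of M) (f \<circ> h))"
  proof (rule smooth_map_cong[OF P _ M])
    fix q assume q: "q \<in> carrier_of P"
    show "(inv_into (carrier_of M) h \<circ> inv_into (carrier_of N) f) q = inv_into (carrier_of M) (f \<circ> h) q"
      using inv_into_comp[of f h "carrier_of M" q] bh bf q by (simp add: bij_betw_def)
  qed
qed

subsection \<open>Maps into embedded submanifolds\<close>

text \<open>The inverse function theorem gives g with derivative inv (f'(g y)). Hence
  \<open>g' y v\<close> solves a linear system whose coefficients f'(g y) are as regular as g, and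
  Cramer's rule gains one order of differentiability at each induction step.\<close>

lemma smooth_local_inverse:
  fixes f :: "real^'n \<Rightarrow> real^'n"
  assumes "open U" "smooth_on U f" "x0 \<in> U" "inj (frechet_derivative f (at x0))"
  obtains U' V g where "open U'" "x0 \<in> U'" "U' \<subseteq> U" "open V" "f x0 \<in> V" "homeomorphism U' V f g" "smooth_on V g"
proof -
  let ?D = "\<lambda>x. frechet_derivative f (at x)"
  let ?f' = "\<lambda>x. Blinfun (?D x)"
  have der: "(f has_derivative ?D x) (at x)" if "x \<in> U" for x
    by (rule smooth_on_has_derivative[OF assms(2) that])
  have app: "blinfun_apply (?f' x) = ?D x" if "x \<in> U" for x
    by (rule bounded_linear_Blinfun_apply[OF has_derivative_bounded_linear[OF der[OF that]]])
  have smD: "Ck_on k U (\<lambda>x. ?D x v)" for k v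
    using assms(2) by (auto simp: smooth_on_def dest: spec[of _ "Suc k"])
  \<comment> \<open>In finite dimension, continuity of the derivative in operator norm follows from
    continuity on each basis vector, which \<open>Ck_on\<close> provides.\<close>
  have cont: "continuous_on U ?f'"
  proof (rule continuous_at_imp_continuous_on, rule ballI, rule continuous_blinfun_componentwiseI1)
    fix x i assume x: "x \<in> U"
    have "continuous_on U (\<lambda>x. ?D x i)" using smD[of 0 i] by simp
    then have "continuous_on U (\<lambda>x. blinfun_apply (?f' x) i)"
      by (rule continuous_on_eq) (simp add: app)
    then show "isCont (\<lambda>x. blinfun_apply (?f' x) i) x"
      using x assms(1) by (simp add: continuous_on_eq_continuous_at)
  qed
  have lin0: "linear (?D x0)" by (rule has_derivative_linear[OF der[OF assms(3)]])
  obtain h where h: "linear h" "h \<circ> ?D x0 = id"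
    using linear_injective_left_inverse[OF lin0 assms(4)] by blast
  have inv: "Blinfun h o\<^sub>L ?f' x0 = id_blinfun"
    using h by (intro blinfun_eqI)
       (simp add: app[OF assms(3)] bounded_linear_Blinfun_apply linear_conv_bounded_linear fun_eq_iff)
  have der': "(f has_derivative blinfun_apply (?f' x)) (at x)" if "x \<in> U" for x
    using der[OF that] app[OF that] by simp
  obtain U' V g g' where *: "open U'" "U' \<subseteq> U" "x0 \<in> U'" "open V" "f x0 \<in> V" "homeomorphism U' V f g"
    and g': "\<And>y. y \<in> V \<Longrightarrow> (g has_derivative (g' y)) (at y)"
      "\<And>y. y \<in> V \<Longrightarrow> g' y = inv (blinfun_apply (?f' (g y)))"
      "\<And>y. y \<in> V \<Longrightarrow> bij (blinfun_apply (?f' (g y)))"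
    using inverse_function_theorem[OF assms(1) der' cont assms(3) inv] by blast
  have gV: "g ` V \<subseteq> U" using *(2,6) by (auto simp: homeomorphism_def)
  have "Ck_on k V g" for k
  proof (induction k)
    case 0
    then show ?case using *(6) by (simp add: homeomorphism_def)
  next
    case (Suc k)
    show ?case
    proof (rule Ck_on_SucI[OF *(4) g'(1)])
      fix v
      let ?A = "\<lambda>y. matrix (?D (g y))"
      show "Ck_on k V (\<lambda>y. g' y v)"
      proof (rule Ck_on_solve[OF *(4), where A = ?A and b = "\<lambda>_. v"])
        show "Ck_on k V (\<lambda>y. ?A y $ i $ j)" for i j
          unfolding matrix_def by (simp, rule Ck_on_vec_nth[OF *(4)])
            (rule Ck_on_compose[OF *(4) Suc.IH smD gV])
        fix y assume y: "y \<in> V"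
        then have gy: "g y \<in> U" using gV by auto
        have lin: "linear (?D (g y))" by (rule has_derivative_linear[OF der[OF gy]])
        have bij: "bij (?D (g y))" using g'(3)[OF y] app[OF gy] by simp
        show "det (?A y) \<noteq> 0" using bij det_nz_iff_inj[OF lin] by (simp add: bij_def)
        show "?A y *v g' y v = v"
          using g'(2)[OF y] app[OF gy] bij fun_cong[OF matrix_vector_mul(2)[OF lin]]
          by (simp add: bij_is_surj surj_f_inv_f)
      qed simp
    qed
  qed
  then show ?thesis using that * by (auto simp: smooth_on_def)
qed

text \<open>Composing the immersion \<open>\<psi>\<close> with the adjoint of its differential at a point makes it locally invertible.\<close>

lemma smooth_lift_immersion:
  fixes \<psi> :: "real^'n \<Rightarrow> real^'m" and F :: "real^'k \<Rightarrow> real^'m"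
  assumes S: "open S" and V: "open V" and sF: "smooth_on S F" and s\<psi>: "smooth_on V \<psi>"
    and cG: "continuous_on S G" and GV: "G ` S \<subseteq> V" and eq: "\<And>x. x \<in> S \<Longrightarrow> \<psi> (G x) = F x"
    and inj: "\<And>y. y \<in> V \<Longrightarrow> inj (frechet_derivative \<psi> (at y))"
  shows "smooth_on S G"
  unfolding smooth_on_def
proof (intro allI Ck_on_local)
  fix k x assume x: "x \<in> S"
  let ?y = "G x"
  have y: "?y \<in> V" using x GV by auto
  define L where "L = frechet_derivative \<psi> (at ?y)"
  have der: "(\<psi> has_derivative L) (at ?y)"
    unfolding L_def by (rule smooth_on_has_derivative[OF s\<psi> y])
  have linL: "linear L" by (rule has_derivative_linear[OF der])
  define P where "P = adjoint L"
  have linP: "bounded_linear P"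
    using adjoint_linear[OF linL] by (simp add: P_def linear_conv_bounded_linear)
  define \<theta> where "\<theta> = (\<lambda>y. P (\<psi> y))"
  have s\<theta>: "smooth_on V \<theta>"
    using s\<psi> unfolding smooth_on_def \<theta>_def by (blast intro: Ck_on_bounded_linear[OF V _ linP])
  have "(\<theta> has_derivative (\<lambda>v. P (L v))) (at ?y)"
    unfolding \<theta>_def by (rule bounded_linear.has_derivative[OF linP der])
  then have d\<theta>: "frechet_derivative \<theta> (at ?y) = (\<lambda>v. P (L v))"
    by (rule frechet_derivative_at[symmetric])
  \<comment> \<open>The inner product of v with P (L v) is |L v|^2, so the composition inherits the
    trivial kernel of L.\<close>
  have "inj (\<lambda>v. P (L v))"
  proof -
    have lin: "linear (\<lambda>v. P (L v))"
      using linear_compose[OF linL adjoint_linear[OF linL]] by (simp add: P_def o_def)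
    have "v = 0" if "P (L v) = 0" for v
    proof -
      have "L v \<bullet> L v = v \<bullet> P (L v)"
        using adjoint_works[OF linL, of v "L v"] by (simp add: P_def)
      then have "L v = 0" using that by simp
      then show ?thesis
        using inj[OF y] linear_injective_0[OF linL] by (simp add: L_def)
    qed
    then show ?thesis using linear_injective_0[OF lin] by blast
  qed
  then obtain U' W g where g: "open U'" "?y \<in> U'" "open W" "homeomorphism U' W \<theta> g" "smooth_on W g"
    using smooth_local_inverse[OF V s\<theta> y] d\<theta> by metis
  \<comment> \<open>Where G stays in U', the local inverse g of \<theta> recovers it from F: the
    equation G x = g (P (F x)) upgrades G from continuous to smooth.\<close>
  define S' where "S' = S \<inter> G -` U'"
  have oS': "open S'"
    unfolding S'_def by (rule continuous_open_preimage[OF cG S g(1)])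
  have "Ck_on k S' (\<lambda>x. g (P (F x)))"
  proof (rule Ck_on_compose[OF oS', where f = "\<lambda>x. P (F x)"])
    show "Ck_on k W g" using g(5) by (simp add: smooth_on_def)
    show "Ck_on k S' (\<lambda>x. P (F x))"
      by (rule Ck_on_bounded_linear[OF oS' Ck_on_subset linP])
        (use sF in \<open>auto simp: smooth_on_def S'_def\<close>)
    show "(\<lambda>x. P (F x)) ` S' \<subseteq> W"
      using g(4) eq[symmetric] by (auto simp: S'_def homeomorphism_def \<theta>_def)
  qed
  then have "Ck_on k S' G"
    by (rule Ck_on_cong[OF oS', rotated])
      (use g(4) eq[symmetric] in \<open>auto simp: S'_def homeomorphism_def \<theta>_def\<close>)
  then show "\<exists>W. open W \<and> x \<in> W \<and> Ck_on k W G"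
    using oS' x g(2) by (auto simp: S'_def)
qed

section \<open>Inclusion of submanifolds into Euclidean space\<close>

lemma charts_at_euclid: "charts_at euclid p = {(UNIV, id)}"
  by (auto simp: charts_at_def euclid_def)

lemma differential_euclid:
  assumes M: "smooth_manifold M" and F: "smooth_map M (euclid :: (real^'m, 'm) manifold) F"
    and c: "c \<in> charts_at M p" and v: "v \<in> tangent_space M p"
  shows "differential M euclid F p v (UNIV, id) = cder c F (UNIV, id) p (v c)"
proof -
  have p: "p \<in> carrier_of M" using charts_at_carrier[OF M c] .
  let ?c = "chart_at M p"
  have c': "?c \<in> charts_at M p" using chart_at_in[OF M p] .
  have "cder ?c F (UNIV, id) p (cder c id ?c p (v c)) = cder c F (UNIV, id) p (v c)"
    using cder_comp[OF M M smooth_map_id[OF M] F, of c p ?c "(UNIV, id)"] c c'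
    by (simp add: charts_at_euclid)
  moreover have "cder c id ?c p (v c) = v ?c"
    using fun_cong[OF tangent_tvec[OF c v], of ?c] c' by (simp add: tvec_def)
  ultimately show ?thesis by (simp add: differential_def charts_at_euclid)
qed

text \<open>Euclidean space has a single chart and components at all other charts are 0, so equality
  of the coordinate images already gives equality of the image tangent vectors.\<close>

lemma immersion_cder_inj:
  assumes M: "smooth_manifold M" and F: "smooth_map M (euclid :: (real^'m, 'm) manifold) F"
    and c: "c \<in> charts_at M p" and inj: "inj_on (differential M euclid F p) (tangent_space M p)"
  shows "inj (cder c F (UNIV, id) p)"
proof (rule injI)
  fix v w assume eq: "cder c F (UNIV, id) p v = cder c F (UNIV, id) p w"
  have "differential M euclid F p (tvec M c p v) = differential M euclid F p (tvec M c p w)"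
  proof
    fix d :: "(real^'m, 'm) chart"
    show "differential M euclid F p (tvec M c p v) d = differential M euclid F p (tvec M c p w) d"
      using eq differential_euclid[OF M F c tvec_tangent[OF M c]] tvec_at[OF M c]
      by (cases "d = (UNIV, id)") (auto, auto simp: differential_def charts_at_euclid)
  qed
  then have "tvec M c p v = tvec M c p w"
    using inj tvec_tangent[OF M c] by (auto simp: inj_on_def)
  then show "v = w" by (metis tvec_at[OF M c])
qed

text \<open>The inclusion is a homeomorphism onto its image and acts as the identity on sets, so
  both topologies have the same open sets.\<close>

lemma embedded_topology:
  fixes N :: "(real^'m, 'n::finite) manifold"
  assumes "embedding_map (mtop N) (mtop (euclid :: (real^'m, 'm) manifold)) (\<lambda>p. p)"
  shows "mtop N = top_of_set (carrier_of N)"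
proof -
  have h: "homeomorphic_map (mtop N) (top_of_set (carrier_of N)) (\<lambda>p. p)"
    using assms by (simp add: embedding_map_def euclid_def)
  have "openin (mtop N) U \<longleftrightarrow> openin (top_of_set (carrier_of N)) U" for U
    using homeomorphic_map_openness_eq[OF h, of U] openin_subset[of "mtop N" U] openin_subset[of "top_of_set (carrier_of N)" U]
    by auto
  then show ?thesis by (simp add: topology_eq)
qed

text \<open>Let \<psi> be the inclusion of N read in a chart d. The coordinate representation G of F
  then satisfies \<psi> (G x) = F read in the ambient space, and \<psi> is an immersion, so
  \<open>smooth_lift_immersion\<close> applies.\<close>

lemma smooth_map_into_embedded:
  fixes M :: "('p, 'k::finite) manifold" and N :: "(real^'m, 'n::finite) manifold"
  assumes M: "smooth_manifold M" and N: "smooth_manifold N"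
    and emb: "isometric_embedding N g\<^sub>N (euclid :: (real^'m, 'm) manifold) euclid_metric (\<lambda>p. p)"
    and cF: "continuous_map (mtop M) (mtop N) F" and sF: "smooth_map M (euclid :: (real^'m, 'm) manifold) F"
  shows "smooth_map M N F"
  unfolding smooth_map_def
proof (intro conjI ballI cF)
  fix c d assume c: "c \<in> atlas M" and d: "d \<in> atlas N"
  let ?e = "(UNIV, id) :: (real^'m, 'm) chart"
  let ?S = "cmap c ` {p \<in> cdom c. F p \<in> cdom d}"
  have oS: "open ?S" by (rule chart_preimage_open[OF M c cF chart_dom_open[OF N d]])
  have sI: "smooth_map N (euclid :: (real^'m, 'm) manifold) (\<lambda>p. p)"
    using emb by (simp add: isometric_embedding_def)
  show "smooth_on ?S (coord_rep c F d)"
  proof (rule smooth_lift_immersion[OF oS chart_image_open[OF N d], where F = "coord_rep c F ?e" and \<psi> = "coord_rep d (\<lambda>p. p) ?e"])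
    have "smooth_on (cmap c ` {p \<in> cdom c. F p \<in> cdom ?e}) (coord_rep c F ?e)"
      using sF c unfolding smooth_map_def by (auto simp: euclid_def)
    then show "smooth_on ?S (coord_rep c F ?e)"
      unfolding smooth_on_def by (auto intro: Ck_on_subset)
    show "smooth_on (cmap d ` cdom d) (coord_rep d (\<lambda>p. p) ?e)"
      using sI d unfolding smooth_map_def by (auto simp: euclid_def)
    show "coord_rep c F d ` ?S \<subseteq> cmap d ` cdom d"
      by (auto simp: coord_rep_def cinv_cmap[OF M c])
    show "coord_rep d (\<lambda>p. p) ?e (coord_rep c F d x) = coord_rep c F ?e x" if "x \<in> ?S" for x
      using that by (auto simp: coord_rep_def cinv_cmap[OF M c] cinv_cmap[OF N d])
    show "inj (frechet_derivative (coord_rep d (\<lambda>p. p) ?e) (at y))" if y: "y \<in> cmap d ` cdom d" for y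
    proof -
      have dq: "d \<in> charts_at N (cinv d y)" using cinv_in[OF y] d by (simp add: charts_at_def)
      have "inj_on (differential N euclid (\<lambda>p. p) (cinv d y)) (tangent_space N (cinv d y))"
        using emb charts_at_carrier[OF N dq] by (auto simp: isometric_embedding_def)
      from immersion_cder_inj[OF N sI dq this] show ?thesis by (simp add: cmap_cinv[OF y])
    qed
    have "continuous_map (top_of_set ?S) (subtopology (mtop N) (cdom d)) (F \<circ> cinv c)"
      unfolding continuous_map_in_subtopology
    proof (intro conjI continuous_map_compose[OF _ cF])
      show "continuous_map (top_of_set ?S) (mtop M) (cinv c)"
        by (rule continuous_map_from_subtopology_mono[OF continuous_map_cinv[OF M c]]) auto
      show "(F \<circ> cinv c) \<in> topspace (top_of_set ?S) \<rightarrow> cdom d"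
        by (auto simp: cinv_cmap[OF M c])
    qed
    from continuous_map_compose[OF this continuous_map_cmap[OF N d]]
    show "continuous_on ?S (coord_rep c F d)"
      by (simp add: coord_rep_def o_assoc)
  qed
qed

section \<open>The radial map and its composition with isometries\<close>

lemma
  fixes M :: "('p, 'k::finite) manifold" and F :: "'p \<Rightarrow> real^'m"
  assumes M: "smooth_manifold M" and F: "smooth_map M (euclid :: (real^'m, 'm) manifold) F"
  shows smooth_map_euclid_scaleR: "smooth_map M (euclid :: (real^'m, 'm) manifold) (\<lambda>p. a *\<^sub>R F p)"
    and differential_euclid_scaleR: "p \<in> carrier_of M \<Longrightarrow>
      differential M (euclid :: (real^'m, 'm) manifold) (\<lambda>p. a *\<^sub>R F p) p v (UNIV, id)
        = a *\<^sub>R differential M euclid F p v (UNIV, id)"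
proof -
  let ?e = "(UNIV, id) :: (real^'m, 'm) chart"
  have rep: "coord_rep c (\<lambda>p. a *\<^sub>R F p) ?e = (\<lambda>x. a *\<^sub>R coord_rep c F ?e x)" for c
    by (simp add: coord_rep_def fun_eq_iff)
  have "continuous_map (mtop M) euclidean F"
    using F by (simp add: smooth_map_def euclid_def)
  then have "continuous_map (mtop M) euclidean (\<lambda>p. a *\<^sub>R F p)"
    using continuous_map_compose[of "mtop M" euclidean F euclidean "\<lambda>y. a *\<^sub>R y"]
    by (simp add: o_def continuous_on_scaleR continuous_on_id)
  moreover have "smooth_on (cmap c ` cdom c) (\<lambda>x. a *\<^sub>R coord_rep c F ?e x)" if c: "c \<in> atlas M" for c
  proof -
    have "smooth_on (cmap c ` cdom c) (coord_rep c F ?e)"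
      using F c unfolding smooth_map_def by (auto simp: euclid_def)
    then show ?thesis
      unfolding smooth_on_def
      using Ck_on_bounded_linear[OF chart_image_open[OF M c] _ bounded_linear_scaleR_right] by blast
  qed
  ultimately show "smooth_map M (euclid :: (real^'m, 'm) manifold) (\<lambda>p. a *\<^sub>R F p)"
    by (simp add: smooth_map_def euclid_def rep)
  show "differential M (euclid :: (real^'m, 'm) manifold) (\<lambda>p. a *\<^sub>R F p) p v ?e
      = a *\<^sub>R differential M euclid F p v ?e" if p: "p \<in> carrier_of M"
  proof -
    have "(coord_rep (chart_at M p) F ?e has_derivative cder (chart_at M p) F ?e p) (at (cmap (chart_at M p) p))"
      by (rule smooth_map_has_derivative[OF F chart_at_in[OF M p]]) (simp add: charts_at_euclid)
    from frechet_derivative_at[OF has_derivative_scaleR_right[OF this, of a]]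
    show ?thesis
      by (auto simp: differential_def charts_at_euclid rep dest: fun_cong[where x = "v (chart_at M p)"])
  qed
qed

text \<open>The factor a is left open so that scaling by R and its inverse, scaling by 1/R, are both
  instances.\<close>

lemma radial_map_smooth:
  fixes M N :: "(real^'m, 'n::finite) manifold"
  assumes M: "smooth_manifold M" and N: "smooth_manifold N"
    and eM: "isometric_embedding M g\<^sub>M (euclid :: (real^'m, 'm) manifold) euclid_metric (\<lambda>p. p)"
    and eN: "isometric_embedding N g\<^sub>N (euclid :: (real^'m, 'm) manifold) euclid_metric (\<lambda>p. p)"
    and carr: "(\<lambda>p. a *\<^sub>R p) ` carrier_of M \<subseteq> carrier_of N"
  shows "smooth_map M N (\<lambda>p. a *\<^sub>R p)"
proof (rule smooth_map_into_embedded[OF M N eN])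
  have tM: "mtop M = top_of_set (carrier_of M)" and tN: "mtop N = top_of_set (carrier_of N)"
    using embedded_topology eM eN by (auto simp: isometric_embedding_def)
  show "continuous_map (mtop M) (mtop N) (\<lambda>p. a *\<^sub>R p)"
    using carr by (subst tM, subst tN)
      (auto simp: image_subset_iff_funcset intro: continuous_intros)
  show "smooth_map M (euclid :: (real^'m, 'm) manifold) (\<lambda>p. a *\<^sub>R p)"
    by (rule smooth_map_euclid_scaleR[OF M]) (use eM in \<open>simp add: isometric_embedding_def\<close>)
qed

lemma radial_map_Diff:
  fixes M N :: "(real^'m, 'n::finite) manifold"
  assumes M: "smooth_manifold M" and N: "smooth_manifold N"
    and eM: "isometric_embedding M g\<^sub>M (euclid :: (real^'m, 'm) manifold) euclid_metric (\<lambda>p. p)"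
    and eN: "isometric_embedding N g\<^sub>N (euclid :: (real^'m, 'm) manifold) euclid_metric (\<lambda>p. p)"
    and R: "R \<noteq> 0" and carr: "carrier_of N = (\<lambda>p. R *\<^sub>R p) ` carrier_of M"
  shows "(\<lambda>p. R *\<^sub>R p) \<in> Diff M N"
  unfolding Diff_def
proof (intro CollectI conjI)
  have inj: "inj_on (\<lambda>p :: real^'m. R *\<^sub>R p) A" for A
    using R by (auto simp: inj_on_def)
  show "bij_betw (\<lambda>p. R *\<^sub>R p) (carrier_of M) (carrier_of N)"
    using inj carr by (simp add: bij_betw_def)
  show "smooth_map M N (\<lambda>p. R *\<^sub>R p)"
    by (rule radial_map_smooth[OF M N eM eN]) (simp add: carr)
  have "smooth_map N M (\<lambda>p. inverse R *\<^sub>R p)"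
    by (rule radial_map_smooth[OF N M eN eM]) (use R in \<open>auto simp: carr\<close>)
  then show "smooth_map N M (inv_into (carrier_of M) (\<lambda>p. R *\<^sub>R p))"
    by (rule smooth_map_cong[OF N _ M]) (use R in \<open>auto simp: carr inv_into_f_f[OF inj]\<close>)
qed

text \<open>Followed by the inclusion of N, the radial map is R times the inclusion of M, and both
  metrics are the Euclidean inner product of the images under the inclusions. Each of the two
  arguments contributes a factor R.\<close>

lemma radial_map_pullback:
  fixes M N :: "(real^'m, 'n::finite) manifold"
  assumes M: "smooth_manifold M" and N: "smooth_manifold N"
    and eM: "isometric_embedding M g\<^sub>M (euclid :: (real^'m, 'm) manifold) euclid_metric (\<lambda>p. p)"
    and eN: "isometric_embedding N g\<^sub>N (euclid :: (real^'m, 'm) manifold) euclid_metric (\<lambda>p. p)"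
    and sm: "smooth_map M N (\<lambda>p. R *\<^sub>R p)"
  shows "tensor2_eq M (pullback M N (\<lambda>p. R *\<^sub>R p) g\<^sub>N) (\<lambda>p u v. R\<^sup>2 * g\<^sub>M p u v)"
  unfolding tensor2_eq_def
proof (intro ballI)
  fix p u v assume p: "p \<in> carrier_of M" and u: "u \<in> tangent_space M p" and v: "v \<in> tangent_space M p"
  let ?F = "\<lambda>p. R *\<^sub>R p" and ?E = "euclid :: (real^'m, 'm) manifold"
  have sM: "smooth_map M ?E (\<lambda>p. p)" and sN: "smooth_map N ?E (\<lambda>p. p)"
    using eM eN by (auto simp: isometric_embedding_def)
  have dF: "differential N ?E (\<lambda>p. p) (?F p) (differential M N ?F p w) (UNIV, id)
      = R *\<^sub>R differential M ?E (\<lambda>p. p) p w (UNIV, id)" for w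
    using differential_comp[OF M N sm sN p, of w, symmetric] differential_euclid_scaleR[OF M sM p]
    by (simp add: o_def)
  have "pullback M N ?F g\<^sub>N p u v = pullback N ?E (\<lambda>p. p) euclid_metric (?F p) (differential M N ?F p u) (differential M N ?F p v)"
    using eN smooth_map_carrier[OF sm p] differential_tangent[OF M N sm p] u v
    by (simp add: isometric_embedding_def tensor2_eq_def pullback_def)
  also have "\<dots> = R\<^sup>2 * pullback M ?E (\<lambda>p. p) euclid_metric p u v"
    by (simp add: pullback_def euclid_metric_def dF power2_eq_square)
  also have "\<dots> = R\<^sup>2 * g\<^sub>M p u v"
    using eM p u v by (simp add: isometric_embedding_def tensor2_eq_def)
  finally show "pullback M N ?F g\<^sub>N p u v = R\<^sup>2 * g\<^sub>M p u v" .
qed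

text \<open>Functoriality of the differential: pulling back by the composite means pulling back by f
  and then by h, and f pulls \<open>g\<^sub>P\<close> back to \<open>g\<^sub>N\<close>.\<close>

lemma pullback_isometry_comp:
  assumes M: "smooth_manifold M" and N: "smooth_manifold N"
    and h: "smooth_map M N h" and f: "isometry N g\<^sub>N P g\<^sub>P f"
    and eq: "tensor2_eq M (pullback M N h g\<^sub>N) T"
  shows "tensor2_eq M (pullback M P (f \<circ> h) g\<^sub>P) T"
  unfolding tensor2_eq_def
proof (intro ballI)
  fix p u v assume p: "p \<in> carrier_of M" and u: "u \<in> tangent_space M p" and v: "v \<in> tangent_space M p"
  have sf: "smooth_map N P f" using f by (simp add: isometry_def Diff_def)
  have "pullback M P (f \<circ> h) g\<^sub>P p u v = pullback N P f g\<^sub>P (h p) (differential M N h p u) (differential M N h p v)"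
    by (simp add: pullback_def differential_comp[OF M N h sf p])
  also have "\<dots> = pullback M N h g\<^sub>N p u v"
    using f smooth_map_carrier[OF h p] differential_tangent[OF M N h p] u v
    by (simp add: isometry_def tensor2_eq_def pullback_def)
  finally show "pullback M P (f \<circ> h) g\<^sub>P p u v = T p u v"
    using eq p u v by (simp add: tensor2_eq_def)
qed

subsection \<open>Change of variables over arbitrary finite index types\<close>

text \<open>The library proves the change of variables formula for well-ordered index types only. It is
  transferred to an arbitrary finite index type along a bijection with the following copy.\<close>

typedef 'a idx = "{i::nat. i < CARD('a::finite)}"
  using zero_less_card_finite by blast

instantiation idx :: (finite) linorder
begin
definition less_eq_idx :: "'a idx \<Rightarrow> 'a idx \<Rightarrow> bool" where "x \<le> y \<longleftrightarrow> Rep_idx x \<le> Rep_idx y"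
definition less_idx :: "'a idx \<Rightarrow> 'a idx \<Rightarrow> bool" where "x < y \<longleftrightarrow> Rep_idx x < Rep_idx y"
instance
  by standard (auto simp: less_eq_idx_def less_idx_def Rep_idx_inject)
end

instance idx :: (finite) wellorder
proof
  fix P :: "'a idx \<Rightarrow> bool" and a
  assume step: "\<And>x. (\<And>y. y < x \<Longrightarrow> P y) \<Longrightarrow> P x"
  show "P a"
  proof (induction a rule: measure_induct_rule[where f = Rep_idx])
    case (less a)
    show ?case by (rule step, rule less) (simp add: less_idx_def)
  qed
qed

lemma bij_betw_Rep_idx: "bij_betw (Rep_idx :: 'a::finite idx \<Rightarrow> nat) UNIV {i. i < CARD('a)}"
  by (auto simp: bij_betw_def inj_def Rep_idx_inject type_definition.Rep_range[OF type_definition_idx])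

instance idx :: (finite) finite
proof
  show "finite (UNIV :: 'a idx set)"
    using bij_betw_finite[OF bij_betw_Rep_idx] by simp
qed

lemma ex_bij_idx: "\<exists>s :: 'n::finite idx \<Rightarrow> 'n. bij s"
  using finite_same_card_bij[of "UNIV :: 'n idx set" "UNIV :: 'n set"] bij_betw_same_card[OF bij_betw_Rep_idx]
  by simp

text \<open>Renumbering of coordinates. For bijective s it is a linear isometry that maps boxes to
  boxes of the same volume, hence is compatible with the gauge integral.\<close>

definition reindex :: "('m::finite \<Rightarrow> 'n::finite) \<Rightarrow> real^'n \<Rightarrow> real^'m" where
  "reindex s x = (\<chi> j. x $ s j)"

lemma reindex_inv:
  assumes "bij s"
  shows "reindex (inv s) (reindex s x) = x" "reindex s (reindex (inv s) y) = y"
  using assms by (simp_all add: reindex_def vec_eq_iff bij_is_surj surj_f_inv_f bij_is_inj)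

lemma reindex_cbox:
  assumes "bij s"
  shows "reindex s ` cbox a b = cbox (reindex s a) (reindex s b)"
proof -
  have all: "(\<forall>j. P (s j)) \<longleftrightarrow> (\<forall>i. P i)" for P
    using assms by (metis bij_pointE)
  have mem: "reindex s x \<in> cbox (reindex s a) (reindex s b) \<longleftrightarrow> x \<in> cbox a b" for x
    using all[of "\<lambda>i. a $ i \<le> x $ i \<and> x $ i \<le> b $ i"] by (simp add: mem_box_cart reindex_def)
  have "y \<in> reindex s ` cbox a b" if "y \<in> cbox (reindex s a) (reindex s b)" for y
    using that mem[of "reindex (inv s) y"] reindex_inv(2)[OF assms, of y] by (metis imageI)
  then show ?thesis using mem by blast
qed

lemma reindex_content:
  assumes "bij s"
  shows "measure lborel (reindex s ` cbox a b) = measure lborel (cbox a b)"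
proof (cases "cbox a b = {}")
  case False
  then have "cbox (reindex s a) (reindex s b) \<noteq> {}" using reindex_cbox[OF assms, of a b] by auto
  moreover have "(\<Prod>j\<in>UNIV. b $ s j - a $ s j) = (\<Prod>i\<in>UNIV. b $ i - a $ i)"
    using prod.reindex_bij_betw[OF assms, of "\<lambda>i. b $ i - a $ i"] .
  ultimately show ?thesis
    unfolding reindex_cbox[OF assms] using False by (simp add: content_cbox_cart) (simp add: reindex_def)
qed simp

lemma reindex_linear: "linear (reindex s)"
  by (rule linearI) (simp_all add: reindex_def vec_eq_iff)

lemma reindex_norm:
  assumes "bij s"
  shows "norm (reindex s x) = norm x"
  using sum.reindex_bij_betw[OF assms, of "\<lambda>i. (norm (x $ i))\<^sup>2"]
  by (simp add: norm_vec_def L2_set_def reindex_def)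

lemma has_integral_reindex_cbox:
  assumes "bij s" "(f has_integral I) (cbox a b)"
  shows "((\<lambda>y. f (reindex (inv s) y)) has_integral I) (cbox (reindex s a) (reindex s b))"
proof -
  have bi: "bij (inv s)" using assms(1) by (rule bij_imp_bij_inv)
  have "((\<lambda>y. f (reindex (inv s) y)) has_integral (1 / 1) *\<^sub>R I) (reindex s ` cbox a b)"
    by (rule has_integral_twiddle[where h = "reindex s" and g = "reindex (inv s)"])
       (use assms reindex_inv[OF assms(1)] reindex_cbox[OF assms(1)] reindex_cbox[OF bi] reindex_content[OF bi]
          linear_continuous_at[OF reindex_linear[of "inv s", unfolded linear_conv_bounded_linear]] in auto)
  then show ?thesis by (simp add: reindex_cbox[OF assms(1)])
qed

text \<open>On boxes the transfer is the preceding lemma. Over a general set the integral is a limit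
  over boxes containing large balls, and since reindexing preserves norms, the same radius B works
  on both sides.\<close>

lemma has_integral_reindex:
  fixes f :: "real^'n \<Rightarrow> real"
  assumes s: "bij (s :: 'm::finite \<Rightarrow> 'n::finite)" and f: "(f has_integral I) A"
  shows "((\<lambda>y. f (reindex (inv s) y)) has_integral I) (reindex s ` A)"
proof -
  define F where "F = (\<lambda>x. if x \<in> A then f x else 0)"
  have F: "\<And>a b. F integrable_on cbox a b"
    and lim: "\<And>e. e > 0 \<Longrightarrow> \<exists>B>0. \<forall>a b. ball 0 B \<subseteq> cbox a b \<longrightarrow> norm (integral (cbox a b) F - I) < e"
    using f unfolding has_integral_alt' F_def by blast+
  have bi: "bij (inv s)" using s by (rule bij_imp_bij_inv)
  have int: "((\<lambda>y. F (reindex (inv s) y)) has_integral integral (cbox (reindex (inv s) a) (reindex (inv s) b)) F) (cbox a b)" for a b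
    using has_integral_reindex_cbox[OF s integrable_integral[OF F], of "reindex (inv s) a" "reindex (inv s) b"]
    by (simp add: reindex_inv[OF s])
  have mem: "reindex (inv s) y \<in> A \<longleftrightarrow> y \<in> reindex s ` A" for y
    using reindex_inv[OF s] by (metis imageE imageI)
  have Feq: "(\<lambda>y. if y \<in> reindex s ` A then f (reindex (inv s) y) else 0) = (\<lambda>y. F (reindex (inv s) y))"
    by (auto simp: F_def fun_eq_iff mem)
  show ?thesis
    unfolding has_integral_alt' Feq
  proof (intro conjI allI impI)
    show "(\<lambda>y. F (reindex (inv s) y)) integrable_on cbox a b" for a b
      using int by blast
    fix e :: real assume "e > 0"
    then obtain B where B: "B > 0" "\<And>a b. ball 0 B \<subseteq> cbox a b \<Longrightarrow> norm (integral (cbox a b) F - I) < e"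
      using lim by blast
    show "\<exists>B>0. \<forall>a b. ball 0 B \<subseteq> cbox a b \<longrightarrow>
        norm (integral (cbox a b) (\<lambda>y. F (reindex (inv s) y)) - I) < e"
    proof (intro exI conjI allI impI)
      fix a b :: "real^'m" assume ab: "ball 0 B \<subseteq> cbox a b"
      have "ball 0 B \<subseteq> cbox (reindex (inv s) a) (reindex (inv s) b)"
      proof
        fix x :: "real^'n" assume "x \<in> ball 0 B"
        then have "reindex s x \<in> cbox a b" using ab reindex_norm[OF s, of x] by (auto simp: subset_eq)
        then have "reindex (inv s) (reindex s x) \<in> reindex (inv s) ` cbox a b" by blast
        then show "x \<in> cbox (reindex (inv s) a) (reindex (inv s) b)"
          by (simp add: reindex_inv[OF s] reindex_cbox[OF bi])
      qed
      from B(2)[OF this] show "norm (integral (cbox a b) (\<lambda>y. F (reindex (inv s) y)) - I) < e"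
        by (simp add: integral_unique[OF int])
    qed (rule B(1))
  qed
qed

text \<open>Conjugation by s matches the permutations of the two index types and preserves signs,
  which identifies the two Leibniz sums term by term.\<close>

lemma det_reindex:
  fixes A :: "real^'n^'n" and s :: "'m::finite \<Rightarrow> 'n::finite"
  assumes s: "bij s"
  shows "det (\<chi> i j. A $ s i $ s j) = det A"
proof -
  let ?m = "map_permutation UNIV (s :: 'm \<Rightarrow> 'n)"
  have app: "?m p (s i) = s (p i)" for p i
    using map_permutation_apply[of s UNIV i p] s by (simp add: bij_is_inj)
  have bb: "bij_betw ?m {p. p permutes UNIV} {p. p permutes UNIV}"
  proof (rule bij_betw_byWitness[where f' = "map_permutation UNIV (inv s)"])
    have bi: "bij (inv s)" using s by (rule bij_imp_bij_inv)
    show "\<forall>p\<in>{p. p permutes UNIV}. map_permutation UNIV (inv s) (?m p) = p"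
      using map_permutation_compose_inv[of s UNIV UNIV _ "inv s"] s by (auto simp: bij_is_inj)
    show "\<forall>p\<in>{p. p permutes UNIV}. ?m (map_permutation UNIV (inv s) p) = p"
      using map_permutation_compose_inv[of "inv s" UNIV UNIV _ s] bi s by (auto simp: bij_is_surj surj_f_inv_f)
    show "?m ` {p. p permutes UNIV} \<subseteq> {p. p permutes UNIV}"
      using map_permutation_permutes[of s UNIV UNIV] s by auto
    show "map_permutation UNIV (inv s) ` {p. p permutes UNIV} \<subseteq> {p. p permutes UNIV}"
      using map_permutation_permutes[of "inv s" UNIV UNIV] bi by auto
  qed
  have "det (\<chi> i j. A $ s i $ s j) = (\<Sum>p\<in>{p. p permutes UNIV}. of_int (sign p) * (\<Prod>i\<in>UNIV. A $ s i $ s (p i)))"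
    by (simp add: det_def)
  also have "\<dots> = (\<Sum>p\<in>{p. p permutes UNIV}. of_int (sign (?m p)) * (\<Prod>i\<in>UNIV. A $ i $ ?m p i))"
  proof (rule sum.cong[OF refl])
    fix p :: "'m \<Rightarrow> 'm" assume p: "p \<in> {p. p permutes UNIV}"
    have "sign (?m p) = sign p"
      by (rule sign_map_permutation) (use s p in \<open>auto simp: bij_is_inj\<close>)
    moreover have "(\<Prod>i\<in>UNIV. A $ s i $ s (p i)) = (\<Prod>i\<in>UNIV. A $ i $ ?m p i)"
      using prod.reindex_bij_betw[OF s, of "\<lambda>i. A $ i $ ?m p i"] by (simp add: app)
    ultimately show "of_int (sign p) * (\<Prod>i\<in>UNIV. A $ s i $ s (p i)) = of_int (sign (?m p)) * (\<Prod>i\<in>UNIV. A $ i $ ?m p i)"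
      by simp
  qed
  also have "\<dots> = det A"
    unfolding det_def by (rule sum.reindex_bij_betw[OF bb])
  finally show ?thesis .
qed

text \<open>The map g is conjugated with the renumbering, the formula is applied on the well-ordered
  copy, and the result is renumbered back.\<close>

lemma integral_change_of_variables:
  fixes f :: "real^'n \<Rightarrow> real" and g :: "real^'n \<Rightarrow> real^'n"
  assumes S: "open S" and der: "\<And>x. x \<in> S \<Longrightarrow> (g has_derivative g' x) (at x)" and inj: "inj_on g S"
    and f: "f absolutely_integrable_on (g ` S)"
  shows "integral S (\<lambda>x. \<bar>det (matrix (g' x))\<bar> * f (g x)) = integral (g ` S) f"
    and "(\<lambda>x. \<bar>det (matrix (g' x))\<bar> * f (g x)) integrable_on S"
proof -
  obtain s :: "'n idx \<Rightarrow> 'n" where s: "bij s" using ex_bij_idx by blast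
  have bi: "bij (inv s)" and ii: "inv (inv s) = s" using s by (simp_all add: bij_imp_bij_inv inv_inv_eq)
  let ?E = "reindex s" and ?H = "reindex (inv s)"
  let ?g = "\<lambda>y. ?E (g (?H y))" and ?g' = "\<lambda>y v. ?E (g' (?H y) (?H v))"
  define S' where "S' = ?E ` S"
  \<comment> \<open>Values lie in \<open>real^1\<close> because the formula is stated for
    vector-valued integrands.\<close>
  define f' :: "real^('n idx) \<Rightarrow> real^1" where "f' = (\<lambda>y. vec (f (?H y)))"
  have HS: "?H y \<in> S \<longleftrightarrow> y \<in> S'" for y
  proof
    assume "?H y \<in> S"
    then have "?E (?H y) \<in> S'" unfolding S'_def by (rule imageI)
    then show "y \<in> S'" by (simp add: reindex_inv[OF s])
  qed (auto simp: S'_def reindex_inv[OF s])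
  have blH: "bounded_linear ?H" and blE: "bounded_linear ?E"
    using reindex_linear linear_conv_bounded_linear by blast+
  have "S' = ?H -` S" using HS by auto
  then have "open S'"
    using S by (simp add: open_vimage linear_continuous_on[OF blH])
  then have mS: "S' \<in> sets lebesgue"
    by (intro sets_completionI_sets) simp
  have gS: "?g ` S' = ?E ` (g ` S)"
    unfolding S'_def by (auto simp: reindex_inv[OF s] image_image)
  have dg: "(?g has_derivative ?g' y) (at y within S')" if "y \<in> S'" for y
  proof -
    have 1: "(?H has_derivative ?H) (at y)" by (rule bounded_linear.has_derivative[OF blH has_derivative_ident])
    have 2: "(g has_derivative g' (?H y)) (at (?H y))" using der that HS by simp
    have "((\<lambda>y. g (?H y)) has_derivative (\<lambda>v. g' (?H y) (?H v))) (at y)"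
      using diff_chain_at[OF 1 2] by (simp add: o_def)
    from bounded_linear.has_derivative[OF blE this] show ?thesis by (rule has_derivative_at_withinI)
  qed
  have injg: "inj_on ?g S'"
  proof (rule inj_onI)
    fix x y assume x: "x \<in> S'" and y: "y \<in> S'" and "?g x = ?g y"
    then have "g (?H x) = g (?H y)" by (metis reindex_inv(1)[OF s])
    then have "?H x = ?H y" using inj x y HS by (auto simp: inj_on_def)
    then show "x = y" by (metis reindex_inv(2)[OF s])
  qed
  \<comment> \<open>Conjugation renumbers the rows and the columns of the Jacobian matrix by the
    same bijection, so even the sign of the determinant is kept.\<close>
  have det: "det (matrix (?g' y)) = det (matrix (g' (?H y)))" if "y \<in> S'" for y
  proof -
    have "inv s i = j \<longleftrightarrow> i = s j" for i j
      using bij_inv_eq_iff[OF s, of j i] by auto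
    then have "?H (axis j 1) = axis (s j) 1" for j
      by (simp add: reindex_def vec_eq_iff axis_def)
    then have "matrix (?g' y) = (\<chi> i j. matrix (g' (?H y)) $ s i $ s j)"
      by (simp add: matrix_def reindex_def)
    then show ?thesis by (simp add: det_reindex[OF s])
  qed
  have vec1: "bounded_linear (vec :: real \<Rightarrow> real^1)"
    by (rule bounded_linear_intro[where K = 1]) (auto simp: vec_eq_iff norm_vec_def L2_set_def)
  have abs: "f' absolutely_integrable_on (?g ` S')"
  proof -
    have "(\<lambda>y. f (?H y)) absolutely_integrable_on (?E ` (g ` S))"
      using f has_integral_reindex[OF s, of f _ "g ` S"] has_integral_reindex[OF s, of "\<lambda>x. norm (f x)" _ "g ` S"]
      unfolding absolutely_integrable_on_def integrable_on_def by blast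
    from absolutely_integrable_linear[OF this vec1] show ?thesis
      unfolding gS by (simp add: f'_def o_def)
  qed
  let ?D = "\<lambda>y. \<bar>det (matrix (?g' y))\<bar> *\<^sub>R f' (?g y)"
  from has_absolute_integral_change_of_variables[OF mS dg injg, of f' "integral (?g ` S') f'"] abs
  have D: "?D absolutely_integrable_on S'" "integral S' ?D = integral (?g ` S') f'" by blast+
  have hD: "(?D has_integral integral (?g ` S') f') S'"
    unfolding D(2)[symmetric]
    by (rule integrable_integral[OF set_lebesgue_integral_eq_integral(1)[OF D(1)]])
  have "((\<lambda>y. ?D y $ 1) has_integral integral (?g ` S') f' $ 1) S'"
    using has_integral_linear[OF hD bounded_linear_vec_nth[of 1]] by (simp add: o_def)
  then have h1: "((\<lambda>y. \<bar>det (matrix (g' (?H y)))\<bar> * f (g (?H y))) has_integral integral (?g ` S') f' $ 1) S'"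
    by (rule has_integral_eq[rotated]) (use det in \<open>simp add: f'_def reindex_inv[OF s]\<close>)
  have HS': "?H ` S' = S" unfolding S'_def by (simp add: image_image reindex_inv[OF s])
  have h2: "((\<lambda>x. \<bar>det (matrix (g' x))\<bar> * f (g x)) has_integral integral (?g ` S') f' $ 1) S"
    using has_integral_reindex[OF bi h1] by (simp add: ii HS' reindex_inv[OF s])
  have hf: "(f has_integral integral (g ` S) f) (g ` S)"
    using set_lebesgue_integral_eq_integral(1)[OF f] by (rule integrable_integral)
  have "(f' has_integral vec (integral (g ` S) f)) (?E ` (g ` S))"
    using has_integral_linear[OF has_integral_reindex[OF s hf] vec1] by (simp add: f'_def o_def)
  then have "integral (?g ` S') f' = vec (integral (g ` S) f)"
    unfolding gS by (rule integral_unique)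
  then show "integral S (\<lambda>x. \<bar>det (matrix (g' x))\<bar> * f (g x)) = integral (g ` S) f"
    and "(\<lambda>x. \<bar>det (matrix (g' x))\<bar> * f (g x)) integrable_on S"
    using h2 by (auto intro: integral_unique)
qed

subsection \<open>Flows and partitions of unity\<close>

text \<open>\<open>Ck_on\<close> describes the derivative direction by direction. The sum of its
  norms on basis vectors dominates the operator norm and is continuous, hence bounded on a compact
  ball, where the mean value inequality applies.\<close>

lemma C1_locally_Lipschitz:
  fixes f :: "'a::euclidean_space \<Rightarrow> 'b::real_normed_vector"
  assumes "open U" "Ck_on 1 U f" "x \<in> U"
  obtains r L where "r > 0" "cball x r \<subseteq> U"
    "\<And>y z. y \<in> cball x r \<Longrightarrow> z \<in> cball x r \<Longrightarrow> norm (f y - f z) \<le> L * norm (y - z)"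
proof -
  obtain r where r: "r > 0" "cball x r \<subseteq> U" using assms(1,3) open_contains_cball by blast
  let ?D = "\<lambda>y. frechet_derivative f (at y)"
  have der: "(f has_derivative ?D y) (at y)" if "y \<in> U" for y
    using Ck_on_has_derivative[of 0 U f y] assms(2) that by simp
  let ?N = "\<lambda>y. \<Sum>b\<in>Basis. norm (?D y b)"
  have "continuous_on U (\<lambda>y. ?D y b)" for b
    using assms(2) by simp
  then have "continuous_on (cball x r) ?N"
    using r(2) by (intro continuous_on_sum continuous_on_norm) (blast intro: continuous_on_subset)
  then have "bounded (?N ` cball x r)"
    by (intro compact_imp_bounded compact_continuous_image) auto
  then obtain L where L: "\<And>y. y \<in> cball x r \<Longrightarrow> norm (?N y) \<le> L"
    unfolding bounded_iff by blast
  have on: "onorm (?D y) \<le> L" if y: "y \<in> cball x r" for y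
  proof (rule onorm_le)
    fix v
    have lin: "linear (?D y)" using der y r(2) has_derivative_linear by blast
    have "?D y v = ?D y (\<Sum>b\<in>Basis. (v \<bullet> b) *\<^sub>R b)" by (simp add: euclidean_representation)
    also have "\<dots> = (\<Sum>b\<in>Basis. (v \<bullet> b) *\<^sub>R ?D y b)"
      by (simp add: linear_sum[OF lin] linear_cmul[OF lin])
    also have "norm \<dots> \<le> (\<Sum>b\<in>Basis. norm v * norm (?D y b))"
      by (rule sum_norm_le) (simp add: Basis_le_norm mult_right_mono)
    also have "\<dots> = ?N y * norm v" by (simp add: sum_distrib_left mult.commute)
    also have "\<dots> \<le> L * norm v"
      using L[OF y] by (intro mult_right_mono) auto
    finally show "norm (?D y v) \<le> L * norm v" .
  qed
  have "norm (f y - f z) \<le> L * norm (y - z)" if "y \<in> cball x r" "z \<in> cball x r" for y z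
  proof (rule differentiable_bound[where S = "cball x r" and f' = ?D, OF convex_cball])
    show "(f has_derivative ?D w) (at w within cball x r)" if "w \<in> cball x r" for w
      by (rule has_derivative_at_withinI, rule der) (use r(2) that in blast)
  qed (use that on in blast)+
  then show ?thesis by (rule that[OF r])
qed

text \<open>Gronwall's argument for u = |x - y|^2: the bound |u'| <= 2 L u makes u exp(-2 L s)
  nonincreasing and u exp(2 L s) nondecreasing, and both vanish at \<open>t\<^sub>0\<close>. The
  first controls later times, the second earlier ones. The Lipschitz bound is asked only along the
  two curves.\<close>

lemma ode_unique:
  fixes x y :: "real \<Rightarrow> 'a::real_inner"
  assumes t\<^sub>0: "t\<^sub>0 \<in> {a<..<b}" and eq: "x t\<^sub>0 = y t\<^sub>0" and s: "s \<in> {a<..<b}"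
    and x: "\<And>s. s \<in> {a<..<b} \<Longrightarrow> (x has_vector_derivative f (x s)) (at s)"
    and y: "\<And>s. s \<in> {a<..<b} \<Longrightarrow> (y has_vector_derivative f (y s)) (at s)"
    and L: "\<And>s. s \<in> {a<..<b} \<Longrightarrow> norm (f (x s) - f (y s)) \<le> L * norm (x s - y s)"
  shows "x s = y s"
proof -
  define u where "u s = (x s - y s) \<bullet> (x s - y s)" for s
  define u' where "u' s = 2 * ((x s - y s) \<bullet> (f (x s) - f (y s)))" for s
  have u: "(u has_real_derivative u' s) (at s)" if "s \<in> {a<..<b}" for s
  proof -
    have "((\<lambda>s. x s - y s) has_derivative (\<lambda>h. h *\<^sub>R (f (x s) - f (y s)))) (at s)"
      using has_vector_derivative_diff[OF x[OF that] y[OF that]] by (simp add: has_vector_derivative_def)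
    from has_derivative_inner[OF this this] show ?thesis
      unfolding has_field_derivative_def u_def u'_def
      by (rule has_derivative_eq_rhs) (simp add: fun_eq_iff inner_commute algebra_simps)
  qed
  have u': "\<bar>u' s\<bar> \<le> 2 * L * u s" if "s \<in> {a<..<b}" for s
  proof -
    have "\<bar>u' s\<bar> \<le> 2 * (norm (x s - y s) * norm (f (x s) - f (y s)))"
      using Cauchy_Schwarz_ineq2[of "x s - y s" "f (x s) - f (y s)"] by (simp add: u'_def)
    also have "\<dots> \<le> 2 * (norm (x s - y s) * (L * norm (x s - y s)))"
      using L[OF that] by (intro mult_left_mono) auto
    also have "\<dots> = 2 * L * u s"
      by (simp add: u_def dot_square_norm power2_eq_square)
    finally show ?thesis .
  qed
  have der: "((\<lambda>s. u s * exp (c * s)) has_real_derivative (u' s + c * u s) * exp (c * s)) (at s)"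
    if "s \<in> {a<..<b}" for s c
    by (rule derivative_eq_intros u[OF that] refl | simp add: algebra_simps)+
  have "u s \<le> 0"
  proof (cases "t\<^sub>0 \<le> s")
    case True
    have "u t\<^sub>0 * exp (-(2*L) * t\<^sub>0) \<ge> u s * exp (-(2*L) * s)"
    proof (rule DERIV_nonpos_imp_nonincreasing[OF True, where f = "\<lambda>s. u s * exp (-(2*L) * s)"])
      fix r assume "t\<^sub>0 \<le> r" "r \<le> s"
      then have r: "r \<in> {a<..<b}" using t\<^sub>0 s by auto
      have "(u' r + -(2*L) * u r) * exp (-(2*L) * r) \<le> 0"
        using u'[OF r] by (intro mult_nonpos_nonneg) auto
      then show "\<exists>z. DERIV (\<lambda>s. u s * exp (-(2*L) * s)) r :> z \<and> z \<le> 0"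
        using der[OF r, of "-(2*L)"] by blast
    qed
    then show ?thesis by (simp add: u_def eq mult_le_0_iff not_le[symmetric])
  next
    case False
    have "u s * exp ((2*L) * s) \<le> u t\<^sub>0 * exp ((2*L) * t\<^sub>0)"
    proof (rule DERIV_nonneg_imp_nondecreasing[where f = "\<lambda>s. u s * exp ((2*L) * s)"])
      fix r assume "s \<le> r" "r \<le> t\<^sub>0"
      then have r: "r \<in> {a<..<b}" using t\<^sub>0 s by auto
      have "(u' r + (2*L) * u r) * exp ((2*L) * r) \<ge> 0"
        using u'[OF r] by (intro mult_nonneg_nonneg) auto
      then show "\<exists>z. DERIV (\<lambda>s. u s * exp ((2*L) * s)) r :> z \<and> z \<ge> 0"
        using der[OF r, of "2*L"] by blast
    qed (use False in simp)
    then show ?thesis by (simp add: u_def eq mult_le_0_iff not_le[symmetric])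
  qed
  moreover have "u s \<ge> 0" unfolding u_def by (rule inner_ge_zero)
  ultimately have "(x s - y s) \<bullet> (x s - y s) = 0" unfolding u_def by (rule antisym)
  then show ?thesis by simp
qed

text \<open>Continuity is demanded separately: the derivative condition is read through
  \<open>cmap d\<close>, whose values outside the domain of d are arbitrary, so it cannot by itself
  keep the curve in the chart.\<close>

definition integral_curve where
  "integral_curve M X \<gamma> \<longleftrightarrow> continuous_map euclideanreal (mtop M) \<gamma> \<and>
     (\<forall>t. \<forall>d\<in>charts_at M (\<gamma> t). ((\<lambda>s. cmap d (\<gamma> s)) has_vector_derivative X (\<gamma> t) d) (at t))"

lemma integral_curve_shift:
  assumes "integral_curve M X \<gamma>"
  shows "integral_curve M X (\<lambda>s. \<gamma> (s + t))"
  unfolding integral_curve_def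
proof (intro conjI allI ballI)
  have "continuous_map euclideanreal euclideanreal (\<lambda>s. s + t)"
    by (simp add: continuous_on_add continuous_on_id)
  from continuous_map_compose[OF this, of "mtop M" \<gamma>] show "continuous_map euclideanreal (mtop M) (\<lambda>s. \<gamma> (s + t))"
    using assms by (simp add: integral_curve_def o_def)
  fix s d assume "d \<in> charts_at M (\<gamma> (s + t))"
  then have "((\<lambda>s. cmap d (\<gamma> s)) has_vector_derivative X (\<gamma> (s + t)) d) (at (s + t))"
    using assms by (simp add: integral_curve_def)
  moreover have "((\<lambda>s. s + t) has_vector_derivative 1) (at s)"
    by (auto intro!: derivative_eq_intros)
  ultimately show "((\<lambda>s. cmap d (\<gamma> (s + t))) has_vector_derivative X (\<gamma> (s + t)) d) (at s)"
    using vector_diff_chain_at[of "\<lambda>s. s + t" 1 s "\<lambda>s. cmap d (\<gamma> s)"] by (simp add: o_def)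
qed

text \<open>The set of times at which the curves agree is closed because M is Hausdorff, open by
  uniqueness for the differential equation in a chart, and nonempty; the real line is
  connected.\<close>

lemma integral_curve_unique:
  assumes M: "smooth_manifold M" and X: "smooth_vector_field M X"
    and g1: "integral_curve M X \<gamma>\<^sub>1" and g2: "integral_curve M X \<gamma>\<^sub>2" and eq: "\<gamma>\<^sub>1 t\<^sub>0 = \<gamma>\<^sub>2 t\<^sub>0"
  shows "\<gamma>\<^sub>1 t = \<gamma>\<^sub>2 t"
proof -
  let ?A = "{t. \<gamma>\<^sub>1 t = \<gamma>\<^sub>2 t}"
  have c1: "continuous_map euclideanreal (mtop M) \<gamma>\<^sub>1" and c2: "continuous_map euclideanreal (mtop M) \<gamma>\<^sub>2"
    using g1 g2 by (auto simp: integral_curve_def)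
  have carr: "\<gamma>\<^sub>1 t \<in> carrier_of M" for t
    using continuous_map_image_subset_topspace[OF c1] by auto
  have "closed ?A"
    using closedin_continuous_maps_eq[OF _ c1 c2] M by (simp add: smooth_manifold_def)
  moreover have "open ?A"
  proof (rule iffD2[OF open_subopen], rule ballI)
    fix t assume "t \<in> ?A"
    then have t: "\<gamma>\<^sub>1 t = \<gamma>\<^sub>2 t" by simp
    obtain d where d: "d \<in> charts_at M (\<gamma>\<^sub>1 t)" using charts_at_nonempty[OF M carr] by blast
    then have da: "d \<in> atlas M" and dt: "\<gamma>\<^sub>1 t \<in> cdom d" by (auto simp: charts_at_def)
    let ?U = "cmap d ` cdom d" and ?x0 = "cmap d (\<gamma>\<^sub>1 t)" and ?f = "\<lambda>x. X (cinv d x) d"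
    have C1: "Ck_on 1 ?U ?f"
      using X da unfolding smooth_vector_field_def smooth_on_def by blast
    obtain r L where r: "r > 0" "cball ?x0 r \<subseteq> ?U"
      and L: "\<And>y z. y \<in> cball ?x0 r \<Longrightarrow> z \<in> cball ?x0 r \<Longrightarrow> norm (?f y - ?f z) \<le> L * norm (y - z)"
      using C1_locally_Lipschitz[OF chart_image_open[OF M da] C1] dt by (metis imageI)
    \<comment> \<open>The coordinate ball on which the field is Lipschitz, pulled back to M; by
      continuity both curves stay in it for times near t.\<close>
    let ?O = "{p \<in> cdom d. cmap d p \<in> ball ?x0 r}"
    have "openin (subtopology (mtop M) (cdom d)) {p \<in> topspace (subtopology (mtop M) (cdom d)). cmap d p \<in> ball ?x0 r}"
      by (rule openin_continuous_map_preimage[OF continuous_map_cmap[OF M da]]) simp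
    then have "openin (mtop M) {p \<in> topspace (subtopology (mtop M) (cdom d)). cmap d p \<in> ball ?x0 r}"
      by (rule openin_trans_full[OF _ chart_dom_open[OF M da]])
    moreover have "{p \<in> topspace (subtopology (mtop M) (cdom d)). cmap d p \<in> ball ?x0 r} = ?O"
      using chart_dom_subset[OF M da] by auto
    ultimately have O: "openin (mtop M) ?O" by simp
    have "open ({s. \<gamma>\<^sub>1 s \<in> ?O} \<inter> {s. \<gamma>\<^sub>2 s \<in> ?O})"
      using openin_continuous_map_preimage[OF c1 O] openin_continuous_map_preimage[OF c2 O] by (intro open_Int) simp_all
    moreover have "t \<in> {s. \<gamma>\<^sub>1 s \<in> ?O} \<inter> {s. \<gamma>\<^sub>2 s \<in> ?O}"
      using t dt r(1) by auto
    ultimately obtain e where e: "e > 0" "ball t e \<subseteq> {s. \<gamma>\<^sub>1 s \<in> ?O} \<inter> {s. \<gamma>\<^sub>2 s \<in> ?O}"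
      using open_contains_ball by blast
    let ?I = "{t - e<..<t + e}"
    have I: "?I = ball t e" by (simp add: ball_eq_greaterThanLessThan)
    have in1: "\<gamma>\<^sub>1 s \<in> ?O" and in2: "\<gamma>\<^sub>2 s \<in> ?O" if "s \<in> ?I" for s
      using e(2) that I by auto
    have "cmap d (\<gamma>\<^sub>1 s) = cmap d (\<gamma>\<^sub>2 s)" if s: "s \<in> ?I" for s
    proof (rule ode_unique[where f = ?f and L = L and a = "t - e" and b = "t + e" and t\<^sub>0 = t])
      show "t \<in> ?I" using e by simp
      show "s \<in> ?I" by (rule s)
      show "cmap d (\<gamma>\<^sub>1 t) = cmap d (\<gamma>\<^sub>2 t)" using t by simp
      fix s assume s: "s \<in> ?I"
      have 1: "d \<in> charts_at M (\<gamma>\<^sub>1 s)" "d \<in> charts_at M (\<gamma>\<^sub>2 s)"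
        using in1[OF s] in2[OF s] da by (auto simp: charts_at_def)
      have 2: "cinv d (cmap d (\<gamma>\<^sub>1 s)) = \<gamma>\<^sub>1 s" "cinv d (cmap d (\<gamma>\<^sub>2 s)) = \<gamma>\<^sub>2 s"
        using in1[OF s] in2[OF s] cinv_cmap[OF M da] by auto
      show "((\<lambda>s. cmap d (\<gamma>\<^sub>1 s)) has_vector_derivative ?f (cmap d (\<gamma>\<^sub>1 s))) (at s)"
        using g1 1 unfolding 2 integral_curve_def by blast
      show "((\<lambda>s. cmap d (\<gamma>\<^sub>2 s)) has_vector_derivative ?f (cmap d (\<gamma>\<^sub>2 s))) (at s)"
        using g2 1 unfolding 2 integral_curve_def by blast
      show "norm (?f (cmap d (\<gamma>\<^sub>1 s)) - ?f (cmap d (\<gamma>\<^sub>2 s))) \<le> L * norm (cmap d (\<gamma>\<^sub>1 s) - cmap d (\<gamma>\<^sub>2 s))"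
        by (rule L) (use in1[OF s] in2[OF s] in auto)
    qed
    then have "\<gamma>\<^sub>1 s = \<gamma>\<^sub>2 s" if "s \<in> ?I" for s
      by (rule inj_onD[OF chart_inj[OF M da]]) (use that in1[OF that] in2[OF that] in blast)+
    then show "\<exists>T. open T \<and> t \<in> T \<and> T \<subseteq> ?A"
      using e(1) by (intro exI[of _ ?I]) auto
  qed
  ultimately have "?A = {} \<or> ?A = UNIV" by (intro iffD1[OF clopen] conjI)
  moreover have "t\<^sub>0 \<in> ?A" using eq by (rule CollectI)
  ultimately have "t \<in> ?A" by fast
  then show ?thesis by (rule CollectD)
qed

section \<open>Group law and smoothness of flows\<close>

lemma flow_carrier: "is_flow M X \<phi> \<Longrightarrow> p \<in> carrier_of M \<Longrightarrow> \<phi> t p \<in> carrier_of M"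
  by (simp add: is_flow_def)

lemma flow_chart:
  assumes "is_flow M X \<phi>" "p \<in> carrier_of M" "c \<in> charts_at M p" "d \<in> charts_at M (\<phi> t p)"
  obtains W where "open W" "(t, cmap c p) \<in> W"
    "\<And>s y. (s, y) \<in> W \<Longrightarrow> y \<in> cmap c ` cdom c \<and> \<phi> s (cinv c y) \<in> cdom d"
    "smooth_on W (\<lambda>(s, y). cmap d (\<phi> s (cinv c y)))"
proof -
  have W: "\<forall>c\<in>charts_at M p. \<forall>d\<in>charts_at M (\<phi> t p).
        \<exists>W. open W \<and> (t, cmap c p) \<in> W \<and>
            (\<forall>(s, y)\<in>W. y \<in> cmap c ` cdom c \<and> \<phi> s (cinv c y) \<in> cdom d) \<and>
            smooth_on W (\<lambda>(s, y). cmap d (\<phi> s (cinv c y)))"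
    using assms(1,2) unfolding is_flow_def by blast
  obtain W where W: "open W" "(t, cmap c p) \<in> W"
      "\<forall>(s, y)\<in>W. y \<in> cmap c ` cdom c \<and> \<phi> s (cinv c y) \<in> cdom d"
      "smooth_on W (\<lambda>(s, y). cmap d (\<phi> s (cinv c y)))"
    using bspec[OF bspec[OF W assms(3)] assms(4)] by (elim exE conjE)
  show ?thesis by (rule that[OF W(1,2) _ W(4)]) (use W(3) in auto)
qed

text \<open>Joint smoothness in charts already contains joint continuity into the topology of M. It
  serves twice: with p fixed for orbits, and with t fixed for the maps
  \<open>\<phi> t\<close>.\<close>

lemma flow_nbhd:
  assumes M: "smooth_manifold M" and fl: "is_flow M X \<phi>" and p: "p \<in> carrier_of M"
    and c: "c \<in> charts_at M p" and O: "openin (mtop M) T" "\<phi> t p \<in> T"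
  obtains W where "open W" "(t, cmap c p) \<in> W"
    "\<And>s y. (s, y) \<in> W \<Longrightarrow> y \<in> cmap c ` cdom c \<and> \<phi> s (cinv c y) \<in> T"
proof -
  obtain d where d: "d \<in> charts_at M (\<phi> t p)"
    using charts_at_nonempty[OF M flow_carrier[OF fl p]] by blast
  then have da: "d \<in> atlas M" "\<phi> t p \<in> cdom d" by (auto simp: charts_at_def)
  obtain W where W: "open W" "(t, cmap c p) \<in> W"
    "\<And>s y. (s, y) \<in> W \<Longrightarrow> y \<in> cmap c ` cdom c \<and> \<phi> s (cinv c y) \<in> cdom d"
    "smooth_on W (\<lambda>(s, y). cmap d (\<phi> s (cinv c y)))"
    using flow_chart[OF fl p c d] by blast
  let ?Y = "\<lambda>(s, y). cmap d (\<phi> s (cinv c y))"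
  let ?T = "cmap d ` {q \<in> cdom d. q \<in> T}"
  have "continuous_on W ?Y" using W(4) unfolding smooth_on_def by (blast intro: Ck_on_continuous_on)
  moreover have "open ?T"
    by (rule chart_preimage_open[OF M da(1) continuous_map_id[unfolded id_def] O(1)])
  ultimately have "open (W \<inter> ?Y -` ?T)" by (intro continuous_open_preimage W(1))
  moreover have "cinv c (cmap c p) = p" using c cinv_cmap[OF M] by (auto simp: charts_at_def)
  then have "(t, cmap c p) \<in> W \<inter> ?Y -` ?T" using W(2) da O(2) by auto
  moreover have "y \<in> cmap c ` cdom c \<and> \<phi> s (cinv c y) \<in> T" if sy: "(s, y) \<in> W \<inter> ?Y -` ?T" for s y
  proof -
    have 1: "y \<in> cmap c ` cdom c" "\<phi> s (cinv c y) \<in> cdom d" using sy W(3)[of s y] by auto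
    obtain q where "q \<in> cdom d" "q \<in> T" "cmap d (\<phi> s (cinv c y)) = cmap d q"
      using sy unfolding Int_iff vimage_eq prod.case image_iff mem_Collect_eq by blast
    then show ?thesis using 1 inj_onD[OF chart_inj[OF M da(1)]] by metis
  qed
  ultimately show ?thesis using that by blast
qed

lemma flow_integral_curve:
  assumes M: "smooth_manifold M" and fl: "is_flow M X \<phi>" and p: "p \<in> carrier_of M"
  shows "integral_curve M X (\<lambda>t. \<phi> t p)"
  unfolding integral_curve_def
proof (intro conjI allI ballI)
  obtain c where c: "c \<in> charts_at M p" using charts_at_nonempty[OF M p] by blast
  have cp: "cinv c (cmap c p) = p" using c cinv_cmap[OF M] by (auto simp: charts_at_def)
  show "continuous_map euclideanreal (mtop M) (\<lambda>t. \<phi> t p)"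
    unfolding continuous_map_def
  proof (intro conjI allI impI)
    show "(\<lambda>t. \<phi> t p) \<in> topspace euclideanreal \<rightarrow> topspace (mtop M)" using flow_carrier[OF fl p] by auto
    fix T assume T: "openin (mtop M) T"
    have "open {t. \<phi> t p \<in> T}"
      unfolding open_subopen[of "{t. \<phi> t p \<in> T}"]
    proof
      fix t assume "t \<in> {t. \<phi> t p \<in> T}"
      then have "\<phi> t p \<in> T" by simp
      from flow_nbhd[OF M fl p c T this] obtain W where W: "open W" "(t, cmap c p) \<in> W"
        "\<And>s y. (s, y) \<in> W \<Longrightarrow> y \<in> cmap c ` cdom c \<and> \<phi> s (cinv c y) \<in> T" by blast
      have "open ((\<lambda>s. (s, cmap c p)) -` W)"
        by (intro open_vimage W(1) continuous_intros)
      then show "\<exists>S. open S \<and> t \<in> S \<and> S \<subseteq> {t. \<phi> t p \<in> T}"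
        using W(2) W(3)[of _ "cmap c p", unfolded cp] by (intro exI[of _ "(\<lambda>s. (s, cmap c p)) -` W"]) auto
    qed
    then show "openin euclideanreal {t \<in> topspace euclideanreal. \<phi> t p \<in> T}" by simp
  qed
  show "((\<lambda>s. cmap d (\<phi> s p)) has_vector_derivative X (\<phi> t p) d) (at t)" if "d \<in> charts_at M (\<phi> t p)" for t d
    using fl p that unfolding is_flow_def by blast
qed

text \<open>As functions of s, both sides are integral curves of X with the same value at s =
  0.\<close>

lemma flow_add:
  assumes M: "smooth_manifold M" and X: "smooth_vector_field M X" and fl: "is_flow M X \<phi>" and p: "p \<in> carrier_of M"
  shows "\<phi> s (\<phi> t p) = \<phi> (s + t) p"
proof (rule integral_curve_unique[OF M X, where \<gamma>\<^sub>1 = "\<lambda>s. \<phi> s (\<phi> t p)" and \<gamma>\<^sub>2 = "\<lambda>s. \<phi> (s + t) p" and t\<^sub>0 = 0 and t = s])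
  show "integral_curve M X (\<lambda>s. \<phi> s (\<phi> t p))"
    by (rule flow_integral_curve[OF M fl flow_carrier[OF fl p]])
  show "integral_curve M X (\<lambda>s. \<phi> (s + t) p)"
    by (rule integral_curve_shift[OF flow_integral_curve[OF M fl p]])
  show "\<phi> 0 (\<phi> t p) = \<phi> (0 + t) p"
    using fl flow_carrier[OF fl p] by (simp add: is_flow_def)
qed

lemma flow_zero: "is_flow M X \<phi> \<Longrightarrow> p \<in> carrier_of M \<Longrightarrow> \<phi> 0 p = p"
  by (simp add: is_flow_def)

text \<open>Freezing the time in the jointly smooth chart expression leaves a smooth map of the
  position.\<close>

lemma flow_smooth_map:
  assumes M: "smooth_manifold M" and fl: "is_flow M X \<phi>"
  shows "smooth_map M M (\<phi> t)"
  unfolding smooth_map_def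
proof (intro conjI ballI)
  show "continuous_map (mtop M) (mtop M) (\<phi> t)"
    unfolding continuous_map_def
  proof (intro conjI allI impI)
    show "\<phi> t \<in> carrier_of M \<rightarrow> carrier_of M" using flow_carrier[OF fl] by auto
    fix T assume T: "openin (mtop M) T"
    show "openin (mtop M) {p \<in> carrier_of M. \<phi> t p \<in> T}"
      unfolding openin_subopen[of _ "{p \<in> carrier_of M. \<phi> t p \<in> T}"]
    proof
      fix p assume "p \<in> {p \<in> carrier_of M. \<phi> t p \<in> T}"
      then have p: "p \<in> carrier_of M" "\<phi> t p \<in> T" by auto
      obtain c where c: "c \<in> charts_at M p" using charts_at_nonempty[OF M p(1)] by blast
      then have ca: "c \<in> atlas M" "p \<in> cdom c" by (auto simp: charts_at_def)
      from flow_nbhd[OF M fl p(1) c T p(2)] obtain W where W: "open W" "(t, cmap c p) \<in> W"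
        "\<And>s y. (s, y) \<in> W \<Longrightarrow> y \<in> cmap c ` cdom c \<and> \<phi> s (cinv c y) \<in> T" by blast
      let ?V = "(\<lambda>y. (t, y)) -` W"
      have "open ?V" by (intro open_vimage W(1) continuous_intros)
      then have "openin (subtopology (mtop M) (cdom c)) {q \<in> topspace (subtopology (mtop M) (cdom c)). cmap c q \<in> ?V}"
        by (intro openin_continuous_map_preimage[OF continuous_map_cmap[OF M ca(1)]]) simp
      then have "openin (mtop M) {q \<in> topspace (subtopology (mtop M) (cdom c)). cmap c q \<in> ?V}"
        by (rule openin_trans_full[OF _ chart_dom_open[OF M ca(1)]])
      moreover have "p \<in> {q \<in> topspace (subtopology (mtop M) (cdom c)). cmap c q \<in> ?V}"
        using p ca W(2) by auto
      moreover have "{q \<in> topspace (subtopology (mtop M) (cdom c)). cmap c q \<in> ?V} \<subseteq> {p \<in> carrier_of M. \<phi> t p \<in> T}"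
        using W(3) cinv_cmap[OF M ca(1)] by force
      ultimately show "\<exists>S. openin (mtop M) S \<and> p \<in> S \<and> S \<subseteq> {p \<in> carrier_of M. \<phi> t p \<in> T}" by blast
    qed
  qed
  fix c d assume c: "c \<in> atlas M" and d: "d \<in> atlas M"
  show "smooth_on (cmap c ` {p \<in> cdom c. \<phi> t p \<in> cdom d}) (coord_rep c (\<phi> t) d)"
    unfolding smooth_on_def
  proof (intro allI Ck_on_local)
    fix k x assume "x \<in> cmap c ` {p \<in> cdom c. \<phi> t p \<in> cdom d}"
    then obtain p where p: "x = cmap c p" "p \<in> cdom c" "\<phi> t p \<in> cdom d" by auto
    have pc: "p \<in> carrier_of M" using chart_dom_subset[OF M c] p(2) by blast
    from flow_chart[OF fl pc charts_atI[OF c p(2)] charts_atI[OF d p(3)]] obtain W where W: "open W" "(t, cmap c p) \<in> W"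
      "\<And>s y. (s, y) \<in> W \<Longrightarrow> y \<in> cmap c ` cdom c \<and> \<phi> s (cinv c y) \<in> cdom d"
      "smooth_on W (\<lambda>(s, y). cmap d (\<phi> s (cinv c y)))" by blast
    let ?V = "(\<lambda>y. (t, y)) -` W"
    have oV: "open ?V" by (intro open_vimage W(1) continuous_intros)
    have "Ck_on k ?V (\<lambda>y. (\<lambda>(s, y). cmap d (\<phi> s (cinv c y))) (t, y))"
      by (rule Ck_on_compose[OF oV Ck_on_Pair[OF oV Ck_on_const Ck_on_ident[OF oV]]])
         (use W(4) in \<open>auto simp: smooth_on_def\<close>)
    then have "Ck_on k ?V (coord_rep c (\<phi> t) d)"
      by (simp add: coord_rep_def o_def)
    then show "\<exists>W. open W \<and> x \<in> W \<and> Ck_on k W (coord_rep c (\<phi> t) d)"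
      using oV W(2) p(1) by (intro exI[of _ ?V]) auto
  qed
qed

text \<open>Compact Hausdorff spaces are normal, so there are Urysohn functions that equal 1 at p
  and vanish off a neighbourhood whose closure lies in one chart domain. Finitely many of their
  positivity sets cover M, and division by the sum normalises them.\<close>

lemma partition_of_unity_exists:
  assumes M: "smooth_manifold M" and comp: "compact_space (mtop M)"
  shows "\<exists>C \<rho>. partition_of_unity M C \<rho>"
proof -
  let ?X = "mtop M"
  have H: "Hausdorff_space ?X" using M by (simp add: smooth_manifold_def)
  have N: "normal_space ?X" using compact_Hausdorff_or_regular_imp_normal_space comp H by blast
  have ex: "\<exists>c V f. c \<in> atlas M \<and> openin ?X V \<and> ?X closure_of V \<subseteq> cdom c \<and>
      continuous_map ?X euclideanreal f \<and> (\<forall>q\<in>carrier_of M. 0 \<le> f q \<and> (f q \<noteq> 0 \<longrightarrow> q \<in> V)) \<and> f p = 1"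
    if p: "p \<in> carrier_of M" for p
  proof -
    obtain c where c: "c \<in> atlas M" "p \<in> cdom c" using charts_at_nonempty[OF M p] charts_atD[of _ M p] by blast
    have cl: "closedin ?X {p}" using H p by (simp add: closedin_Hausdorff_sing_eq)
    then obtain V where V: "openin ?X V" "p \<in> V" "?X closure_of V \<subseteq> cdom c"
      using N chart_dom_open[OF M c(1)] c(2) unfolding normal_space_alt by (metis empty_subsetI insert_subset)
    have "closedin ?X (carrier_of M - V)" using V(1) by blast
    then obtain f where f: "continuous_map ?X (top_of_set {0..1::real}) f" "f ` (carrier_of M - V) \<subseteq> {0}" "f ` {p} \<subseteq> {1}"
      using Urysohn_lemma[OF N _ cl, of "carrier_of M - V" 0 1] V(2) by (auto simp: disjnt_def)
    have "f q \<in> {0..1}" if "q \<in> carrier_of M" for q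
      using continuous_map_image_subset_topspace[OF f(1)] that by auto
    then show ?thesis
      using c V f by (intro exI[of _ c] exI[of _ V] exI[of _ f]) (auto simp: continuous_map_in_subtopology)
  qed
  obtain cc V f where
    cc: "\<And>p. p \<in> carrier_of M \<Longrightarrow> cc p \<in> atlas M" and V: "\<And>p. p \<in> carrier_of M \<Longrightarrow> ?X closure_of V p \<subseteq> cdom (cc p)"
    and f: "\<And>p. p \<in> carrier_of M \<Longrightarrow> continuous_map ?X euclideanreal (f p)"
    and f0: "\<And>p q. p \<in> carrier_of M \<Longrightarrow> q \<in> carrier_of M \<Longrightarrow> 0 \<le> f p q"
    and fV: "\<And>p q. p \<in> carrier_of M \<Longrightarrow> q \<in> carrier_of M \<Longrightarrow> f p q \<noteq> 0 \<Longrightarrow> q \<in> V p"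
    and f1: "\<And>p. p \<in> carrier_of M \<Longrightarrow> f p p = (1::real)"
  proof -
    \<comment> \<open>Chart, neighbourhood and function are packed into a triple so that one
      application of choice selects them together.\<close>
    define P where "P p t \<longleftrightarrow> fst t \<in> atlas M \<and> openin ?X (fst (snd t)) \<and> ?X closure_of (fst (snd t)) \<subseteq> cdom (fst t) \<and>
      continuous_map ?X euclideanreal (snd (snd t)) \<and>
      (\<forall>q\<in>carrier_of M. 0 \<le> snd (snd t) q \<and> (snd (snd t) q \<noteq> 0 \<longrightarrow> q \<in> fst (snd t))) \<and> snd (snd t) p = 1" for p t
    have "\<forall>p\<in>carrier_of M. \<exists>t. P p t"
    proof
      fix p assume "p \<in> carrier_of M"
      from ex[OF this] obtain c V f where "P p (c, V, f)" unfolding P_def fst_conv snd_conv by blast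
      then show "\<exists>t. P p t" ..
    qed
    from bchoice[OF this] obtain T where "\<forall>p\<in>carrier_of M. P p (T p)" ..
    then show ?thesis
      by (intro that[of "\<lambda>p. fst (T p)" "\<lambda>p. fst (snd (T p))" "\<lambda>p. snd (snd (T p))"])
        (simp_all add: P_def)
  qed
  let ?O = "\<lambda>p. {q \<in> carrier_of M. f p q \<in> {0<..}}"
  have oO: "openin ?X (?O p)" if "p \<in> carrier_of M" for p
    by (rule openin_continuous_map_preimage[OF f[OF that]]) simp
  have cov: "carrier_of M \<subseteq> \<Union>(?O ` carrier_of M)" using f1 by force
  have "(\<forall>U\<in>?O ` carrier_of M. openin ?X U) \<and> carrier_of M \<subseteq> \<Union>(?O ` carrier_of M)"
    using oO cov by blast
  then obtain \<F> where \<F>: "finite \<F>" "\<F> \<subseteq> ?O ` carrier_of M" "carrier_of M \<subseteq> \<Union>\<F>"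
    using comp[unfolded compact_space_alt, THEN spec, of "?O ` carrier_of M"] by blast
  from finite_subset_image[OF \<F>(1,2)] obtain F where "F \<subseteq> carrier_of M" "finite F" "\<F> = ?O ` F"
    by blast
  then have F: "finite F" "F \<subseteq> carrier_of M" "carrier_of M \<subseteq> \<Union>(?O ` F)"
    using \<F>(3) by simp_all
  let ?s = "\<lambda>q. \<Sum>p\<in>F. f p q"
  have s: "?s q > 0" if q: "q \<in> carrier_of M" for q
  proof -
    obtain p where p: "p \<in> F" "f p q > 0" using F(3) q by auto
    show ?thesis
      by (rule sum_pos2[OF F(1) p(1), where f = "\<lambda>p. f p q"]) (use p(2) F(2) q f0 in auto)
  qed
  \<comment> \<open>Several of the chosen points may share a chart, while weights are indexed by
    charts; hence their functions are added up.\<close>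
  define \<rho> where "\<rho> c q = (\<Sum>p\<in>{p\<in>F. cc p = c}. f p q) / ?s q" for c q
  have "partition_of_unity M (cc ` F) \<rho>"
    unfolding partition_of_unity_def
  proof (intro conjI ballI)
    show "finite (cc ` F)" "cc ` F \<subseteq> atlas M" using F cc by auto
    fix c assume c: "c \<in> cc ` F"
    show "continuous_map ?X euclideanreal (\<rho> c)"
      unfolding \<rho>_def
    proof (intro continuous_map_real_divide continuous_map_sum)
      show "?s q \<noteq> 0" if "q \<in> carrier_of M" for q using s[OF that] by simp
    qed (use F f in auto)
    show "0 \<le> \<rho> c q" if "q \<in> carrier_of M" for q
      unfolding \<rho>_def using F(2) f0 that by (intro divide_nonneg_nonneg sum_nonneg) auto
    have "{q \<in> carrier_of M. \<rho> c q \<noteq> 0} \<subseteq> \<Union>(V ` {p\<in>F. cc p = c})"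
    proof
      fix q assume q: "q \<in> {q \<in> carrier_of M. \<rho> c q \<noteq> 0}"
      then have "(\<Sum>p\<in>{p\<in>F. cc p = c}. f p q) \<noteq> 0" by (auto simp: \<rho>_def)
      then obtain p where "p \<in> {p\<in>F. cc p = c}" "f p q \<noteq> 0" by (meson sum.neutral)
      then show "q \<in> \<Union>(V ` {p\<in>F. cc p = c})" using fV[of p q] F(2) q by auto
    qed
    then have "?X closure_of {q \<in> carrier_of M. \<rho> c q \<noteq> 0} \<subseteq> ?X closure_of \<Union>(V ` {p\<in>F. cc p = c})"
      by (rule closure_of_mono)
    also have "\<dots> = \<Union>((\<lambda>S. ?X closure_of S) ` (V ` {p\<in>F. cc p = c}))"
      by (rule closure_of_Union) (use F in simp)
    also have "\<dots> \<subseteq> cdom c" using V F(2) by blast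
    finally show "?X closure_of {q \<in> carrier_of M. \<rho> c q \<noteq> 0} \<subseteq> cdom c" .
  next
    fix q assume q: "q \<in> carrier_of M"
    have "(\<Sum>c\<in>cc ` F. \<Sum>p\<in>{p\<in>F. cc p = c}. f p q) = ?s q"
      using sum.image_gen[OF F(1), of "\<lambda>p. f p q" cc] by simp
    then show "(\<Sum>c\<in>cc ` F. \<rho> c q) = 1"
      using s[OF q] by (simp add: \<rho>_def sum_divide_distrib[symmetric])
  qed
  then show ?thesis by blast
qed

subsection \<open>Positive definite matrices\<close>

text \<open>Symmetric elimination: the induction runs over a set of indices outside of which G
  vanishes and splits off one rank-one square per index. Since G is only semidefinite, a zero pivot
  can occur; it forces its whole row to vanish.\<close>

lemma psd_cholesky:
  fixes G :: "real^'n^'n"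
  assumes "\<And>i j. G $ i $ j = G $ j $ i" "\<And>x. 0 \<le> x \<bullet> (G *v x)"
  shows "\<exists>V :: real^'n^'n. G = transpose V ** V"
proof -
  have "\<exists>V :: 'n \<Rightarrow> real^'n. \<forall>i j. G $ i $ j = (\<Sum>a\<in>I. V a $ i * V a $ j)"
    if "finite I" "\<And>i j. i \<notin> I \<or> j \<notin> I \<Longrightarrow> G $ i $ j = 0" for I
    using that assms
  proof (induction I arbitrary: G rule: finite_induct)
    case empty
    then show ?case by simp
  next
    case (insert a I)
    have ip: "axis i 1 \<bullet> (G *v x) = (G *v x) $ i" for i x
      by (simp add: inner_axis')
    have sym: "x \<bullet> (G *v y) = y \<bullet> (G *v x)" for x y
      using insert.prems(2) by (simp add: inner_vec_def matrix_vector_mult_def sum_distrib_left sum_distrib_right)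
        (subst sum.swap, simp add: mult_ac)
    have col: "G *v axis j 1 = (\<chi> i. G $ i $ j)" for j
      by (simp add: matrix_vector_mult_def axis_def vec_eq_iff if_distrib cong: if_cong)
    have diag: "axis j 1 \<bullet> (G *v axis j 1) = G $ j $ j" for j
      by (subst ip) (simp add: col)
    have exp: "(x + t *\<^sub>R axis a 1) \<bullet> (G *v (x + t *\<^sub>R axis a 1))
        = x \<bullet> (G *v x) + 2 * t * (G *v x) $ a + t\<^sup>2 * G $ a $ a" for x t
    proof -
      have "x \<bullet> (G *v axis a 1) = (G *v x) $ a" using sym[of x "axis a 1"] ip by simp
      moreover note diag[of a]
      ultimately show ?thesis
        by (simp add: matrix_vector_right_distrib matrix_vector_mult_scaleR inner_add_left inner_add_right ip power2_eq_square algebra_simps)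
    qed
    show ?case
    proof (cases "G $ a $ a = 0")
      case True
      have row: "G $ a $ j = 0" for j
      proof (rule ccontr)
        assume n: "G $ a $ j \<noteq> 0"
        \<comment> \<open>Since \<open>G $ a $ a = 0\<close>, the form at
          \<open>axis j 1 + t *\<^sub>R axis a 1\<close> is affine in t; this t gives it the value
          -1.\<close>
        let ?t = "- (G $ j $ j + 1) / (2 * G $ a $ j)"
        have "axis j 1 \<bullet> (G *v axis j 1) + 2 * ?t * (G *v axis j 1) $ a = - 1"
          unfolding diag using n by (simp add: col field_simps)
        moreover have "0 \<le> axis j 1 \<bullet> (G *v axis j 1) + 2 * ?t * (G *v axis j 1) $ a"
          using insert.prems(3)[of "axis j 1 + ?t *\<^sub>R axis a 1"] unfolding exp True by simp
        ultimately show False by linarith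
      qed
      have "\<And>i j. i \<notin> I \<or> j \<notin> I \<Longrightarrow> G $ i $ j = 0"
        using insert.prems(1,2) row by (metis insert_iff)
      from insert.IH[OF this insert.prems(2,3)] obtain V :: "'n \<Rightarrow> real^'n"
        where V: "\<forall>i j. G $ i $ j = (\<Sum>b\<in>I. V b $ i * V b $ j)" by blast
      have "\<forall>i j. G $ i $ j = (\<Sum>b\<in>insert a I. (V(a := 0)) b $ i * (V(a := 0)) b $ j)"
        using V insert.hyps by (auto intro!: sum.cong)
      then show ?thesis by blast
    next
      case False
      have pos: "G $ a $ a > 0"
        using insert.prems(3)[of "axis a 1"] False unfolding diag by simp
      \<comment> \<open>The Schur complement of the pivot: what remains of G after a rank-one term
        has cleared the row and column of a.\<close>
      define H :: "real^'n^'n" where "H = (\<chi> i j. G $ i $ j - G $ a $ i * G $ a $ j / G $ a $ a)"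
      have H1: "\<And>i j. i \<notin> I \<or> j \<notin> I \<Longrightarrow> H $ i $ j = 0"
      proof -
        fix i j assume ij: "i \<notin> I \<or> j \<notin> I"
        show "H $ i $ j = 0"
        proof (cases "i = a \<or> j = a")
          case True
          then show ?thesis using False insert.prems(2)[of i a] by (auto simp: H_def)
        next
          case F: False
          then have "G $ i $ j = 0" "G $ a $ i * G $ a $ j = 0"
            using ij insert.prems(1) by auto
          then show ?thesis by (auto simp: H_def)
        qed
      qed
      have H2: "\<And>i j. H $ i $ j = H $ j $ i"
        using insert.prems(2) by (simp add: H_def mult.commute)
      have H3: "0 \<le> x \<bullet> (H *v x)" for x
      proof -
        have Hx: "H *v x = G *v x - ((G *v x) $ a / G $ a $ a) *\<^sub>R (\<chi> i. G $ a $ i)"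
          by (simp add: H_def matrix_vector_mult_def vec_eq_iff left_diff_distrib right_diff_distrib sum_subtractf sum_distrib_left sum_divide_distrib mult_ac)
        have "x \<bullet> (\<chi> i. G $ a $ i) = (G *v x) $ a"
          by (simp add: inner_vec_def matrix_vector_mult_def mult.commute)
        then have "x \<bullet> (H *v x) = x \<bullet> (G *v x) - ((G *v x) $ a)\<^sup>2 / G $ a $ a"
          by (simp add: Hx inner_diff_right power2_eq_square)
        \<comment> \<open>Shifting x along \<open>axis a 1\<close> to the minimum of the form gives
          exactly the value of the form of H at x.\<close>
        moreover have "0 \<le> x \<bullet> (G *v x) - ((G *v x) $ a)\<^sup>2 / G $ a $ a"
          using insert.prems(3)[of "x + (- (G *v x) $ a / G $ a $ a) *\<^sub>R axis a 1"] pos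
          unfolding exp by (simp add: power2_eq_square)
        ultimately show ?thesis by simp
      qed
      from insert.IH[OF H1 H2 H3] obtain V :: "'n \<Rightarrow> real^'n"
        where V: "\<forall>i j. H $ i $ j = (\<Sum>b\<in>I. V b $ i * V b $ j)" by blast
      let ?v = "\<chi> i. G $ a $ i / sqrt (G $ a $ a)"
      have "G $ i $ j = (\<Sum>b\<in>insert a I. (V(a := ?v)) b $ i * (V(a := ?v)) b $ j)" for i j
      proof -
        have "(\<Sum>b\<in>I. (V(a := ?v)) b $ i * (V(a := ?v)) b $ j) = H $ i $ j"
          using V insert.hyps by (auto intro!: sum.cong)
        moreover have "?v $ i * ?v $ j = G $ a $ i * G $ a $ j / G $ a $ a"
          using pos by simp
        ultimately show ?thesis using insert.hyps by (simp add: H_def)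
      qed
      then show ?thesis by blast
    qed
  qed
  from this[of UNIV] obtain V :: "'n \<Rightarrow> real^'n" where V: "\<And>i j. G $ i $ j = (\<Sum>a\<in>UNIV. V a $ i * V a $ j)"
    by auto
  then have "G = transpose (\<chi> a. V a) ** (\<chi> a. V a)"
    by (simp add: vec_eq_iff matrix_matrix_mult_def transpose_def)
  then show ?thesis by blast
qed

definition posdef :: "real^'n^'n \<Rightarrow> bool" where
  "posdef g \<longleftrightarrow> (\<forall>i j. g $ i $ j = g $ j $ i) \<and> (\<forall>x. x \<noteq> 0 \<longrightarrow> 0 < x \<bullet> (g *v x))"

lemma posdef_psd: "posdef g \<Longrightarrow> 0 \<le> x \<bullet> (g *v x)"
  unfolding posdef_def by (cases "x = 0") (auto intro: less_imp_le)

text \<open>The factorization gives det g = (det V)^2, which cannot be negative, and definiteness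
  excludes a kernel.\<close>

lemma posdef_det:
  fixes g :: "real^'n^'n"
  assumes "posdef g" shows "det g > 0"
proof -
  obtain V :: "real^'n^'n" where V: "g = transpose V ** V"
  proof -
    have "g $ i $ j = g $ j $ i" for i j using assms by (simp add: posdef_def)
    from psd_cholesky[of g, OF this posdef_psd[OF assms]] show ?thesis using that by (elim exE)
  qed
  have "inj ((*v) g)"
  proof (rule injI)
    fix x y assume "g *v x = g *v y"
    then have "g *v (x - y) = 0" by (simp add: matrix_vector_mult_diff_distrib)
    then have "x - y = 0" using assms unfolding posdef_def by (metis inner_zero_right less_irrefl)
    then show "x = y" by simp
  qed
  then have "det g \<noteq> 0" using det_nz_iff_inj[of "(*v) g"] by simp
  moreover have "det g = det V * det V" by (simp add: V det_mul)
  ultimately show ?thesis by (metis not_real_square_gt_zero mult_eq_0_iff)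
qed

lemma matrix_inv_eqI:
  fixes A B :: "real^'n^'n"
  assumes "A ** B = mat 1"
  shows "matrix_inv A = B"
proof -
  have BA: "B ** A = mat 1" using assms matrix_left_right_inverse by blast
  then have "A ** matrix_inv A = mat 1 \<and> matrix_inv A ** A = mat 1"
    unfolding matrix_inv_def using assms by (rule_tac someI2[of _ B]) auto
  then show ?thesis by (metis BA matrix_mul_assoc matrix_mul_lid matrix_mul_rid)
qed

lemma matrix_inv_mult:
  fixes A :: "real^'n^'n"
  assumes "det A \<noteq> 0"
  shows "A ** matrix_inv A = mat 1" "matrix_inv A ** A = mat 1"
proof -
  obtain B where "A ** B = mat 1" "B ** A = mat 1"
    using assms by (auto simp: invertible_det_nz[symmetric] invertible_def)
  then show "A ** matrix_inv A = mat 1" "matrix_inv A ** A = mat 1"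
    using matrix_inv_eqI by auto
qed

lemma transpose_symmetric: "(\<And>i j. g $ i $ j = g $ j $ i) \<Longrightarrow> transpose g = g"
  by (simp add: transpose_def vec_eq_iff)

lemma posdef_transpose: "posdef g \<Longrightarrow> transpose g = g"
  by (rule transpose_symmetric) (simp add: posdef_def)

lemma posdef_inv_transpose:
  assumes "posdef g" shows "transpose (matrix_inv g) = matrix_inv g"
proof -
  have "det g \<noteq> 0" using posdef_det[OF assms] by simp
  then have "transpose (matrix_inv g ** g) = mat 1" by (simp add: matrix_inv_mult transpose_mat)
  then have "g ** transpose (matrix_inv g) = mat 1"
    by (simp add: matrix_transpose_mul posdef_transpose[OF assms])
  then show ?thesis using matrix_inv_eqI by metis
qed

lemma posdef_inv_psd:
  assumes "posdef g" shows "0 \<le> x \<bullet> (matrix_inv g *v x)"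
proof -
  have "det g \<noteq> 0" using posdef_det[OF assms] by simp
  then have "x = g *v (matrix_inv g *v x)" by (simp add: matrix_vector_mul_assoc matrix_inv_mult)
  then show ?thesis using posdef_psd[OF assms, of "matrix_inv g *v x"] by (metis inner_commute)
qed

text \<open>With G the inverse of the Gram matrix this is the squared norm of s in the induced
  metric on tensors. The trace form reduces positivity and changes of basis to cyclicity of the
  trace.\<close>

definition tensor_sq :: "real^'n^'n \<Rightarrow> real^'n^'n \<Rightarrow> real" where
  "tensor_sq G s = trace (s ** G ** transpose s ** transpose G)"

lemma tensor_sq_sum:
  "tensor_sq G s = (\<Sum>i\<in>UNIV. \<Sum>j\<in>UNIV. \<Sum>k\<in>UNIV. \<Sum>l\<in>UNIV. G $ i $ k * G $ j $ l * s $ i $ j * s $ k $ l)"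
proof -
  have "tensor_sq G s = (\<Sum>i\<in>UNIV. \<Sum>k\<in>UNIV. \<Sum>l\<in>UNIV. \<Sum>j\<in>UNIV. G $ i $ k * G $ j $ l * s $ i $ j * s $ k $ l)"
    by (simp add: tensor_sq_def trace_def matrix_matrix_mult_def transpose_def sum_distrib_right sum_distrib_left mult_ac)
  also have "\<dots> = (\<Sum>i\<in>UNIV. \<Sum>k\<in>UNIV. \<Sum>j\<in>UNIV. \<Sum>l\<in>UNIV. G $ i $ k * G $ j $ l * s $ i $ j * s $ k $ l)"
    by (intro sum.cong refl sum.swap)
  also have "\<dots> = (\<Sum>i\<in>UNIV. \<Sum>j\<in>UNIV. \<Sum>k\<in>UNIV. \<Sum>l\<in>UNIV. G $ i $ k * G $ j $ l * s $ i $ j * s $ k $ l)"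
    by (intro sum.cong refl sum.swap)
  finally show ?thesis .
qed

text \<open>\<open>fiber_norm\<close> is a square root, and squaring it recovers the radicand only
  if that is nonnegative. With the inverse metric factored as V^T V, cyclicity turns the expression
  into tr(B B^T) for B = V s V^T.\<close>

lemma tensor_sq_nonneg:
  fixes g :: "real^'n^'n"
  assumes "posdef g" shows "0 \<le> tensor_sq (matrix_inv g) s"
proof -
  let ?G = "matrix_inv g"
  have "transpose ?G $ i $ j = ?G $ i $ j" for i j
    by (simp add: posdef_inv_transpose[OF assms])
  then have "?G $ i $ j = ?G $ j $ i" for i j
    by (simp add: transpose_def)
  from psd_cholesky[of ?G, OF this posdef_inv_psd[OF assms]]
  obtain V :: "real^'n^'n" where V: "?G = transpose V ** V" by (elim exE)
  let ?B = "V ** s ** transpose V"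
  have "tensor_sq ?G s = trace ((s ** transpose V ** V ** transpose s ** transpose V) ** V)"
    by (simp add: tensor_sq_def V matrix_transpose_mul matrix_mul_assoc)
  also have "\<dots> = trace (?B ** transpose ?B)"
    by (subst trace_mul_sym) (simp add: matrix_transpose_mul matrix_mul_assoc)
  also have "\<dots> \<ge> 0"
  proof -
    have "0 \<le> trace (B ** transpose B)" for B :: "real^'n^'n"
      by (simp add: trace_def matrix_matrix_mult_def transpose_def sum_nonneg)
    then show ?thesis .
  qed
  finally show ?thesis .
qed

text \<open>With K the inverse of J, the inverse of the transformed metric is K G K^T. The inner
  pairs of J and K cancel in the product, and the outer pair cancels by cyclicity of the
  trace.\<close>

lemma tensor_sq_change:
  fixes g s J :: "real^'n^'n"
  assumes "det g \<noteq> 0" "det J \<noteq> 0"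
  shows "tensor_sq (matrix_inv (transpose J ** g ** J)) (transpose J ** s ** J) = tensor_sq (matrix_inv g) s"
proof -
  let ?G = "matrix_inv g" and ?K = "matrix_inv J"
  have JK: "J ** ?K = mat 1" "?K ** J = mat 1" using matrix_inv_mult[OF assms(2)] by auto
  then have JKt: "transpose J ** transpose ?K = mat 1" "transpose ?K ** transpose J = mat 1"
    by (simp_all add: matrix_transpose_mul[symmetric] transpose_mat)
  have a1: "A ** J ** ?K = A" "A ** ?K ** J = A" "A ** transpose J ** transpose ?K = A"
      "A ** transpose ?K ** transpose J = A" "A ** g ** ?G = A" for A :: "real^'n^'n"
    using JK JKt matrix_inv_mult[OF assms(1)] by (simp_all add: matrix_mul_assoc[symmetric])
  have inv: "matrix_inv (transpose J ** g ** J) = ?K ** ?G ** transpose ?K"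
    by (rule matrix_inv_eqI) (simp add: matrix_mul_assoc a1 JKt)
  have "tensor_sq (matrix_inv (transpose J ** g ** J)) (transpose J ** s ** J)
      = trace ((transpose J ** (s ** ?G ** transpose s ** transpose ?G)) ** transpose ?K)"
    by (simp add: tensor_sq_def inv matrix_transpose_mul matrix_mul_assoc a1)
  also have "\<dots> = tensor_sq ?G s"
    by (subst trace_mul_sym) (simp add: tensor_sq_def matrix_mul_assoc JKt)
  finally show ?thesis .
qed

text \<open>For the symmetric matrix s = r a - g one has s G = r m - 1 with m = a G, and the squared
  norm is tr((r m - 1)^2); the constant term is tr 1 = n.\<close>

lemma tensor_sq_diff:
  fixes a g :: "real^'n^'n"
  assumes g: "posdef g" and a: "\<And>i j. a $ i $ j = a $ j $ i"
  shows "tensor_sq (matrix_inv g) (\<chi> i j. r * a $ i $ j - g $ i $ j)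
    = r\<^sup>2 * trace ((a ** matrix_inv g) ** (a ** matrix_inv g)) - 2 * r * trace (a ** matrix_inv g) + of_nat CARD('n)"
proof -
  let ?s = "\<chi> i j. r * a $ i $ j - g $ i $ j" and ?G = "matrix_inv g" and ?m = "a ** matrix_inv g"
  have "transpose ?s = ?s" using a g by (intro transpose_symmetric) (auto simp: posdef_def)
  then have "tensor_sq ?G ?s = trace ((?s ** ?G) ** (?s ** ?G))"
    by (simp add: tensor_sq_def posdef_inv_transpose[OF g] matrix_mul_assoc)
  moreover have "?s ** ?G = (\<chi> i j. r * ?m $ i $ j - (if i = j then 1 else 0))"
  proof -
    have "g ** ?G = mat 1" using posdef_det[OF g] by (simp add: matrix_inv_mult)
    then have "(g ** ?G) $ i $ j = (if i = j then 1 else 0)" for i j by (simp add: mat_def)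
    moreover have "(?s ** ?G) $ i $ j = r * ?m $ i $ j - (g ** ?G) $ i $ j" for i j
      by (simp add: matrix_matrix_mult_def left_diff_distrib sum_subtractf sum_distrib_left mult.assoc)
    ultimately show ?thesis by (simp add: vec_eq_iff)
  qed
  moreover have "trace ((\<chi> i j. r * m $ i $ j - (if i = j then 1 else 0)) ** (\<chi> i j. r * m $ i $ j - (if i = j then 1 else 0)))
      = r\<^sup>2 * trace (m ** m) - 2 * r * trace m + of_nat CARD('n)" for m :: "real^'n^'n"
  proof -
    have "(r * m $ i $ k - (if i = k then 1 else 0)) * (r * m $ k $ i - (if k = i then 1 else 0))
        = r\<^sup>2 * (m $ i $ k * m $ k $ i) + (if k = i then 1 - 2 * r * m $ i $ i else 0)" for i k
      by (simp add: power2_eq_square algebra_simps)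
    then show ?thesis
      by (simp add: trace_def matrix_matrix_mult_def sum.distrib sum_subtractf sum_distrib_left)
  qed
  ultimately show ?thesis by simp
qed

text \<open>A permutation other than the identity moves at least two indices. Differentiating one
  factor of its Leibniz term leaves an off-diagonal entry of the identity matrix, so only the
  identity permutation contributes.\<close>

lemma has_real_derivative_det_identity:
  fixes m :: "real \<Rightarrow> real^'n^'n"
  assumes m: "\<And>i j. ((\<lambda>t. m t $ i $ j) has_real_derivative m' i j) (at t)" and mt: "m t = mat 1"
  shows "((\<lambda>t. det (m t)) has_real_derivative (\<Sum>i\<in>UNIV. m' i i)) (at t)"
proof -
  let ?P = "{p :: 'n \<Rightarrow> 'n. p permutes UNIV}"
  let ?d = "\<lambda>p. of_int (sign p) * (\<Sum>i\<in>UNIV. m' i (p i) * (\<Prod>j\<in>UNIV - {i}. m t $ j $ p j))"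
  have "((\<lambda>t. det (m t)) has_real_derivative (\<Sum>p\<in>?P. ?d p)) (at t)"
    unfolding det_def by (intro DERIV_sum DERIV_cmult has_field_derivative_prod m)
  moreover have "(\<Sum>p\<in>?P. ?d p) = (\<Sum>p\<in>?P. if p = id then \<Sum>i\<in>UNIV. m' i i else 0)"
  proof (rule sum.cong[OF refl])
    fix p :: "'n \<Rightarrow> 'n" assume p: "p \<in> ?P"
    show "?d p = (if p = id then \<Sum>i\<in>UNIV. m' i i else 0)"
    proof (cases "p = id")
      case True
      then show ?thesis by (simp add: mt mat_def sign_id)
    next
      case False
      have "(\<Prod>j\<in>UNIV - {i}. m t $ j $ p j) = 0" for i
      proof -
        have "\<exists>j. j \<noteq> i \<and> p j \<noteq> j"
        proof (rule ccontr)
          assume "\<not> (\<exists>j. j \<noteq> i \<and> p j \<noteq> j)"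
          then have pj: "p j = j" if "j \<noteq> i" for j using that by blast
          have "p i = i" using p pj by (metis injD mem_Collect_eq permutes_inj)
          then have "p j = j" for j using pj by (cases "j = i") auto
          then have "p = id" by (simp add: fun_eq_iff)
          then show False using False by simp
        qed
        then obtain j where "j \<noteq> i" "p j \<noteq> j" by blast
        then show ?thesis
          by (intro prod_zero bexI[of _ j]) (auto simp: mt mat_def)
      qed
      then show ?thesis by (simp only: mult_zero_right sum.neutral_const) (simp add: False)
    qed
  qed
  moreover have "\<dots> = (\<Sum>i\<in>UNIV. m' i i)"
    using permutes_id[of UNIV] by (simp add: finite_permutations)
  ultimately show ?thesis by simp
qed

section \<open>Bilinear forms as matrices\<close>

lemma bilinear_form_matrix:
  fixes B :: "real^'n \<Rightarrow> real^'n \<Rightarrow> real"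
  assumes "\<And>w'. linear (\<lambda>w. B w w')" "\<And>w. linear (B w)"
  shows "B w w' = w \<bullet> ((\<chi> i j. B (axis i 1) (axis j 1)) *v w')"
proof -
  have lin: "f x = (\<Sum>i\<in>UNIV. x $ i * f (axis i 1))" if f: "linear f" for f :: "real^'n \<Rightarrow> real" and x
  proof -
    have "f x = f (\<Sum>i\<in>UNIV. (x $ i) *\<^sub>R axis i 1)"
      using basis_expansion[of x] by (simp add: scalar_mult_eq_scaleR)
    also have "\<dots> = (\<Sum>i\<in>UNIV. x $ i * f (axis i 1))"
      by (simp add: linear_sum[OF f] linear_cmul[OF f])
    finally show ?thesis .
  qed
  have "B w w' = (\<Sum>i\<in>UNIV. w $ i * B (axis i 1) w')"
    using lin[OF assms(1)] .
  also have "\<dots> = (\<Sum>i\<in>UNIV. w $ i * (\<Sum>j\<in>UNIV. w' $ j * B (axis i 1) (axis j 1)))"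
    by (intro sum.cong refl arg_cong2[where f = "(*)"] lin[OF assms(2)])
  also have "\<dots> = w \<bullet> ((\<chi> i j. B (axis i 1) (axis j 1)) *v w')"
    by (simp add: inner_vec_def matrix_vector_mult_def mult.commute)
  finally show ?thesis .
qed

lemma congruence_matrix:
  fixes A :: "real^'n^'n" and L :: "real^'k \<Rightarrow> real^'n"
  assumes "linear L"
  shows "(\<chi> i j. L (axis i 1) \<bullet> (A *v L (axis j 1))) = transpose (matrix L) ** A ** matrix L"
proof -
  have "L (axis i 1) \<bullet> (A *v L (axis j 1)) = (transpose (matrix L) ** A ** matrix L) $ i $ j" for i j
  proof -
    have "L (axis i 1) \<bullet> (A *v L (axis j 1)) = (\<Sum>k\<in>UNIV. \<Sum>l\<in>UNIV. L (axis i 1) $ k * A $ k $ l * L (axis j 1) $ l)"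
      by (simp add: inner_vec_def matrix_vector_mult_def sum_distrib_left mult_ac)
    also have "\<dots> = (\<Sum>l\<in>UNIV. \<Sum>k\<in>UNIV. L (axis i 1) $ k * A $ k $ l * L (axis j 1) $ l)"
      by (rule sum.swap)
    also have "\<dots> = (transpose (matrix L) ** A ** matrix L) $ i $ j"
      by (simp add: matrix_matrix_mult_def transpose_def matrix_def sum_distrib_right)
    finally show ?thesis .
  qed
  then show ?thesis by (simp add: vec_eq_iff)
qed

subsection \<open>Metrics in charts\<close>

lemma riemannian_smooth: "riemannian_manifold M g \<Longrightarrow> smooth_manifold M"
  by (simp add: riemannian_manifold_def)

text \<open>Fits the linearity axiom of \<open>riemannian_manifold\<close>, which combines scaling
  and addition in one equation.\<close>

lemma linear_axpy:
  fixes f :: "'a::real_vector \<Rightarrow> real"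
  assumes "\<And>a x y. f (a *\<^sub>R x + y) = a * f x + f y"
  shows "linear f"
proof (rule linearI)
  have "f 0 = 0" using assms[of 1 0 0] by simp
  then show "f (a *\<^sub>R x) = a *\<^sub>R f x" for a x using assms[of a x 0] by simp
  show "f (x + y) = f x + f y" for x y using assms[of 1 x y] by simp
qed

lemma riemannian_sym:
  "riemannian_manifold M g \<Longrightarrow> p \<in> carrier_of M \<Longrightarrow> u \<in> tangent_space M p \<Longrightarrow> v \<in> tangent_space M p \<Longrightarrow> g p u v = g p v u"
  unfolding riemannian_manifold_def by blast

text \<open>The axioms give linearity in the first argument; symmetry supplies it in the second, and
  then the Gram matrix determines the form.\<close>

lemma metric_form:
  assumes g: "riemannian_manifold M g" and c: "c \<in> charts_at M p"
  shows "g p (tvec M c p w) (tvec M c p w') = w \<bullet> (metric_matrix M g c p *v w')"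
proof -
  have M: "smooth_manifold M" using g by (rule riemannian_smooth)
  have p: "p \<in> carrier_of M" using charts_at_carrier[OF M c] .
  note T = tvec_tangent[OF M c]
  have ax: "\<forall>u\<in>tangent_space M p. \<forall>v\<in>tangent_space M p. \<forall>w\<in>tangent_space M p. \<forall>a.
      g p (\<lambda>c. a *\<^sub>R u c + w c) v = a * g p u v + g p w v"
    using g p unfolding riemannian_manifold_def by blast
  have lin: "g p (tvec M c p (a *\<^sub>R x + y)) (tvec M c p z) = a * g p (tvec M c p x) (tvec M c p z) + g p (tvec M c p y) (tvec M c p z)" for a x y z
    unfolding tvec_linear[OF M c] by (rule ax[rule_format, OF T T T])
  have l1: "linear (\<lambda>w. g p (tvec M c p w) (tvec M c p w'))" for w'
    by (rule linear_axpy) (rule lin)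
  have sym: "g p (tvec M c p x) (tvec M c p y) = g p (tvec M c p y) (tvec M c p x)" for x y
    by (rule riemannian_sym[OF g p T T])
  have l2: "linear (\<lambda>w'. g p (tvec M c p w) (tvec M c p w'))" for w
  proof -
    have "(\<lambda>w'. g p (tvec M c p w) (tvec M c p w')) = (\<lambda>w'. g p (tvec M c p w') (tvec M c p w))"
      by (rule ext, rule sym)
    then show ?thesis by (simp only: l1)
  qed
  from bilinear_form_matrix[where B = "\<lambda>w w'. g p (tvec M c p w) (tvec M c p w')", OF l1 l2]
  show ?thesis unfolding metric_matrix_def coord_vec_tvec .
qed

lemma metric_matrix_posdef:
  assumes g: "riemannian_manifold M g" and c: "c \<in> charts_at M p"
  shows "posdef (metric_matrix M g c p)"
  unfolding posdef_def
proof (intro conjI allI impI)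
  have M: "smooth_manifold M" using g by (rule riemannian_smooth)
  have p: "p \<in> carrier_of M" using charts_at_carrier[OF M c] .
  note T = tvec_tangent[OF M c]
  show "metric_matrix M g c p $ i $ j = metric_matrix M g c p $ j $ i" for i j
    unfolding metric_matrix_def coord_vec_tvec vec_lambda_beta by (rule riemannian_sym[OF g p T T])
  fix x :: "real^'b" assume "x \<noteq> 0"
  then have "tvec M c p x \<noteq> (\<lambda>c. 0)" using tvec_at[OF M c, of x] by (metis)
  then have "0 < g p (tvec M c p x) (tvec M c p x)"
    using g p T unfolding riemannian_manifold_def by blast
  then show "0 < x \<bullet> (metric_matrix M g c p *v x)" by (simp add: metric_form[OF g c])
qed

lemma inner_matrix_congruence:
  fixes J :: "real^'k^'n" and A :: "real^'n^'n"
  shows "(J *v w) \<bullet> (A *v (J *v w')) = w \<bullet> ((transpose J ** A ** J) *v w')"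
proof -
  have "(J *v w) \<bullet> y = w \<bullet> (transpose J *v y)" for y
    by (metis dot_lmul_matrix vector_transpose_matrix)
  then show ?thesis by (simp only: matrix_vector_mul_assoc matrix_mul_assoc)
qed

lemma pullback_form:
  assumes M: "smooth_manifold M" and g: "riemannian_manifold N g" and F: "smooth_map M N F"
    and c: "c \<in> charts_at M p" and d: "d \<in> charts_at N (F p)"
  shows "pullback M N F g p (tvec M c p w) (tvec M c p w')
    = w \<bullet> ((transpose (matrix (cder c F d p)) ** metric_matrix N g d (F p) ** matrix (cder c F d p)) *v w')"
proof -
  have N: "smooth_manifold N" using g by (rule riemannian_smooth)
  have J: "matrix (cder c F d p) *v x = cder c F d p x" for x
    using fun_cong[OF matrix_vector_mul(2)[OF cder_linear[OF F c d]]] .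
  show ?thesis
    unfolding inner_matrix_congruence[symmetric] J
    by (simp add: pullback_def differential_tvec[OF M N F c d] metric_form[OF g d])
qed

lemma metric_matrix_change:
  assumes g: "riemannian_manifold M g" and c: "c \<in> charts_at M p" and d: "d \<in> charts_at M p"
  shows "metric_matrix M g c p
    = transpose (matrix (cder c id d p)) ** metric_matrix M g d p ** matrix (cder c id d p)"
proof -
  have M: "smooth_manifold M" using g by (rule riemannian_smooth)
  have lin: "linear (cder c id d p)"
    by (rule cder_linear[OF smooth_map_id[OF M] c]) (simp add: d)
  have "metric_matrix M g c p = (\<chi> i j. cder c id d p (axis i 1) \<bullet> (metric_matrix M g d p *v cder c id d p (axis j 1)))"
    unfolding metric_form[OF g d, symmetric] tvec_change[OF M c d, symmetric]
    by (simp add: metric_matrix_def coord_vec_tvec)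
  then show ?thesis by (simp add: congruence_matrix[OF lin])
qed

text \<open>The chain rule for F' after F, with the same chart c at both ends, yields a left inverse
  of the Jacobian. The inverse relation is known on the carrier only, so the composite is compared
  with the identity on the chart image.\<close>

lemma cder_inverse_det:
  assumes M: "smooth_manifold M" and F: "smooth_map M M F" and F': "smooth_map M M F'"
    and inv: "\<And>p. p \<in> carrier_of M \<Longrightarrow> F' (F p) = p"
    and c: "c \<in> charts_at M p" and d: "d \<in> charts_at M (F p)"
  shows "det (matrix (cder c F d p)) \<noteq> 0"
proof -
  have p: "p \<in> carrier_of M" using charts_at_carrier[OF M c] .
  have ca: "c \<in> atlas M" "p \<in> cdom c" using c by (auto simp: charts_at_def)
  have c': "c \<in> charts_at M (F' (F p))" using c inv[OF p] by simp
  have "(coord_rep c (F' \<circ> F) c has_derivative cder d F' c (F p) \<circ> cder c F d p) (at (cmap c p))"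
    by (rule coord_rep_chain[OF M M smooth_map_continuous[OF F] c d smooth_map_has_derivative[OF F c d]
          smooth_map_has_derivative[OF F' d c']])
  moreover have "(coord_rep c (F' \<circ> F) c has_derivative id) (at (cmap c p))"
  proof (rule has_derivative_transform_within_open[OF has_derivative_id chart_image_open[OF M ca(1)]])
    show "cmap c p \<in> cmap c ` cdom c" using ca by blast
    fix x assume x: "x \<in> cmap c ` cdom c"
    have "cinv c x \<in> carrier_of M" using cinv_in[OF x] chart_dom_subset[OF M ca(1)] by blast
    then show "id x = coord_rep c (F' \<circ> F) c x" by (simp add: coord_rep_def inv cmap_cinv[OF x])
  qed
  ultimately have "cder d F' c (F p) \<circ> cder c F d p = id"
    by (rule has_derivative_unique)
  then have "inj (cder c F d p)" by (metis inj_on_id inj_on_imageI2)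
  then show ?thesis using det_nz_iff_inj[OF cder_linear[OF F c d]] by simp
qed

text \<open>The definition works in \<open>chart_at M p\<close>; passing to c is the change of basis
  of \<open>tensor_sq_change\<close>. The matrix A describes S on tangent vectors at p only, and
  coordinate vectors are such.\<close>

lemma fiber_norm_sq:
  assumes g: "riemannian_manifold M g" and c: "c \<in> charts_at M p"
    and S: "\<And>w w'. S (tvec M c p w) (tvec M c p w') = w \<bullet> (A *v w')"
  shows "(fiber_norm M g p S)\<^sup>2 = tensor_sq (matrix_inv (metric_matrix M g c p)) A"
proof -
  have M: "smooth_manifold M" using g by (rule riemannian_smooth)
  have p: "p \<in> carrier_of M" using charts_at_carrier[OF M c] .
  let ?b = "chart_at M p"
  have b: "?b \<in> charts_at M p" by (rule chart_at_in[OF M p])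
  let ?L = "cder ?b id c p"
  let ?s = "\<chi> i j. S (coord_vec M ?b p i) (coord_vec M ?b p j)"
  have lin: "linear ?L" by (rule cder_linear[OF smooth_map_id[OF M] b]) (simp add: c)
  have s: "?s = transpose (matrix ?L) ** A ** matrix ?L"
    unfolding congruence_matrix[OF lin, symmetric] S[symmetric] tvec_change[OF M b c, symmetric] coord_vec_tvec ..
  have det: "det (matrix ?L) \<noteq> 0"
    by (rule cder_inverse_det[OF M smooth_map_id[OF M] smooth_map_id[OF M] _ b]) (simp_all add: c)
  have detg: "det (metric_matrix M g c p) \<noteq> 0"
    using posdef_det[OF metric_matrix_posdef[OF g c]] by simp
  have eq: "tensor_sq (matrix_inv (metric_matrix M g ?b p)) ?s = tensor_sq (matrix_inv (metric_matrix M g c p)) A"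
    unfolding s metric_matrix_change[OF g b c] by (rule tensor_sq_change[OF detg det])
  have "fiber_norm M g p S = sqrt (tensor_sq (matrix_inv (metric_matrix M g ?b p)) ?s)"
    by (simp add: fiber_norm_def tensor_sq_sum Let_def)
  then show ?thesis
    using tensor_sq_nonneg[OF metric_matrix_posdef[OF g b], of ?s] eq by simp
qed

text \<open>A change of chart multiplies the root of the Gram determinant by |det J| and the
  determinant factor of the form by det J; orientation makes det J positive, so the two
  agree.\<close>

lemma volume_form_chart:
  assumes g: "riemannian_manifold M g" and or: "oriented_manifold M" and c: "c \<in> charts_at M p"
  shows "volume_form M g p (coord_vec M c p) = sqrt (det (metric_matrix M g c p))"
proof -
  have M: "smooth_manifold M" using g by (rule riemannian_smooth)
  have p: "p \<in> carrier_of M" using charts_at_carrier[OF M c] .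
  let ?b = "chart_at M p"
  have b: "?b \<in> charts_at M p" by (rule chart_at_in[OF M p])
  let ?J = "matrix (cder c id ?b p)"
  have "det ?J > 0" using or b c unfolding oriented_manifold_def charts_at_def by blast
  moreover have "det (metric_matrix M g c p) = (det ?J)\<^sup>2 * det (metric_matrix M g ?b p)"
    by (subst metric_matrix_change[OF g c b]) (simp add: det_mul power2_eq_square)
  moreover have "(\<chi> i j. coord_vec M c p j ?b $ i) = ?J"
    using b by (simp add: coord_vec_def matrix_def vec_eq_iff)
  ultimately show ?thesis
    by (simp add: volume_form_def real_sqrt_mult mult.commute)
qed

text \<open>The Gram matrix of the pulled back metric in the source chart c. No target chart enters,
  which suits flow maps that move p from chart to chart.\<close>

definition pull_matrix where
  "pull_matrix M g F c p = (\<chi> i j. pullback M M F g p (coord_vec M c p i) (coord_vec M c p j))"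

lemma pull_matrix_chart:
  assumes g: "riemannian_manifold M g" and F: "smooth_map M M F"
    and c: "c \<in> charts_at M p" and d: "d \<in> charts_at M (F p)"
  shows "pull_matrix M g F c p
    = transpose (matrix (cder c F d p)) ** metric_matrix M g d (F p) ** matrix (cder c F d p)"
proof -
  have M: "smooth_manifold M" using g by (rule riemannian_smooth)
  have "axis i 1 \<bullet> (A *v axis j 1) = A $ i $ j" for A :: "real^'b^'b" and i j
    unfolding inner_axis' by (simp add: matrix_vector_mult_def axis_def if_distrib cong: if_cong)
  then show ?thesis
    unfolding pull_matrix_def coord_vec_tvec pullback_form[OF M g F c d] by (simp add: vec_eq_iff)
qed

lemma pull_matrix_sym:
  assumes g: "riemannian_manifold M g" and F: "smooth_map M M F" and c: "c \<in> charts_at M p"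
  shows "pull_matrix M g F c p $ i $ j = pull_matrix M g F c p $ j $ i"
proof -
  have M: "smooth_manifold M" using g by (rule riemannian_smooth)
  have p: "p \<in> carrier_of M" using charts_at_carrier[OF M c] .
  note T = differential_tangent[OF M M F p tvec_tangent[OF M c]]
  show ?thesis
    unfolding pull_matrix_def pullback_def coord_vec_tvec vec_lambda_beta
    by (rule riemannian_sym[OF g smooth_map_carrier[OF F p] T T])
qed

lemma det_pull_matrix:
  assumes g: "riemannian_manifold M g" and F: "smooth_map M M F"
    and c: "c \<in> charts_at M p" and d: "d \<in> charts_at M (F p)"
  shows "det (pull_matrix M g F c p) = (det (matrix (cder c F d p)))\<^sup>2 * det (metric_matrix M g d (F p))"
  by (simp add: pull_matrix_chart[OF assms] det_mul power2_eq_square)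

text \<open>Meant for \<open>\<phi> 0\<close>, which is known to be the identity on the carrier
  only; near p its coordinate representation in c is still the identity.\<close>

lemma pull_matrix_identity:
  assumes g: "riemannian_manifold M g" and F: "smooth_map M M F"
    and id: "\<And>p. p \<in> carrier_of M \<Longrightarrow> F p = p" and c: "c \<in> charts_at M p"
  shows "pull_matrix M g F c p = metric_matrix M g c p"
proof -
  have M: "smooth_manifold M" using g by (rule riemannian_smooth)
  have p: "p \<in> carrier_of M" using charts_at_carrier[OF M c] .
  have ca: "c \<in> atlas M" "p \<in> cdom c" using c by (auto simp: charts_at_def)
  have "(coord_rep c F c has_derivative (\<lambda>x. x)) (at (cmap c p))"
  proof (rule has_derivative_transform_within_open[OF has_derivative_ident chart_image_open[OF M ca(1)]])
    show "cmap c p \<in> cmap c ` cdom c" using ca by blast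
    fix x assume x: "x \<in> cmap c ` cdom c"
    have "cinv c x \<in> carrier_of M" using cinv_in[OF x] chart_dom_subset[OF M ca(1)] by blast
    then show "x = coord_rep c F c x" by (simp add: coord_rep_def id cmap_cinv[OF x])
  qed
  from frechet_derivative_at[OF this] have J: "matrix (cder c F c p) = mat 1"
    by (simp add: matrix_id_mat_1[unfolded id_def, symmetric])
  have "c \<in> charts_at M (F p)" using c id[OF p] by simp
  from pull_matrix_chart[OF g F c this] show ?thesis
    by (simp add: J id[OF p] transpose_mat)
qed

text \<open>Since h multiplies the metric by the constant r, pulling back by the composite gives r
  times the metric pulled back by F. The integrand thereby depends only on the two Gram matrices of
  M, and N disappears.\<close>

lemma Phi_integrand_chart:
  fixes M :: "('p, 'n::finite) manifold"
  assumes g: "riemannian_manifold M g" and or: "oriented_manifold M" and N: "smooth_manifold N"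
    and F: "smooth_map M M F" and h: "smooth_map M N h"
    and conf: "tensor2_eq M (pullback M N h g\<^sub>N) (\<lambda>p u v. r * g p u v)"
    and c: "c \<in> charts_at M p"
  defines "m \<equiv> pull_matrix M g F c p ** matrix_inv (metric_matrix M g c p)"
  shows "(fiber_norm M g p (\<lambda>u w. pullback M N (h \<circ> F) g\<^sub>N p u w - g p u w))\<^sup>2 * volume_form M g p (coord_vec M c p)
    = sqrt (det (metric_matrix M g c p)) * (r\<^sup>2 * trace (m ** m) - 2 * r * trace m + of_nat CARD('n))"
proof -
  have M: "smooth_manifold M" using g by (rule riemannian_smooth)
  have p: "p \<in> carrier_of M" using charts_at_carrier[OF M c] .
  note T = tvec_tangent[OF M c]
  obtain d where d: "d \<in> charts_at M (F p)"
    using charts_at_nonempty[OF M smooth_map_carrier[OF F p]] by blast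
  let ?a = "pull_matrix M g F c p" and ?g = "metric_matrix M g c p"
  have pb: "pullback M N (h \<circ> F) g\<^sub>N p u w = r * pullback M M F g p u w"
    if "u \<in> tangent_space M p" "w \<in> tangent_space M p" for u w
    using conf smooth_map_carrier[OF F p] differential_tangent[OF M M F p] that
    by (simp add: tensor2_eq_def pullback_def differential_comp[OF M M F h p])
  have S: "pullback M N (h \<circ> F) g\<^sub>N p (tvec M c p w) (tvec M c p w') - g p (tvec M c p w) (tvec M c p w')
      = w \<bullet> ((\<chi> i j. r * ?a $ i $ j - ?g $ i $ j) *v w')" for w w'
  proof -
    have "(\<chi> i j. r * ?a $ i $ j - ?g $ i $ j) *v w' = r *\<^sub>R (?a *v w') - ?g *v w'"
      by (simp add: matrix_vector_mult_def vec_eq_iff left_diff_distrib sum_subtractf sum_distrib_left mult.assoc)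
    then show ?thesis
      by (simp add: pb[OF T T] pullback_form[OF M g F c d] pull_matrix_chart[OF g F c d, symmetric]
          metric_form[OF g c] inner_diff_right)
  qed
  show ?thesis
    unfolding fiber_norm_sq[OF g c, where S = "\<lambda>u w. pullback M N (h \<circ> F) g\<^sub>N p u w - g p u w", OF S]
      tensor_sq_diff[OF metric_matrix_posdef[OF g c] pull_matrix_sym[OF g F c]]
      volume_form_chart[OF g or c] m_def by (rule mult.commute)
qed

subsection \<open>Integration in charts\<close>

text \<open>U and the complement of K are open and cover the space, and f vanishes on their
  overlap.\<close>

lemma continuous_on_zero_extension:
  fixes f :: "'a::topological_space \<Rightarrow> 'b::real_normed_vector"
  assumes "open U" "closed K" "K \<subseteq> U" "continuous_on U f" "\<And>x. x \<in> U - K \<Longrightarrow> f x = 0"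
  shows "continuous_on UNIV (\<lambda>x. if x \<in> U then f x else 0)"
proof -
  have "continuous_on (U \<union> - K) (\<lambda>x. if x \<in> U then f x else 0)"
  proof (rule continuous_on_open_Un[OF assms(1)])
    show "open (- K)" using assms(2) by (simp add: open_Compl)
    show "continuous_on U (\<lambda>x. if x \<in> U then f x else 0)"
      by (rule continuous_on_eq[OF assms(4)]) simp
    show "continuous_on (- K) (\<lambda>x. if x \<in> U then f x else 0)"
      by (rule continuous_on_eq[of _ "\<lambda>_. 0"]) (use assms(5) in auto)
  qed
  moreover have "U \<union> - K = UNIV" using assms(3) by auto
  ultimately show ?thesis by simp
qed

lemma if_support_eq:
  assumes "T \<subseteq> U" "\<And>y. y \<in> U \<Longrightarrow> y \<notin> T \<Longrightarrow> u y = 0"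
  shows "(\<lambda>y. if y \<in> T then u y else 0) = (\<lambda>y. if y \<in> U then u y else 0)"
  using assms by (auto simp: fun_eq_iff)

text \<open>Chart images may be unbounded and irregular; compact support moves the integral to a
  box, where continuous functions are integrable.\<close>

lemma compact_support_has_integral:
  fixes f :: "real^'n \<Rightarrow> real"
  assumes "open U" "compact K" "K \<subseteq> U" "continuous_on U f" "\<And>x. x \<in> U - K \<Longrightarrow> f x = 0" "K \<subseteq> cbox a b"
  shows "(f has_integral integral (cbox a b) (\<lambda>x. if x \<in> U then f x else 0)) U"
proof -
  let ?F = "\<lambda>x. if x \<in> U then f x else 0"
  have "continuous_on UNIV ?F"
    by (rule continuous_on_zero_extension[OF assms(1) compact_imp_closed[OF assms(2)] assms(3-5)])
  then have "?F integrable_on cbox a b"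
    by (intro integrable_continuous) (blast intro: continuous_on_subset)
  from integrable_integral[OF this] have "(?F has_integral integral (cbox a b) ?F) UNIV"
    by (rule has_integral_on_superset) (use assms(5,6) in auto)
  then show ?thesis by (simp add: has_integral_restrict_UNIV)
qed

lemma compact_support_absolutely_integrable:
  fixes f :: "real^'n \<Rightarrow> real"
  assumes "open U" "compact K" "K \<subseteq> U" "continuous_on U f" "\<And>x. x \<in> U - K \<Longrightarrow> f x = 0"
  shows "f absolutely_integrable_on U"
proof -
  obtain a b where ab: "K \<subseteq> cbox a b"
    using bounded_subset_cbox_symmetric[OF compact_imp_bounded[OF assms(2)]] by metis
  have "(\<lambda>x. norm (f x)) integrable_on U"
    using compact_support_has_integral[OF assms(1-3) continuous_on_norm[OF assms(4)] _ ab] assms(5) by auto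
  moreover have "f integrable_on U"
    using compact_support_has_integral[OF assms ab] by auto
  ultimately show ?thesis by (simp add: absolutely_integrable_on_def)
qed

lemma Ck_on_partial_derivative:
  fixes D :: "real \<Rightarrow> 'a::real_normed_vector \<Rightarrow> real"
  assumes "Ck_on 1 (UNIV \<times> U) (\<lambda>(t, x). D t x)" "x \<in> U"
  shows "((\<lambda>t. D t x) has_real_derivative frechet_derivative (\<lambda>(t, x). D t x) (at (t, x)) (1, 0)) (at t)"
proof -
  let ?D = "\<lambda>(t, x). D t x"
  have "Ck_on (Suc 0) (UNIV \<times> U) ?D" using assms(1) by (simp only: One_nat_def)
  then have der: "(?D has_derivative frechet_derivative ?D (at (t, x))) (at (t, x))"
    by (rule Ck_on_has_derivative) (use assms(2) in blast)
  have "((\<lambda>t. (t, x)) has_derivative (\<lambda>h. (h, 0))) (at t)"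
    by (rule has_derivative_Pair[OF has_derivative_ident has_derivative_const])
  from diff_chain_at[OF this der]
  have "((\<lambda>t. D t x) has_derivative (\<lambda>h. frechet_derivative ?D (at (t, x)) (h, 0))) (at t)"
    by (simp add: o_def)
  moreover have "(\<lambda>h. frechet_derivative ?D (at (t, x)) (h, 0)) = (*) (frechet_derivative ?D (at (t, x)) (1, 0))"
  proof
    fix h
    have "frechet_derivative ?D (at (t, x)) (h *\<^sub>R (1, 0)) = h *\<^sub>R frechet_derivative ?D (at (t, x)) (1, 0)"
      by (rule linear_cmul[OF has_derivative_linear[OF der]])
    moreover have "h *\<^sub>R (1, 0) = (h, 0 :: 'a)" by simp
    ultimately show "frechet_derivative ?D (at (t, x)) (h, 0) = frechet_derivative ?D (at (t, x)) (1, 0) * h"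
      by (simp only: real_scaleR_def mult.commute)
  qed
  ultimately show ?thesis by (simp only: has_field_derivative_def)
qed

text \<open>The weight r is merely continuous and independent of time. Compact support replaces U by
  a fixed box, on which the extended time derivative is jointly continuous, so differentiation under
  the integral is allowed; at \<open>t\<^sub>0\<close> the differentiated integrand vanishes
  identically.\<close>

lemma leibniz_compact_support:
  fixes D :: "real \<Rightarrow> real^'n \<Rightarrow> real"
  assumes U: "open U" and K: "compact K" "K \<subseteq> U" and D: "Ck_on 1 (UNIV \<times> U) (\<lambda>(t, x). D t x)"
    and r: "continuous_on U r" "\<And>x. x \<in> U - K \<Longrightarrow> r x = 0"
    and zero: "\<And>x. x \<in> U \<Longrightarrow> ((\<lambda>t. D t x) has_real_derivative 0) (at t\<^sub>0)"
  shows "((\<lambda>t. integral U (\<lambda>x. r x * D t x)) has_real_derivative 0) (at t\<^sub>0)"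
proof -
  obtain a b where ab: "K \<subseteq> cbox a b"
    using bounded_subset_cbox_symmetric[OF compact_imp_bounded[OF K(1)]] by metis
  let ?D = "\<lambda>(t, x). D t x"
  let ?D' = "\<lambda>z. frechet_derivative ?D (at z) (1, 0)"
  have cD: "continuous_on (UNIV \<times> U) ?D" by (rule Ck_on_continuous_on[OF D])
  have cD': "continuous_on (UNIV \<times> U) ?D'" using D by simp
  have ct: "continuous_on U (D t)" for t
  proof -
    have "continuous_on U (\<lambda>x. ?D (t, x))"
      by (rule continuous_on_compose2[OF cD]) (auto intro!: continuous_intros)
    then show ?thesis by simp
  qed
  have int: "(\<lambda>t. integral U (\<lambda>x. r x * D t x)) = (\<lambda>t. integral (cbox a b) (\<lambda>x. if x \<in> U then r x * D t x else 0))"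
    using r(2) by (intro ext integral_unique compact_support_has_integral[OF U K _ _ ab] continuous_on_mult r(1) ct) simp
  let ?F' = "\<lambda>t x. if x \<in> U then r x * ?D' (t, x) else 0"
  have oU: "open (UNIV \<times> U :: (real \<times> (real^'n)) set)" by (rule open_Times[OF open_UNIV U])
  have cr: "continuous_on (UNIV \<times> U :: (real \<times> (real^'n)) set) (\<lambda>z. r (snd z))"
    by (rule continuous_on_compose2[OF r(1)]) (auto intro!: continuous_intros)
  \<comment> \<open>Closedness of \<open>UNIV \<times> K\<close> allows the zero extension jointly
    in time and space.\<close>
  have ext: "continuous_on UNIV (\<lambda>z :: real \<times> (real^'n). if z \<in> UNIV \<times> U then r (snd z) * ?D' z else 0)"
  proof (rule continuous_on_zero_extension[OF oU closed_Times[OF closed_UNIV compact_imp_closed[OF K(1)]]])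
    show "r (snd z) * ?D' z = 0" if "z \<in> UNIV \<times> U - UNIV \<times> K" for z :: "real \<times> (real^'n)"
      using that r(2)[of "snd z"] by (cases z) simp
    show "UNIV \<times> K \<subseteq> UNIV \<times> U" using K(2) by blast
  qed (intro continuous_on_mult cr cD')
  have ext2: "continuous_on UNIV (\<lambda>x. if x \<in> U then r x * D t x else 0)" for t
    by (rule continuous_on_zero_extension[OF U compact_imp_closed[OF K(1)] K(2)])
       (use r ct in \<open>auto intro!: continuous_on_mult\<close>)
  have "((\<lambda>t. integral (cbox a b) (\<lambda>x. if x \<in> U then r x * D t x else 0)) has_field_derivative
      integral (cbox a b) (?F' t\<^sub>0)) (at t\<^sub>0 within UNIV)"
  proof (rule leibniz_rule_field_derivative)
    show "((\<lambda>t. if x \<in> U then r x * D t x else 0) has_field_derivative ?F' t x) (at t within UNIV)" for t x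
      using Ck_on_partial_derivative[OF D, of x t] by (auto intro!: DERIV_cmult)
    show "(\<lambda>x. if x \<in> U then r x * D t x else 0) integrable_on cbox a b" for t
      by (intro integrable_continuous continuous_on_subset[OF ext2]) simp
    show "continuous_on (UNIV \<times> cbox a b) (\<lambda>(t, x). ?F' t x)"
      by (rule continuous_on_eq[OF continuous_on_subset[OF ext subset_UNIV]]) (auto split: if_splits)
  qed auto
  moreover have "?F' t\<^sub>0 = (\<lambda>x. 0)"
  proof
    fix x show "?F' t\<^sub>0 x = 0"
      using DERIV_unique[OF Ck_on_partial_derivative[OF D] zero, of x] by (cases "x \<in> U") simp_all
  qed
  ultimately show ?thesis unfolding int by simp
qed

section \<open>Supports and metric coefficients in charts\<close>

lemma compact_support_in_chart:
  assumes M: "smooth_manifold M" and comp: "compact_space (mtop M)" and c: "c \<in> atlas M"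
    and r: "continuous_map (mtop M) euclideanreal r"
    and supp: "mtop M closure_of {p \<in> carrier_of M. r p \<noteq> 0} \<subseteq> cdom c"
  obtains K where "compact K" "K \<subseteq> cmap c ` cdom c" "\<And>x. x \<in> cmap c ` cdom c - K \<Longrightarrow> r (cinv c x) = 0"
proof (rule that)
  let ?S = "mtop M closure_of {p \<in> carrier_of M. r p \<noteq> 0}"
  have "compactin (mtop M) ?S" by (rule closedin_compact_space[OF comp closedin_closure_of])
  then have "compactin (subtopology (mtop M) (cdom c)) ?S"
    using supp by (simp add: compactin_subtopology)
  from image_compactin[OF this continuous_map_cmap[OF M c]] show "compact (cmap c ` ?S)" by simp
  show "cmap c ` ?S \<subseteq> cmap c ` cdom c" using supp by blast
  fix x assume x: "x \<in> cmap c ` cdom c - cmap c ` ?S"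
  then have xU: "x \<in> cmap c ` cdom c" by blast
  have "cinv c x \<in> carrier_of M" using cinv_in[OF xU] chart_dom_subset[OF M c] by blast
  moreover have "cinv c x \<notin> ?S"
  proof
    assume "cinv c x \<in> ?S"
    then have "cmap c (cinv c x) \<in> cmap c ` ?S" by (rule imageI)
    then show False using x by (simp only: cmap_cinv[OF xU] Diff_iff simp_thms)
  qed
  moreover have "{p \<in> carrier_of M. r p \<noteq> 0} \<subseteq> ?S" by (rule closure_of_subset) auto
  ultimately show "r (cinv c x) = 0" by blast
qed

lemma continuous_on_cinv:
  assumes M: "smooth_manifold M" and c: "c \<in> atlas M" and r: "continuous_map (mtop M) euclideanreal r"
  shows "continuous_on (cmap c ` cdom c) (\<lambda>x. r (cinv c x))"
  using continuous_map_compose[OF continuous_map_cinv[OF M c] r] by (simp add: o_def)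

lemma metric_matrix_Ck:
  assumes g: "riemannian_manifold M g" and c: "c \<in> atlas M"
  shows "Ck_on k (cmap c ` cdom c) (\<lambda>x. metric_matrix M g c (cinv c x) $ i $ j)"
  using g c by (simp add: riemannian_manifold_def smooth_on_def metric_matrix_def)

lemma cinv_charts_at: "c \<in> atlas M \<Longrightarrow> x \<in> cmap c ` cdom c \<Longrightarrow> c \<in> charts_at M (cinv c x)"
  using cinv_in charts_atI by metis

text \<open>Each column of the inverse solves a linear system with the Gram matrix, so Cramer's rule
  applies column by column.\<close>

lemma metric_matrix_inv_Ck:
  assumes g: "riemannian_manifold M g" and c: "c \<in> atlas M"
  shows "Ck_on k (cmap c ` cdom c) (\<lambda>x. matrix_inv (metric_matrix M g c (cinv c x)) $ i $ j)"
proof -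
  let ?U = "cmap c ` cdom c" and ?g = "\<lambda>x. metric_matrix M g c (cinv c x)"
  have U: "open ?U" by (rule chart_image_open[OF riemannian_smooth[OF g] c])
  have det: "det (?g x) \<noteq> 0" if "x \<in> ?U" for x
    using posdef_det[OF metric_matrix_posdef[OF g cinv_charts_at[OF c that]]] by simp
  have "Ck_on k ?U (\<lambda>x. matrix_inv (?g x) *v axis j 1)"
    by (rule Ck_on_solve[OF U, where A = ?g and b = "\<lambda>_. axis j 1"])
       (auto intro: metric_matrix_Ck[OF g c] simp: det matrix_vector_mul_assoc matrix_inv_mult[OF det])
  from Ck_on_vec_nth[OF U this, of i] show ?thesis
    by (simp add: matrix_vector_mult_def axis_def if_distrib cong: if_cong)
qed

text \<open>The matrix contains space derivatives of the flow, which are directional derivatives of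
  the jointly smooth chart expression and hence jointly smooth themselves. The argument is local
  because the target chart d has to follow the flow.\<close>

lemma pull_matrix_flow_Ck:
  fixes M :: "('p, 'n::finite) manifold"
  assumes g: "riemannian_manifold M g" and fl: "is_flow M X \<phi>" and c: "c \<in> atlas M"
  shows "Ck_on k (UNIV \<times> cmap c ` cdom c) (\<lambda>(t, x). pull_matrix M g (\<phi> t) c (cinv c x) $ i $ j)"
proof (rule Ck_on_local)
  have M: "smooth_manifold M" using g by (rule riemannian_smooth)
  fix z :: "real \<times> (real^'n)" assume "z \<in> UNIV \<times> cmap c ` cdom c"
  then obtain t :: real and x where z: "z = (t, x)" and x: "x \<in> cmap c ` cdom c" by auto
  let ?p = "cinv c x"
  have cp: "c \<in> charts_at M ?p" by (rule cinv_charts_at[OF c x])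
  have p: "?p \<in> carrier_of M" by (rule charts_at_carrier[OF M cp])
  obtain d where d: "d \<in> charts_at M (\<phi> t ?p)" using charts_at_nonempty[OF M flow_carrier[OF fl p]] by blast
  then have da: "d \<in> atlas M" by (simp add: charts_at_def)
  let ?Y = "\<lambda>(s, y). cmap d (\<phi> s (cinv c y))"
  obtain W where W: "open W" "(t, cmap c ?p) \<in> W"
    "\<And>s y. (s, y) \<in> W \<Longrightarrow> y \<in> cmap c ` cdom c \<and> \<phi> s (cinv c y) \<in> cdom d" "smooth_on W ?Y"
    using flow_chart[OF fl p cp d] by blast
  have Y: "Ck_on k W ?Y" "Ck_on (Suc k) W ?Y" for k using W(4) unfolding smooth_on_def by blast+
  let ?D = "\<lambda>z. frechet_derivative ?Y (at z)"
  \<comment> \<open>The Jacobian in the space directions: the time component of each direction is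
    0.\<close>
  define J where "J z = (\<chi> k i. ?D z (0, axis i 1) $ k)" for z
  define h where "h z = metric_matrix M g d (cinv d (?Y z))" for z
  have J: "Ck_on k W (\<lambda>z. J z $ a $ b)" for a b
  proof -
    have "Ck_on k W (\<lambda>z. ?D z (0, axis b 1))" using Y(2)[of k] by simp
    from Ck_on_vec_nth[OF W(1) this, of a] show ?thesis by (simp add: J_def)
  qed
  have h: "Ck_on k W (\<lambda>z. h z $ a $ b)" for a b
    unfolding h_def
    by (rule Ck_on_compose[OF W(1) Y(1) metric_matrix_Ck[OF g da]]) (use W(3) in auto)
  have "Ck_on k W (\<lambda>z. (transpose (J z) ** h z ** J z) $ i $ j)"
    unfolding matrix_matrix_mult_def transpose_def vec_lambda_beta
    by (intro Ck_on_sum Ck_on_mult W(1) J h)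
  then have "Ck_on k W (\<lambda>(t, x). pull_matrix M g (\<phi> t) c (cinv c x) $ i $ j)"
  proof (rule Ck_on_cong[OF W(1), rotated])
    fix z assume zW: "z \<in> W"
    obtain s y where z: "z = (s, y)" by (cases z)
    have y: "y \<in> cmap c ` cdom c" and \<phi>d: "\<phi> s (cinv c y) \<in> cdom d" using W(3) zW z by auto
    have cq: "c \<in> charts_at M (cinv c y)" by (rule cinv_charts_at[OF c y])
    have dq: "d \<in> charts_at M (\<phi> s (cinv c y))" using da \<phi>d by (simp add: charts_at_def)
    have der: "(?Y has_derivative ?D (s, y)) (at (s, y))"
      by (rule smooth_on_has_derivative[OF W(4)]) (use zW z in simp)
    have "((\<lambda>y. (s, y)) has_derivative (\<lambda>v. (0, v))) (at y)"
      by (rule has_derivative_Pair[OF has_derivative_const has_derivative_ident])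
    from diff_chain_at[OF this der] have "(coord_rep c (\<phi> s) d has_derivative (\<lambda>v. ?D (s, y) (0, v))) (at y)"
      by (simp add: o_def coord_rep_def)
    note cd = frechet_derivative_at[OF this]
    have "matrix (cder c (\<phi> s) d (cinv c y)) = J z"
      unfolding matrix_def J_def z cmap_cinv[OF y] cd[symmetric] ..
    moreover have "h z = metric_matrix M g d (\<phi> s (cinv c y))"
      by (simp add: h_def z cinv_cmap[OF M da \<phi>d])
    ultimately show "(transpose (J z) ** h z ** J z) $ i $ j = (case z of (t, x) \<Rightarrow> pull_matrix M g (\<phi> t) c (cinv c x) $ i $ j)"
      using pull_matrix_chart[OF g flow_smooth_map[OF M fl] cq dq] by (simp add: z)
  qed
  then show "\<exists>W. open W \<and> z \<in> W \<and> Ck_on k W (\<lambda>(t, x). pull_matrix M g (\<phi> t) c (cinv c x) $ i $ j)"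
    using W(1,2) z cmap_cinv[OF x] by auto
qed

text \<open>Read in the charts c and d, the map F is a bijection from S onto T with invertible
  derivative up to weights: \<open>q (F p)\<close> vanishes unless \<open>F p\<close> lies in the
  domain of d, and \<open>r (F' p)\<close> vanishes unless \<open>F' p\<close> lies in that of c. So
  both integrals live on S and T, where the substitution takes place.\<close>

lemma volume_change_of_variables:
  assumes g: "riemannian_manifold M g" and comp: "compact_space (mtop M)"
    and F: "smooth_map M M F" and F': "smooth_map M M F'"
    and inv: "\<And>p. p \<in> carrier_of M \<Longrightarrow> F' (F p) = p" "\<And>p. p \<in> carrier_of M \<Longrightarrow> F (F' p) = p"
    and c: "c \<in> atlas M" and d: "d \<in> atlas M"
    and r: "continuous_map (mtop M) euclideanreal r" "mtop M closure_of {p \<in> carrier_of M. r p \<noteq> 0} \<subseteq> cdom c"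
    and q: "continuous_map (mtop M) euclideanreal q" "mtop M closure_of {p \<in> carrier_of M. q p \<noteq> 0} \<subseteq> cdom d"
  shows "integral (cmap c ` cdom c) (\<lambda>x. r (cinv c x) * q (F (cinv c x)) * sqrt (det (pull_matrix M g F c (cinv c x))))
    = integral (cmap d ` cdom d) (\<lambda>y. r (F' (cinv d y)) * q (cinv d y) * sqrt (det (metric_matrix M g d (cinv d y))))"
proof -
  have M: "smooth_manifold M" using g by (rule riemannian_smooth)
  let ?Uc = "cmap c ` cdom c" and ?Ud = "cmap d ` cdom d"
  let ?S = "cmap c ` {p \<in> cdom c. F p \<in> cdom d}" and ?T = "cmap d ` {p \<in> cdom d. F' p \<in> cdom c}"
  let ?f = "\<lambda>x. r (cinv c x) * q (F (cinv c x)) * sqrt (det (pull_matrix M g F c (cinv c x)))"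
  let ?u = "\<lambda>y. r (F' (cinv d y)) * q (cinv d y) * sqrt (det (metric_matrix M g d (cinv d y)))"
  let ?G = "coord_rep c F d"
  have carrc: "p \<in> carrier_of M" if "p \<in> cdom c" for p using chart_dom_subset[OF M c] that by blast
  have carrd: "p \<in> carrier_of M" if "p \<in> cdom d" for p using chart_dom_subset[OF M d] that by blast
  have z1: "s p = 0" if "mtop M closure_of {p \<in> carrier_of M. s p \<noteq> 0} \<subseteq> A" "p \<in> carrier_of M" "p \<notin> A"
    for s :: "'a \<Rightarrow> real" and p A
  proof -
    have "{p \<in> carrier_of M. s p \<noteq> 0} \<subseteq> mtop M closure_of {p \<in> carrier_of M. s p \<noteq> 0}"
      by (rule closure_of_subset) auto
    then show ?thesis using that by blast
  qed
  have oS: "open ?S" by (rule chart_preimage_open[OF M c smooth_map_continuous[OF F] chart_dom_open[OF M d]])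
  have der: "(?G has_derivative frechet_derivative ?G (at x)) (at x)" if "x \<in> ?S" for x
    using that smooth_on_has_derivative[of ?S ?G x] F c d unfolding smooth_map_def by blast
  have Gx: "cinv d (?G (cmap c p)) = F p" if "p \<in> cdom c" "F p \<in> cdom d" for p
    using that by (simp add: coord_rep_def cinv_cmap[OF M c] cinv_cmap[OF M d])
  have inj: "inj_on ?G ?S"
  proof (rule inj_onI)
    fix x y assume x: "x \<in> ?S" and y: "y \<in> ?S" and eq: "?G x = ?G y"
    from x obtain p where p: "x = cmap c p" "p \<in> cdom c" "F p \<in> cdom d" by auto
    from y obtain p' where p': "y = cmap c p'" "p' \<in> cdom c" "F p' \<in> cdom d" by auto
    have "F p = F p'" using Gx[OF p(2,3)] Gx[OF p'(2,3)] eq p(1) p'(1) by simp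
    then have "F' (F p) = F' (F p')" by (rule arg_cong)
    then have "p = p'" by (simp only: inv(1)[OF carrc[OF p(2)]] inv(1)[OF carrc[OF p'(2)]])
    then show "x = y" using p(1) p'(1) by simp
  qed
  have GS: "?G ` ?S = ?T"
  proof (intro equalityI subsetI)
    fix y assume "y \<in> ?G ` ?S"
    then obtain p where p: "p \<in> cdom c" "F p \<in> cdom d" "y = ?G (cmap c p)" by auto
    then have "y = cmap d (F p)" by (simp add: coord_rep_def cinv_cmap[OF M c])
    then show "y \<in> ?T" using p inv(1)[OF carrc[OF p(1)]] by auto
  next
    fix y assume "y \<in> ?T"
    then obtain p where p: "p \<in> cdom d" "F' p \<in> cdom c" "y = cmap d p" by auto
    then have "y = ?G (cmap c (F' p))" "F (F' p) \<in> cdom d"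
      using inv(2)[OF carrd[OF p(1)]] by (simp_all add: coord_rep_def cinv_cmap[OF M c])
    then show "y \<in> ?G ` ?S" using p(2) by blast
  qed
  obtain K where K: "compact K" "K \<subseteq> ?Ud" "\<And>y. y \<in> ?Ud - K \<Longrightarrow> q (cinv d y) = 0"
    using compact_support_in_chart[OF M comp d q] by blast
  have "continuous_on ?Ud ?u"
  proof (intro continuous_on_mult continuous_on_real_sqrt)
    have "continuous_map (mtop M) euclideanreal (\<lambda>p. r (F' p))"
      using continuous_map_compose[OF smooth_map_continuous[OF F'] r(1)] by (simp add: o_def)
    then show "continuous_on ?Ud (\<lambda>y. r (F' (cinv d y)))" by (rule continuous_on_cinv[OF M d])
    show "continuous_on ?Ud (\<lambda>y. q (cinv d y))" by (rule continuous_on_cinv[OF M d q(1)])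
    show "continuous_on ?Ud (\<lambda>y. det (metric_matrix M g d (cinv d y)))"
      by (rule Ck_on_continuous_on[OF Ck_on_det[OF chart_image_open[OF M d] metric_matrix_Ck[OF g d, where k = 0]]])
  qed
  then have absU: "?u absolutely_integrable_on ?Ud"
    by (rule compact_support_absolutely_integrable[OF chart_image_open[OF M d] K(1,2)]) (use K(3) in simp)
  have TU: "?T \<subseteq> ?Ud" by auto
  have u0: "?u y = 0" if "y \<in> ?Ud" "y \<notin> ?T" for y
  proof -
    have y: "cinv d y \<in> cdom d" "cmap d (cinv d y) = y" by (rule cinv_in[OF that(1)], rule cmap_cinv[OF that(1)])
    have "F' (cinv d y) \<notin> cdom c"
    proof
      assume "F' (cinv d y) \<in> cdom c"
      then have "cmap d (cinv d y) \<in> ?T" using y(1) by (intro imageI CollectI conjI)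
      then show False using that(2) unfolding y(2) by (rule notE[rotated])
    qed
    then have "r (F' (cinv d y)) = 0" by (rule z1[OF r(2) smooth_map_carrier[OF F' carrd[OF y(1)]]])
    then show ?thesis by simp
  qed
  \<comment> \<open>The integrand vanishes on the chart image off T, so integrability and integrals
    over the two sets coincide.\<close>
  have uext: "(\<lambda>y. if y \<in> ?T then ?u y else 0) = (\<lambda>y. if y \<in> ?Ud then ?u y else 0)"
    by (rule if_support_eq[OF TU u0])
  have absT: "?u absolutely_integrable_on (?G ` ?S)"
    unfolding GS using absU absolutely_integrable_restrict_UNIV[of ?T ?u] absolutely_integrable_restrict_UNIV[of ?Ud ?u]
    unfolding uext by blast
  have f0: "?f x = 0" if "x \<in> ?Uc" "x \<notin> ?S" for x
  proof -
    have x: "cinv c x \<in> cdom c" "cmap c (cinv c x) = x" by (rule cinv_in[OF that(1)], rule cmap_cinv[OF that(1)])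
    have "F (cinv c x) \<notin> cdom d"
    proof
      assume "F (cinv c x) \<in> cdom d"
      then have "cmap c (cinv c x) \<in> ?S" using x(1) by (intro imageI CollectI conjI)
      then show False using that(2) unfolding x(2) by (rule notE[rotated])
    qed
    then have "q (F (cinv c x)) = 0" by (rule z1[OF q(2) smooth_map_carrier[OF F carrc[OF x(1)]]])
    then show ?thesis by simp
  qed
  have SU: "?S \<subseteq> ?Uc" by auto
  have fext: "(\<lambda>y. if y \<in> ?S then ?f y else 0) = (\<lambda>y. if y \<in> ?Uc then ?f y else 0)"
    by (rule if_support_eq[OF SU f0])
  have feq: "?f x = \<bar>det (matrix (frechet_derivative ?G (at x)))\<bar> * ?u (?G x)" if "x \<in> ?S" for x
  proof -
    from that obtain p where p: "x = cmap c p" "p \<in> cdom c" "F p \<in> cdom d" by auto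
    have cp: "c \<in> charts_at M p" and dp: "d \<in> charts_at M (F p)" using p c d by (auto simp: charts_at_def)
    have ip: "cinv c x = p" using p cinv_cmap[OF M c] by simp
    have iG: "cinv d (?G x) = F p" using Gx[OF p(2,3)] p(1) by simp
    \<comment> \<open>The root of the squared Jacobian determinant is the absolute value that the
      substitution formula asks for.\<close>
    have "sqrt (det (pull_matrix M g F c p)) = \<bar>det (matrix (cder c F d p))\<bar> * sqrt (det (metric_matrix M g d (F p)))"
      by (simp add: det_pull_matrix[OF g F cp dp] real_sqrt_mult)
    then show ?thesis unfolding ip iG inv(1)[OF carrc[OF p(2)]] by (simp add: p(1))
  qed
  have "integral ?Uc ?f = integral ?S ?f"
    using integral_restrict_UNIV[of ?S ?f] integral_restrict_UNIV[of ?Uc ?f] unfolding fext by simp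
  also have "\<dots> = integral ?S (\<lambda>x. \<bar>det (matrix (frechet_derivative ?G (at x)))\<bar> * ?u (?G x))"
    by (rule integral_cong) (rule feq)
  also have "\<dots> = integral (?G ` ?S) ?u"
    by (rule integral_change_of_variables(1)[OF oS der inj absT])
  also have "\<dots> = integral ?Ud ?u"
    unfolding GS using integral_restrict_UNIV[of ?T ?u] integral_restrict_UNIV[of ?Ud ?u] unfolding uext by simp
  finally show ?thesis .
qed

subsection \<open>Critical points\<close>

text \<open>\<open>form_integral\<close> picks its partition independently of the form, so one pair
  C, \<rho> serves for the functional at all times.\<close>

lemma form_integral_partition:
  assumes M: "smooth_manifold M" and comp: "compact_space (mtop M)"
  obtains C \<rho> where "partition_of_unity M C \<rho>"
    "\<And>\<eta>. form_integral M \<eta> = (\<Sum>c\<in>C. integral (cmap c ` cdom c)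
           (\<lambda>x. \<rho> c (cinv c x) * \<eta> (cinv c x) (coord_vec M c (cinv c x))))"
proof -
  define z where "z = (SOME (C, \<rho>). partition_of_unity M C \<rho>)"
  have "case z of (C, \<rho>) \<Rightarrow> partition_of_unity M C \<rho>"
    unfolding z_def by (rule someI_ex) (use partition_of_unity_exists[OF M comp] in auto)
  then show ?thesis
    by (intro that[of "fst z" "snd z"]) (auto simp: form_integral_def z_def[symmetric] split: prod.splits)
qed

text \<open>Both sides are refined by the partition of unity on the other side of the map, so that the
  change of variables formula applies in pairs of charts.\<close>

lemma volume_invariant:
  assumes g: "riemannian_manifold M g" and comp: "compact_space (mtop M)"
    and F: "smooth_map M M F" and F': "smooth_map M M F'"
    and inv: "\<And>p. p \<in> carrier_of M \<Longrightarrow> F' (F p) = p" "\<And>p. p \<in> carrier_of M \<Longrightarrow> F (F' p) = p"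
    and pou: "partition_of_unity M C \<rho>"
    and cont: "\<And>c. c \<in> C \<Longrightarrow> continuous_on (cmap c ` cdom c) (\<lambda>x. det (pull_matrix M g F c (cinv c x)))"
  shows "(\<Sum>c\<in>C. integral (cmap c ` cdom c) (\<lambda>x. \<rho> c (cinv c x) * sqrt (det (pull_matrix M g F c (cinv c x)))))
    = (\<Sum>c\<in>C. integral (cmap c ` cdom c) (\<lambda>x. \<rho> c (cinv c x) * sqrt (det (metric_matrix M g c (cinv c x)))))"
proof -
  have M: "smooth_manifold M" using g by (rule riemannian_smooth)
  let ?U = "\<lambda>c. cmap c ` cdom c"
  let ?A = "\<lambda>c x. sqrt (det (pull_matrix M g F c (cinv c x)))"
  let ?B = "\<lambda>c x. sqrt (det (metric_matrix M g c (cinv c x)))"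
  have fin: "finite C" and at: "\<And>c. c \<in> C \<Longrightarrow> c \<in> atlas M"
    and \<rho>c: "\<And>c. c \<in> C \<Longrightarrow> continuous_map (mtop M) euclideanreal (\<rho> c)"
    and \<rho>s: "\<And>c. c \<in> C \<Longrightarrow> mtop M closure_of {p \<in> carrier_of M. \<rho> c p \<noteq> 0} \<subseteq> cdom c"
    and sum1: "\<And>p. p \<in> carrier_of M \<Longrightarrow> (\<Sum>c\<in>C. \<rho> c p) = 1"
    using pou unfolding partition_of_unity_def by blast+
  have carr: "cinv c x \<in> carrier_of M" if "c \<in> C" "x \<in> ?U c" for c x
    using charts_at_carrier[OF M cinv_charts_at[OF at[OF that(1)] that(2)]] .
  have int: "(\<lambda>x. \<rho> c (cinv c x) * w x) integrable_on ?U c" if c: "c \<in> C" and w: "continuous_on (?U c) w" for c w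
  proof -
    obtain K where K: "compact K" "K \<subseteq> ?U c" "\<And>y. y \<in> ?U c - K \<Longrightarrow> \<rho> c (cinv c y) = 0"
      using compact_support_in_chart[OF M comp at[OF c] \<rho>c[OF c] \<rho>s[OF c]] by blast
    have "(\<lambda>x. \<rho> c (cinv c x) * w x) absolutely_integrable_on ?U c"
      by (rule compact_support_absolutely_integrable[OF chart_image_open[OF M at[OF c]] K(1,2)])
         (use K(3) in \<open>auto intro!: continuous_on_mult w continuous_on_cinv[OF M at[OF c] \<rho>c[OF c]]\<close>)
    then show ?thesis by (rule set_lebesgue_integral_eq_integral(1))
  qed
  have cA: "continuous_on (?U c) (?A c)" if "c \<in> C" for c
    by (intro continuous_on_real_sqrt cont that)
  have cB: "continuous_on (?U c) (?B c)" if "c \<in> C" for c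
    by (intro continuous_on_real_sqrt Ck_on_continuous_on[OF Ck_on_det[OF chart_image_open[OF M at[OF that]] metric_matrix_Ck[OF g at[OF that], where k = 0]]])
  have c\<rho>: "continuous_on (?U c) (\<lambda>x. \<rho> d (G (cinv c x)))" if "c \<in> C" "d \<in> C" "smooth_map M M G" for c d G
  proof -
    have "continuous_map (mtop M) euclideanreal (\<lambda>p. \<rho> d (G p))"
      using continuous_map_compose[OF smooth_map_continuous[OF that(3)] \<rho>c[OF that(2)]] by (simp add: o_def)
    then show ?thesis by (rule continuous_on_cinv[OF M at[OF that(1)]])
  qed
  have 1: "integral (?U c) (\<lambda>x. \<rho> c (cinv c x) * ?A c x)
      = (\<Sum>d\<in>C. integral (?U c) (\<lambda>x. \<rho> c (cinv c x) * \<rho> d (F (cinv c x)) * ?A c x))" if c: "c \<in> C" for c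
  proof -
    have "integral (?U c) (\<lambda>x. \<rho> c (cinv c x) * ?A c x)
      = integral (?U c) (\<lambda>x. \<Sum>d\<in>C. \<rho> c (cinv c x) * \<rho> d (F (cinv c x)) * ?A c x)"
    proof (rule integral_cong)
      fix x assume x: "x \<in> ?U c"
      have "(\<Sum>d\<in>C. \<rho> c (cinv c x) * \<rho> d (F (cinv c x)) * ?A c x) = \<rho> c (cinv c x) * (\<Sum>d\<in>C. \<rho> d (F (cinv c x))) * ?A c x"
        by (simp only: sum_distrib_left sum_distrib_right)
      then show "\<rho> c (cinv c x) * ?A c x = (\<Sum>d\<in>C. \<rho> c (cinv c x) * \<rho> d (F (cinv c x)) * ?A c x)"
        using sum1[OF smooth_map_carrier[OF F carr[OF c x]]] by simp
    qed
    also have "\<dots> = (\<Sum>d\<in>C. integral (?U c) (\<lambda>x. \<rho> c (cinv c x) * \<rho> d (F (cinv c x)) * ?A c x))"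
      unfolding mult.assoc
      by (rule integral_sum[OF fin]) (intro int[OF c] continuous_on_mult cA[OF c] c\<rho>[OF c _ F])
    finally show ?thesis .
  qed
  have 2: "integral (?U d) (\<lambda>y. \<rho> d (cinv d y) * ?B d y)
      = (\<Sum>c\<in>C. integral (?U d) (\<lambda>y. \<rho> c (F' (cinv d y)) * \<rho> d (cinv d y) * ?B d y))" if d: "d \<in> C" for d
  proof -
    have "integral (?U d) (\<lambda>y. \<rho> d (cinv d y) * ?B d y)
      = integral (?U d) (\<lambda>y. \<Sum>c\<in>C. \<rho> d (cinv d y) * (\<rho> c (F' (cinv d y)) * ?B d y))"
    proof (rule integral_cong)
      fix x assume x: "x \<in> ?U d"
      have "(\<Sum>c\<in>C. \<rho> d (cinv d x) * (\<rho> c (F' (cinv d x)) * ?B d x)) = \<rho> d (cinv d x) * ((\<Sum>c\<in>C. \<rho> c (F' (cinv d x))) * ?B d x)"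
        by (simp only: sum_distrib_left sum_distrib_right)
      then show "\<rho> d (cinv d x) * ?B d x = (\<Sum>c\<in>C. \<rho> d (cinv d x) * (\<rho> c (F' (cinv d x)) * ?B d x))"
        using sum1[OF smooth_map_carrier[OF F' carr[OF d x]]] by simp
    qed
    also have "\<dots> = (\<Sum>c\<in>C. integral (?U d) (\<lambda>y. \<rho> d (cinv d y) * (\<rho> c (F' (cinv d y)) * ?B d y)))"
      by (rule integral_sum[OF fin]) (intro int[OF d] continuous_on_mult cB[OF d] c\<rho>[OF d _ F'])
    finally show ?thesis by (simp only: mult_ac)
  qed
  have "(\<Sum>c\<in>C. integral (?U c) (\<lambda>x. \<rho> c (cinv c x) * ?A c x))
      = (\<Sum>c\<in>C. \<Sum>d\<in>C. integral (?U d) (\<lambda>y. \<rho> c (F' (cinv d y)) * \<rho> d (cinv d y) * ?B d y))"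
    by (intro sum.cong refl trans[OF 1] volume_change_of_variables[OF g comp F F' inv] at \<rho>c \<rho>s)
  also have "\<dots> = (\<Sum>d\<in>C. \<Sum>c\<in>C. integral (?U d) (\<lambda>y. \<rho> c (F' (cinv d y)) * \<rho> d (cinv d y) * ?B d y))"
    by (rule sum.swap)
  also have "\<dots> = (\<Sum>d\<in>C. integral (?U d) (\<lambda>y. \<rho> d (cinv d y) * ?B d y))"
    by (intro sum.cong refl 2[symmetric])
  finally show ?thesis .
qed

text \<open>With \<open>a = \<phi>\<^sub>t\<^sup>* g\<close> and \<open>m = a g\<^sup>-\<^sup>1\<close>, the integrand \<open>r\<^sup>2 tr (m\<^sup>2) - 2 r tr m + n\<close> of the functional and the multiple
  \<open>4 r (r - 1) \<surd>(det m)\<close> of the volume density of \<open>a\<close> have the same derivative at \<open>m = 1\<close>.\<close>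

lemma has_real_derivative_deficit:
  fixes a :: "real \<Rightarrow> real^'n^'n"
  assumes a: "\<And>i j. ((\<lambda>t. a t $ i $ j) has_real_derivative a' i j) (at 0)" and a0: "a 0 = g" and g: "posdef g"
  defines "m \<equiv> \<lambda>t. a t ** matrix_inv g"
  shows "((\<lambda>t. sqrt (det g) * (r\<^sup>2 * trace (m t ** m t) - 2 * r * trace (m t) + of_nat CARD('n))
      - 4 * r * (r - 1) * sqrt (det (a t))) has_real_derivative 0) (at 0)"
proof -
  have dg: "det g > 0" by (rule posdef_det[OF g])
  define m' where "m' i j = (\<Sum>k\<in>UNIV. a' i k * matrix_inv g $ k $ j)" for i j
  define \<tau> where "\<tau> = (\<Sum>i\<in>UNIV. m' i i)"
  have m: "((\<lambda>t. m t $ i $ j) has_real_derivative m' i j) (at 0)" for i j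
    unfolding m_def m'_def matrix_matrix_mult_def vec_lambda_beta
    by (intro DERIV_sum DERIV_cmult_right a)
  have m0: "m 0 = mat 1" using dg by (simp add: m_def a0 matrix_inv_mult)
  have tr: "((\<lambda>t. trace (m t)) has_real_derivative \<tau>) (at 0)"
    unfolding trace_def \<tau>_def by (intro DERIV_sum m)
  have "((\<lambda>t. trace (m t ** m t)) has_real_derivative
      (\<Sum>i\<in>UNIV. \<Sum>k\<in>UNIV. m' i k * m 0 $ k $ i + m' k i * m 0 $ i $ k)) (at 0)"
    unfolding trace_def matrix_matrix_mult_def vec_lambda_beta
    by (intro DERIV_sum DERIV_mult m)
  moreover have "(\<Sum>i\<in>UNIV. \<Sum>k\<in>UNIV. m' i k * m 0 $ k $ i + m' k i * m 0 $ i $ k) = 2 * \<tau>"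
    by (simp add: m0 mat_def sum.distrib sum_distrib_left \<tau>_def if_distrib cong: if_cong)
  ultimately have trr: "((\<lambda>t. trace (m t ** m t)) has_real_derivative 2 * \<tau>) (at 0)" by simp
  have "a t = m t ** g" for t
    using dg by (simp add: m_def matrix_mul_assoc[symmetric] matrix_inv_mult)
  \<comment> \<open>Factoring out det g moves the determinant to m, which is the identity at time 0;
    there its derivative is the trace.\<close>
  then have dets: "sqrt (det (a t)) = sqrt (det (m t)) * sqrt (det g)" for t
    by (simp add: det_mul real_sqrt_mult)
  have dm: "((\<lambda>t. det (m t)) has_real_derivative \<tau>) (at 0)"
    unfolding \<tau>_def by (rule has_real_derivative_det_identity[OF m m0])
  have "(sqrt has_real_derivative 1 / 2) (at (det (m 0)))"
    using DERIV_real_sqrt[of "det (m 0)"] by (simp add: m0)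
  from DERIV_chain2[OF this dm] have sq: "((\<lambda>t. sqrt (det (m t))) has_real_derivative \<tau> / 2) (at 0)"
    by simp
  have "((\<lambda>t. sqrt (det g) * (r\<^sup>2 * trace (m t ** m t) - 2 * r * trace (m t) + of_nat CARD('n))
      - 4 * r * (r - 1) * (sqrt (det (m t)) * sqrt (det g))) has_real_derivative
      sqrt (det g) * (r\<^sup>2 * (2 * \<tau>) - 2 * r * \<tau> + 0) - 4 * r * (r - 1) * (\<tau> / 2 * sqrt (det g))) (at 0)"
    by (intro DERIV_diff DERIV_cmult DERIV_cmult_right DERIV_add DERIV_const tr trr sq)
  moreover have "sqrt (det g) * (r\<^sup>2 * (2 * \<tau>) - 2 * r * \<tau> + 0) - 4 * r * (r - 1) * (\<tau> / 2 * sqrt (det g)) = 0"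
    by (simp add: power2_eq_square algebra_simps)
  ultimately show ?thesis unfolding dets by (simp only:)
qed

text \<open>The functional is split into the integral of a deficit D and a constant. D is stationary
  at time 0 at each point, so its integral is stationary whatever the continuous weights
  are.\<close>

theorem conformal_constant_critical:
  fixes M :: "('p, 'n::finite) manifold" and N :: "('q, 'k::finite) manifold"
  assumes g: "riemannian_manifold M g" and or: "oriented_manifold M" and comp: "compact_space (mtop M)"
    and N: "smooth_manifold N" and h: "h \<in> Diff M N"
    and conf: "tensor2_eq M (pullback M N h g\<^sub>N) (\<lambda>p u v. r * g p u v)"
  shows "critical_point M g N g\<^sub>N h"
  unfolding critical_point_def
proof (intro conjI h allI impI, elim conjE)
  fix X \<phi> assume X: "smooth_vector_field M X" and fl: "is_flow M X \<phi>"
  have M: "smooth_manifold M" using g by (rule riemannian_smooth)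
  have sh: "smooth_map M N h" using h by (simp add: Diff_def)
  have s\<phi>: "smooth_map M M (\<phi> t)" for t by (rule flow_smooth_map[OF M fl])
  obtain C \<rho> where pou: "partition_of_unity M C \<rho>"
    and fi: "\<And>\<eta>. form_integral M \<eta> = (\<Sum>c\<in>C. integral (cmap c ` cdom c)
           (\<lambda>x. \<rho> c (cinv c x) * \<eta> (cinv c x) (coord_vec M c (cinv c x))))"
    using form_integral_partition[OF M comp] by blast
  have at: "\<And>c. c \<in> C \<Longrightarrow> c \<in> atlas M"
    and \<rho>c: "\<And>c. c \<in> C \<Longrightarrow> continuous_map (mtop M) euclideanreal (\<rho> c)"
    and \<rho>s: "\<And>c. c \<in> C \<Longrightarrow> mtop M closure_of {p \<in> carrier_of M. \<rho> c p \<noteq> 0} \<subseteq> cdom c"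
    using pou unfolding partition_of_unity_def by blast+
  let ?U = "\<lambda>c. cmap c ` cdom c"
  let ?a = "\<lambda>c t x. pull_matrix M g (\<phi> t) c (cinv c x)" and ?g = "\<lambda>c x. metric_matrix M g c (cinv c x)"
  define m where "m c t x = ?a c t x ** matrix_inv (?g c x)" for c t x
  define P where "P c t x = sqrt (det (?g c x)) * (r\<^sup>2 * trace (m c t x ** m c t x) - 2 * r * trace (m c t x) + of_nat CARD('n))" for c t x
  define D where "D c t x = P c t x - 4 * r * (r - 1) * sqrt (det (?a c t x))" for c t x
  have oU: "open (?U c)" if "c \<in> C" for c by (rule chart_image_open[OF M at[OF that]])
  have oTU: "open (UNIV \<times> ?U c :: (real \<times> (real^'n)) set)" if "c \<in> C" for c
    by (rule open_Times[OF open_UNIV oU[OF that]])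
  have ch: "c \<in> charts_at M (cinv c x)" if "c \<in> C" "x \<in> ?U c" for c x
    by (rule cinv_charts_at[OF at[OF that(1)] that(2)])
  have flow_inv: "\<phi> (- t) (\<phi> t p) = p" "\<phi> t (\<phi> (- t) p) = p" if "p \<in> carrier_of M" for t p
    using flow_add[OF M X fl that, of "- t" t] flow_add[OF M X fl that, of t "- t"] flow_zero[OF fl that] by simp_all
  have a_Ck: "Ck_on 1 (UNIV \<times> ?U c) (\<lambda>z. ?a c (fst z) (snd z) $ i $ j)" if "c \<in> C" for c i j
    using pull_matrix_flow_Ck[OF g fl at[OF that], of 1 i j] by (simp add: case_prod_unfold)
  have lift: "Ck_on 1 (UNIV \<times> ?U c) (\<lambda>z :: real \<times> (real^'n). f (snd z))" if "c \<in> C" "Ck_on 1 (?U c) f" for c and f :: "real^'n \<Rightarrow> real"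
    by (rule Ck_on_compose[OF oTU[OF that(1)] Ck_on_linear_map[OF oTU[OF that(1)] bounded_linear_snd] that(2)]) auto
  have pos_g: "posdef (?g c x)" if "c \<in> C" "x \<in> ?U c" for c x
    by (rule metric_matrix_posdef[OF g ch[OF that]])
  \<comment> \<open>Invertibility of the Jacobian of \<open>\<phi> t\<close> keeps the determinant
    away from 0 at all times, so that its square root is differentiable.\<close>
  have pos_a: "det (?a c t x) > 0" if "c \<in> C" "x \<in> ?U c" for c t x
  proof -
    have p: "cinv c x \<in> carrier_of M" by (rule charts_at_carrier[OF M ch[OF that]])
    obtain d where d: "d \<in> charts_at M (\<phi> t (cinv c x))"
      using charts_at_nonempty[OF M smooth_map_carrier[OF s\<phi> p]] by blast
    have "det (matrix (cder c (\<phi> t) d (cinv c x))) \<noteq> 0"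
      by (rule cder_inverse_det[OF M s\<phi> s\<phi> flow_inv(1) ch[OF that] d])
    then show ?thesis
      using posdef_det[OF metric_matrix_posdef[OF g d]] by (simp add: det_pull_matrix[OF g s\<phi> ch[OF that] d])
  qed
  have m_Ck: "Ck_on 1 (UNIV \<times> ?U c) (\<lambda>z. m c (fst z) (snd z) $ i $ j)" if "c \<in> C" for c i j
    unfolding m_def matrix_matrix_mult_def vec_lambda_beta
    by (intro Ck_on_sum Ck_on_mult oTU[OF that] a_Ck[OF that] lift[OF that metric_matrix_inv_Ck[OF g at[OF that]]])
  have sg_Ck: "Ck_on 1 (UNIV \<times> ?U c) (\<lambda>z :: real \<times> (real^'n). sqrt (det (?g c (snd z))))" if "c \<in> C" for c
    by (rule lift[OF that Ck_on_sqrt[OF oU[OF that] Ck_on_det[OF oU[OF that] metric_matrix_Ck[OF g at[OF that]]] posdef_det[OF pos_g[OF that]]]])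
  have P_Ck: "Ck_on 1 (UNIV \<times> ?U c) (\<lambda>z. P c (fst z) (snd z))" if "c \<in> C" for c
    unfolding P_def trace_def matrix_matrix_mult_def[of "m c _ _" "m c _ _"] vec_lambda_beta
    by (intro Ck_on_mult Ck_on_add Ck_on_diff Ck_on_sum Ck_on_const oTU[OF that] sg_Ck[OF that] m_Ck[OF that])
  have sa_Ck: "Ck_on 1 (UNIV \<times> ?U c) (\<lambda>z. sqrt (det (?a c (fst z) (snd z))))" if "c \<in> C" for c
    by (rule Ck_on_sqrt[OF oTU[OF that] Ck_on_det[OF oTU[OF that] a_Ck[OF that]]]) (auto intro: pos_a[OF that])
  have D_Ck: "Ck_on 1 (UNIV \<times> ?U c) (\<lambda>(t, x). D c t x)" if "c \<in> C" for c
    unfolding case_prod_unfold D_def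
    by (intro Ck_on_diff Ck_on_mult Ck_on_const oTU[OF that] P_Ck[OF that] sa_Ck[OF that])
  have slice: "continuous_on (?U c) (\<lambda>x. f t x)" if "Ck_on 1 (UNIV \<times> ?U c) (\<lambda>z. f (fst z) (snd z))" for c t and f :: "real \<Rightarrow> real^'n \<Rightarrow> real"
  proof -
    have "continuous_on (?U c) (\<lambda>x. (\<lambda>z. f (fst z) (snd z)) (t, x))"
      by (rule continuous_on_compose2[OF Ck_on_continuous_on[OF that]]) (auto intro!: continuous_intros)
    then show ?thesis by simp
  qed
  have D0: "((\<lambda>t. D c t x) has_real_derivative 0) (at 0)" if "c \<in> C" "x \<in> ?U c" for c x
    unfolding D_def P_def m_def
  proof (rule has_real_derivative_deficit[OF _ _ pos_g[OF that]])
    show "((\<lambda>t. ?a c t x $ i $ j) has_real_derivative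
        frechet_derivative (\<lambda>(t, x). ?a c t x $ i $ j) (at (0, x)) (1, 0)) (at 0)" for i j
      by (rule Ck_on_partial_derivative[OF pull_matrix_flow_Ck[OF g fl at[OF that(1)]] that(2)])
    show "?a c 0 x = ?g c x"
      by (rule pull_matrix_identity[OF g s\<phi> flow_zero[OF fl] ch[OF that]])
  qed
  obtain K where K: "\<And>c. c \<in> C \<Longrightarrow> compact (K c)" "\<And>c. c \<in> C \<Longrightarrow> K c \<subseteq> ?U c"
    "\<And>c y. c \<in> C \<Longrightarrow> y \<in> ?U c - K c \<Longrightarrow> \<rho> c (cinv c y) = 0"
  proof -
    have "\<forall>c\<in>C. \<exists>K. compact K \<and> K \<subseteq> ?U c \<and> (\<forall>y\<in>?U c - K. \<rho> c (cinv c y) = 0)"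
    proof
      fix c assume c: "c \<in> C"
      show "\<exists>K. compact K \<and> K \<subseteq> ?U c \<and> (\<forall>y\<in>?U c - K. \<rho> c (cinv c y) = 0)"
        by (rule compact_support_in_chart[OF M comp at[OF c] \<rho>c[OF c] \<rho>s[OF c]]) blast
    qed
    from bchoice[OF this] obtain K where "\<forall>c\<in>C. compact (K c) \<and> K c \<subseteq> ?U c \<and> (\<forall>y\<in>?U c - K c. \<rho> c (cinv c y) = 0)" ..
    then show ?thesis by (intro that[of K]) simp_all
  qed
  have r_cont: "continuous_on (?U c) (\<lambda>x. \<rho> c (cinv c x))" if "c \<in> C" for c
    by (rule continuous_on_cinv[OF M at[OF that] \<rho>c[OF that]])
  have int: "(\<lambda>x. \<rho> c (cinv c x) * w x) integrable_on ?U c" if c: "c \<in> C" and w: "continuous_on (?U c) w" for c w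
  proof -
    have "(\<lambda>x. \<rho> c (cinv c x) * w x) absolutely_integrable_on ?U c"
      by (rule compact_support_absolutely_integrable[OF oU[OF c] K(1,2)[OF c] continuous_on_mult[OF r_cont[OF c] w]])
         (simp add: K(3)[OF c])
    then show ?thesis by (rule set_lebesgue_integral_eq_integral(1))
  qed
  \<comment> \<open>The total volume of M, which is the value at t = 0.\<close>
  define V where "V = (\<Sum>c\<in>C. integral (?U c) (\<lambda>x. \<rho> c (cinv c x) * sqrt (det (?g c x))))"
  have vol: "(\<Sum>c\<in>C. integral (?U c) (\<lambda>x. \<rho> c (cinv c x) * sqrt (det (?a c t x)))) = V" for t
    unfolding V_def
  proof (rule volume_invariant[OF g comp s\<phi> s\<phi> flow_inv pou])
    show "continuous_on (?U c) (\<lambda>x. det (?a c t x))" if "c \<in> C" for c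
      using slice[OF Ck_on_det[OF oTU[OF that] a_Ck[OF that]], of t] .
  qed
  have "Phi M g N g\<^sub>N (h \<circ> \<phi> t) = (\<Sum>c\<in>C. integral (?U c) (\<lambda>x. \<rho> c (cinv c x) * D c t x)) + 4 * r * (r - 1) * V" for t
  proof -
    have "Phi M g N g\<^sub>N (h \<circ> \<phi> t) = (\<Sum>c\<in>C. integral (?U c) (\<lambda>x. \<rho> c (cinv c x) * P c t x))"
      unfolding Phi_def fi
    proof (intro sum.cong refl integral_cong)
      fix c x assume c: "c \<in> C" "x \<in> ?U c"
      show "\<rho> c (cinv c x) * ((fiber_norm M g (cinv c x)
          (\<lambda>u w. pullback M N (h \<circ> \<phi> t) g\<^sub>N (cinv c x) u w - g (cinv c x) u w))\<^sup>2
          * volume_form M g (cinv c x) (coord_vec M c (cinv c x))) = \<rho> c (cinv c x) * P c t x"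
        unfolding Phi_integrand_chart[OF g or N s\<phi> sh conf ch[OF c]] P_def m_def ..
    qed
    also have "\<dots> = (\<Sum>c\<in>C. integral (?U c) (\<lambda>x. \<rho> c (cinv c x) * D c t x)
        + 4 * r * (r - 1) * integral (?U c) (\<lambda>x. \<rho> c (cinv c x) * sqrt (det (?a c t x))))"
    proof (rule sum.cong[OF refl])
      fix c assume c: "c \<in> C"
      have iA: "(\<lambda>x. \<rho> c (cinv c x) * sqrt (det (?a c t x))) integrable_on ?U c"
        by (rule int[OF c slice[OF sa_Ck[OF c]]])
      have iD: "(\<lambda>x. \<rho> c (cinv c x) * D c t x) integrable_on ?U c"
        by (rule int[OF c slice[OF D_Ck[OF c, unfolded case_prod_unfold]]])
      have "integral (?U c) (\<lambda>x. \<rho> c (cinv c x) * P c t x)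
          = integral (?U c) (\<lambda>x. \<rho> c (cinv c x) * D c t x + 4 * r * (r - 1) * (\<rho> c (cinv c x) * sqrt (det (?a c t x))))"
        by (simp add: D_def algebra_simps)
      also have "\<dots> = integral (?U c) (\<lambda>x. \<rho> c (cinv c x) * D c t x)
          + integral (?U c) (\<lambda>x. 4 * r * (r - 1) * (\<rho> c (cinv c x) * sqrt (det (?a c t x))))"
        by (rule integral_add[OF iD integrable_on_mult_right[OF iA]])
      finally show "integral (?U c) (\<lambda>x. \<rho> c (cinv c x) * P c t x) = integral (?U c) (\<lambda>x. \<rho> c (cinv c x) * D c t x)
          + 4 * r * (r - 1) * integral (?U c) (\<lambda>x. \<rho> c (cinv c x) * sqrt (det (?a c t x)))"
        by simp
    qed
    also have "\<dots> = (\<Sum>c\<in>C. integral (?U c) (\<lambda>x. \<rho> c (cinv c x) * D c t x)) + 4 * r * (r - 1) * V"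
      unfolding sum.distrib sum_distrib_left[symmetric] vol ..
    finally show ?thesis .
  qed
  then have Phi: "(\<lambda>t. Phi M g N g\<^sub>N (h \<circ> \<phi> t))
      = (\<lambda>t. (\<Sum>c\<in>C. integral (?U c) (\<lambda>x. \<rho> c (cinv c x) * D c t x)) + 4 * r * (r - 1) * V)"
    by (rule ext)
  have "((\<lambda>t. (\<Sum>c\<in>C. integral (?U c) (\<lambda>x. \<rho> c (cinv c x) * D c t x)) + 4 * r * (r - 1) * V)
      has_real_derivative (\<Sum>c\<in>C. 0) + 0) (at 0)"
    by (intro DERIV_add DERIV_sum DERIV_const leibniz_compact_support[OF oU K(1,2) D_Ck r_cont K(3) D0])
  then show "((\<lambda>t. Phi M g N g\<^sub>N (h \<circ> \<phi> t)) has_real_derivative 0) (at 0)"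
    unfolding Phi by simp
qed

text \<open>Both parts are instances of the conformal case with r = R^2.\<close>

theorem corollaryA4:
  assumes codim: "CARD('m::finite) = CARD('n::finite) + 1"
  shows
    "(\<forall>(M :: ('p, 'n) manifold) g\<^sub>M (\<iota> :: 'p \<Rightarrow> real^'m) (N :: ('q, 'n) manifold) g\<^sub>N h (R :: real).
        closed_embedded_manifold M g\<^sub>M \<iota> \<and> riemannian_manifold N g\<^sub>N \<and> h \<in> Diff M N \<and>
        tensor2_eq M (pullback M N h g\<^sub>N) (\<lambda>p u v. R\<^sup>2 * g\<^sub>M p u v)
        \<longrightarrow> critical_point M g\<^sub>M N g\<^sub>N h) \<and>
     (\<forall>(M :: (real^'m, 'n) manifold) g\<^sub>M (N :: (real^'m, 'n) manifold) g\<^sub>N f (R :: real).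
        R > 0 \<and> closed_embedded_manifold M g\<^sub>M (\<lambda>p. p) \<and>
        riemannian_manifold N g\<^sub>N \<and> carrier_of N = (\<lambda>p. R *\<^sub>R p) ` carrier_of M \<and>
        isometric_embedding N g\<^sub>N euclid euclid_metric (\<lambda>p. p) \<and>
        isometry N g\<^sub>N N g\<^sub>N f
        \<longrightarrow> critical_point M g\<^sub>M N g\<^sub>N (f \<circ> (\<lambda>p. R *\<^sub>R p)))"
proof (intro conjI allI impI; elim conjE)
  fix M :: "('p, 'n) manifold" and g\<^sub>M and \<iota> :: "'p \<Rightarrow> real^'m" and N :: "('q, 'n) manifold" and g\<^sub>N h and R :: real
  assume M: "closed_embedded_manifold M g\<^sub>M \<iota>" and N: "riemannian_manifold N g\<^sub>N" and h: "h \<in> Diff M N"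
    and conf: "tensor2_eq M (pullback M N h g\<^sub>N) (\<lambda>p u v. R\<^sup>2 * g\<^sub>M p u v)"
  show "critical_point M g\<^sub>M N g\<^sub>N h"
    by (rule conformal_constant_critical[OF _ _ _ riemannian_smooth[OF N] h conf])
       (use M in \<open>simp_all add: closed_embedded_manifold_def\<close>)
next
  fix M :: "(real^'m, 'n) manifold" and g\<^sub>M and N :: "(real^'m, 'n) manifold" and g\<^sub>N f and R :: real
  assume R: "R > 0" and cM: "closed_embedded_manifold M g\<^sub>M (\<lambda>p. p)" and gN: "riemannian_manifold N g\<^sub>N"
    and carr: "carrier_of N = (\<lambda>p. R *\<^sub>R p) ` carrier_of M"
    and eN: "isometric_embedding N g\<^sub>N euclid euclid_metric (\<lambda>p. p)"
    and f: "isometry N g\<^sub>N N g\<^sub>N f"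
  have gM: "riemannian_manifold M g\<^sub>M" and or: "oriented_manifold M" and comp: "compact_space (mtop M)"
    and eM: "isometric_embedding M g\<^sub>M euclid euclid_metric (\<lambda>p. p)"
    using cM by (simp_all add: closed_embedded_manifold_def)
  have M: "smooth_manifold M" and N: "smooth_manifold N"
    using gM gN by (simp_all add: riemannian_smooth)
  have hR: "(\<lambda>p. R *\<^sub>R p) \<in> Diff M N"
    by (rule radial_map_Diff[OF M N eM eN _ carr]) (use R in simp)
  then have sR: "smooth_map M N (\<lambda>p. R *\<^sub>R p)" by (simp add: Diff_def)
  show "critical_point M g\<^sub>M N g\<^sub>N (f \<circ> (\<lambda>p. R *\<^sub>R p))"
  proof (rule conformal_constant_critical[OF gM or comp N])
    show "f \<circ> (\<lambda>p. R *\<^sub>R p) \<in> Diff M N"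
      using f by (intro Diff_comp[OF M N N hR]) (simp add: isometry_def)
    show "tensor2_eq M (pullback M N (f \<circ> (\<lambda>p. R *\<^sub>R p)) g\<^sub>N) (\<lambda>p u v. R\<^sup>2 * g\<^sub>M p u v)"
      by (rule pullback_isometry_comp[OF M N sR f radial_map_pullback[OF M N eM eN sR]])
  qed
qed

end
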